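(* Let $\mathcal{Q}_p[\bigcirc,\Diamond_r]$ be the class of path-shaped queries built with $\bigcirc$ (next) and $\Diamond_r$ (now or later), let $\mathcal{Q}_p[\bigcirc,\Diamond]$ be the class of path-shaped queries built with $\bigcirc$ and strict $\Diamond$, and let "safe" be as defined in the context. Then: (i) A query $q\in\mathcal{Q}_p[\bigcirc,\Diamond_r]$ is uniquely characterisable within $\mathcal{Q}_p[\bigcirc,\Diamond_r]$ if and only if $q$ is safe. (ii) Those queries that are uniquely characterisable within $\mathcal{Q}_p[\bigcirc,\Diamond_r]$ are actually polynomially characterisable within $\mathcal{Q}_p[\bigcirc,\Diamond_r]$: there is a polynomial $f$ such that every $q\in\mathcal{Q}_p[\bigcirc,\Diamond_r]$ that is uniquely characterisable within $\mathcal{Q}_p[\bigcirc,\Diamond_r]$ is uniquely characterised within $\mathcal{Q}_p[\bigcirc,\Diamond_r]$ by some example set $E$ with $|E|\le f(|q|)$. (iii) The class $\mathcal{Q}_p[\bigcirc,\Diamond_r]$ is polynomially characterisable for bounded query size. (iv) The class $\mathcal{Q}_p[\bigcirc,\Diamond]$ is polynomially characterisable (within itself).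
   Context: **Data.** Atomic concepts (atoms) $A,B,\dots$ are taken from a countably infinite supply. A data instance is a finite sequence $\mathcal D=(\delta_0,\dots,\delta_n)$ of finite sets of atoms; it is identified with its extensions $(\delta_0,\dots,\delta_n,\emptyset,\dots,\emptyset)$, so $\delta_\ell=\emptyset$ for $\ell>n$. Its size is $|\mathcal D|=\sum_i|\delta_i|$. **Semantics.** For $\ell\in\mathbb N$: $\mathcal D,\ell\models A$ iff $A\in\delta_\ell$; $\mathcal D,\ell\models\top$ always; conjunction as usual; $\mathcal D,\ell\models\bigcirc q$ iff $\mathcal D,\ell+1\models q$; $\mathcal D,\ell\models\Diamond q$ iff $\mathcal D,m\models q$ for some $m>\ell$; $\mathcal D,\ell\models\Diamond_r q$ iff $\mathcal D,m\models q$ for some $m\ge\ell$. Write $q\models q'$ if $\mathcal D,\ell\models q$ implies $\mathcal D,\ell\models q'$ for all $\mathcal D,\ell$; $q\equiv q'$ if $q\models q'$ and $q'\models q$. $|q|$ is the number of symbols in $q$. **Path queries.** For $\Phi\subseteq\{\bigcirc,\Diamond,\Diamond_r\}$, $\mathcal Q_p[\Phi]$ is the set of queries $\rho_0\wedge o_1(\rho_1\wedge o_2(\rho_2\wedge\dots\wedge o_n\rho_n))$ with $n\ge 0$, $o_i\in\Phi$, and each $\rho_i$ a (possibly empty) conjunction of atoms, identified with a finite set of atoms (the empty conjunction is $\top$). Since $\Diamond q\equiv\bigcirc\Diamond_r q$, every query in $\mathcal Q_p[\bigcirc,\Diamond,\Diamond_r]$ is equivalent to one in $\mathcal Q_p[\bigcirc,\Diamond_r]$.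 **Characterisability.** An example set is a pair $E=(E^+,E^-)$ of finite sets of data instances; $|E|=\sum_{\mathcal D\in E^+\cup E^-}|\mathcal D|$. A query $q$ fits $E$ if $\mathcal D,0\models q$ for all $\mathcal D\in E^+$ and $\mathcal D,0\not\models q$ for all $\mathcal D\in E^-$. $E$ uniquely characterises $q$ within a class $\mathcal Q$ if $q$ fits $E$ and $q\equiv q'$ for every $q'\in\mathcal Q$ fitting $E$; $q$ is uniquely characterisable within $\mathcal Q$ if some $E$ does this. $\mathcal Q$ is polynomially characterisable within $\mathcal Q'\supseteq\mathcal Q$ if there is a polynomial $f$ such that every $q\in\mathcal Q$ is uniquely characterised within $\mathcal Q'$ by some $E$ with $|E|\le f(|q|)$; "polynomially characterisable" without qualification means $\mathcal Q'=\mathcal Q$. $\mathcal Q$ is polynomially characterisable for bounded query size if there is a polynomial $f$ such that for all $n$, every $q\in\mathcal Q^n$ is uniquely characterised within $\mathcal Q^n$ by some $E$ with $|E|\le f(n)$, where $\mathcal Q^n$ is the set of queries in $\mathcal Q$ of size at most $n$. **Normal form, lone conjuncts, safe queries.** A query in $\mathcal Q_p[\bigcirc,\Diamond,\Diamond_r]$ is represented as a sequence $\rho_0(t_0),R_1(t_0,t_1),\rho_1(t_1),\dots,R_n(t_{n-1},t_n),\rho_n(t_n)$ with $R_i\in\{\mathit{suc},<,\le\}$ according to $o_i=\bigcirc,\Diamond,\Diamond_r$. Divide it as $q=q_0\mathcal R_1q_1\dots\mathcal R_nq_n$, where each block $q_i$ is a maximal $\mathit{suc}$-chain $\rho^i_0,\rho^i_1,\dots,\rho^i_{k_i}$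 (consecutive elements related by $\mathit{suc}$, $k_i\ge0$), and each $\mathcal R_i$ is a nonempty sequence of relations from $\{<,\le\}$ leading from the last point of $q_{i-1}$ to the first point of $q_i$, whose intermediate points carry no atoms. A block $q_i$ is primitive if $k_i=0$. A lone conjunct is a primitive block $q_i=\rho^i_0$ with $i>0$ and $|\rho^i_0|\ge2$. The query is in normal form if: (n1) $\rho^i_0\ne\emptyset$ if $i>0$, and $\rho^i_{k_i}\neq\emptyset$ if $i>0$ or $k_i>0$; (n2) each $\mathcal R_i$ is either a single $\le$ or a sequence of $<$; (n3) $\rho^i_{k_i}\not\supseteq\rho^{i+1}_0$ if $q_{i+1}$ is primitive and $\mathcal R_{i+1}$ is $\le$; (n4) $\rho^i_{k_i}\not\subseteq\rho^{i+1}_0$ if $i>0$, $q_i$ is primitive and $\mathcal R_{i+1}$ is $\le$. A query in $\mathcal Q_p[\bigcirc,\Diamond_r]$ is safe if it is equivalent to a query in $\mathcal Q_p[\bigcirc,\Diamond,\Diamond_r]$ in normal form containing no lone conjuncts. *)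

theory Defs
  imports "HOL-Computational_Algebra.Polynomial"
begin

(* nat serves as the countably infinite supply of atoms. *)
type_synonym atom = nat

(* A finite sequence of finite sets, identified with its extensions by empty sets,
   is a finitely supported function from time points to finite sets of atoms. *)
type_synonym data = "nat \<Rightarrow> atom set"

definition data_instance :: "data \<Rightarrow> bool" where
  "data_instance D \<longleftrightarrow> (\<forall>l. finite (D l)) \<and> finite {l. D l \<noteq> {}}"

definition data_size :: "data \<Rightarrow> nat" where
  "data_size D = (\<Sum>l | D l \<noteq> {}. card (D l))"

(* Dia is the strict diamond, DiaR the reflexive one ("now or later").  As relations between
   consecutive points of a path query, Next, Dia, DiaR stand for suc, <, \<le>. *)
datatype tempop = Next | Dia | DiaR

datatype query = Top | Atom atom | And query query | Temp tempop query

fun sat :: "data \<Rightarrow> nat \<Rightarrow> query \<Rightarrow> bool" where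
  "sat D l Top \<longleftrightarrow> True"
| "sat D l (Atom A) \<longleftrightarrow> A \<in> D l"
| "sat D l (And q q') \<longleftrightarrow> sat D l q \<and> sat D l q'"
| "sat D l (Temp Next q) \<longleftrightarrow> sat D (l + 1) q"
| "sat D l (Temp Dia q) \<longleftrightarrow> (\<exists>m>l. sat D m q)"
| "sat D l (Temp DiaR q) \<longleftrightarrow> (\<exists>m\<ge>l. sat D m q)"

definition entails :: "query \<Rightarrow> query \<Rightarrow> bool" where
  "entails q q' \<longleftrightarrow> (\<forall>D l. data_instance D \<longrightarrow> sat D l q \<longrightarrow> sat D l q')"

definition equivalent :: "query \<Rightarrow> query \<Rightarrow> bool" where
  "equivalent q q' \<longleftrightarrow> entails q q' \<and> entails q' q"

(* Number of symbols, brackets not counted. *)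
fun query_size :: "query \<Rightarrow> nat" where
  "query_size Top = 1"
| "query_size (Atom A) = 1"
| "query_size (And q q') = query_size q + query_size q' + 1"
| "query_size (Temp op q) = query_size q + 1"

fun conj_list :: "atom list \<Rightarrow> query" where
  "conj_list [] = Top"
| "conj_list [A] = Atom A"
| "conj_list (A # B # As) = And (Atom A) (conj_list (B # As))"

(* Only for finite sets; listing the atoms in increasing order picks one representative
   of the conjunctions identified with the set. *)
definition conj_set :: "atom set \<Rightarrow> query" where
  "conj_set \<rho> = conj_list (sorted_list_of_set \<rho>)"

(* path_query \<rho>0 [(o1, \<rho>1), ..., (on, \<rho>n)] is \<rho>0 \<and> o1 (\<rho>1 \<and> o2 (\<rho>2 \<and> ... \<and> on \<rho>n)). *)
fun path_query :: "atom set \<Rightarrow> (tempop \<times> atom set) list \<Rightarrow> query" where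
  "path_query \<rho> [] = conj_set \<rho>"
| "path_query \<rho> ((op, \<rho>') # ps) = And (conj_set \<rho>) (Temp op (path_query \<rho>' ps))"

definition Qp :: "tempop set \<Rightarrow> query set" where
  "Qp \<Phi> = {path_query \<rho> ps | \<rho> ps. finite \<rho> \<and> (\<forall>(op, \<rho>') \<in> set ps. op \<in> \<Phi> \<and> finite \<rho>')}"

type_synonym examples = "data set \<times> data set"

definition example_set :: "examples \<Rightarrow> bool" where
  "example_set E \<longleftrightarrow> finite (fst E) \<and> finite (snd E) \<and> (\<forall>D \<in> fst E \<union> snd E. data_instance D)"

definition examples_size :: "examples \<Rightarrow> nat" where
  "examples_size E = (\<Sum>D \<in> fst E \<union> snd E. data_size D)"

definition fits :: "query \<Rightarrow> examples \<Rightarrow> bool" where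
  "fits q E \<longleftrightarrow> (\<forall>D \<in> fst E. sat D 0 q) \<and> (\<forall>D \<in> snd E. \<not> sat D 0 q)"

definition uniquely_characterises :: "examples \<Rightarrow> query \<Rightarrow> query set \<Rightarrow> bool" where
  "uniquely_characterises E q Q \<longleftrightarrow>
     example_set E \<and> fits q E \<and> (\<forall>q' \<in> Q. fits q' E \<longrightarrow> equivalent q q')"

definition uniquely_characterisable :: "query \<Rightarrow> query set \<Rightarrow> bool" where
  "uniquely_characterisable q Q \<longleftrightarrow> (\<exists>E. uniquely_characterises E q Q)"

definition poly_characterisable_within :: "query set \<Rightarrow> query set \<Rightarrow> bool" where
  "poly_characterisable_within Q Q' \<longleftrightarrow> Q \<subseteq> Q' \<and>
     (\<exists>f :: nat poly. \<forall>q \<in> Q. \<exists>E. uniquely_characterises E q Q' \<and>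
        examples_size E \<le> poly f (query_size q))"

abbreviation poly_characterisable :: "query set \<Rightarrow> bool" where
  "poly_characterisable Q \<equiv> poly_characterisable_within Q Q"

definition size_bounded :: "query set \<Rightarrow> nat \<Rightarrow> query set" where
  "size_bounded Q n = {q \<in> Q. query_size q \<le> n}"

definition poly_characterisable_bounded :: "query set \<Rightarrow> bool" where
  "poly_characterisable_bounded Q \<longleftrightarrow>
     (\<exists>f :: nat poly. \<forall>n. \<forall>q \<in> size_bounded Q n. \<exists>E.
        uniquely_characterises E q (size_bounded Q n) \<and> examples_size E \<le> poly f n)"

(* (q0, [(R1, q1), ..., (Rn, qn)]) represents q0 R1 q1 ... Rn qn: a block is the list of atom
   sets along a suc-chain, and each Rj is a list of the relations < (Dia) and \<le> (DiaR). *)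
type_synonym block = "atom set list"
type_synonym division = "block \<times> (tempop list \<times> block) list"

(* Blocks are separated by at least one relation other than suc, so they are automatically
   maximal suc-chains. *)
definition wf_division :: "division \<Rightarrow> bool" where
  "wf_division d \<longleftrightarrow>
     (\<forall>b \<in> insert (fst d) (snd ` set (snd d)). b \<noteq> [] \<and> (\<forall>\<rho> \<in> set b. finite \<rho>)) \<and>
     (\<forall>R \<in> fst ` set (snd d). R \<noteq> [] \<and> set R \<subseteq> {Dia, DiaR})"

(* Every relation of R but the last leads to an intermediate point, which carries no atoms. *)
definition division_steps :: "tempop list \<times> block \<Rightarrow> (tempop \<times> atom set) list" where
  "division_steps = (\<lambda>(R, b).
     map (\<lambda>r. (r, {})) (butlast R) @ (last R, hd b) # map (Pair Next) (tl b))"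

definition division_query :: "division \<Rightarrow> query" where
  "division_query = (\<lambda>(b, ds).
     path_query (hd b) (map (Pair Next) (tl b) @ concat (map division_steps ds)))"

definition is_division_of :: "division \<Rightarrow> query \<Rightarrow> bool" where
  "is_division_of d q \<longleftrightarrow> wf_division d \<and> q = division_query d"

definition last_index :: "division \<Rightarrow> nat" where
  "last_index d = length (snd d)"

definition block_at :: "division \<Rightarrow> nat \<Rightarrow> block" where
  "block_at d i = (fst d # map snd (snd d)) ! i"

(* rel_at d i, for 1 \<le> i \<le> last_index d, leads to the i-th block. *)
definition rel_at :: "division \<Rightarrow> nat \<Rightarrow> tempop list" where
  "rel_at d i = fst (snd d ! (i - 1))"

definition primitive_block :: "block \<Rightarrow> bool" where
  "primitive_block b \<longleftrightarrow> length b = 1"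

definition normal_form :: "division \<Rightarrow> bool" where
  "normal_form d \<longleftrightarrow>
     (\<forall>i \<le> last_index d.
        (i > 0 \<longrightarrow> hd (block_at d i) \<noteq> {}) \<and>
        (i > 0 \<or> \<not> primitive_block (block_at d i) \<longrightarrow> last (block_at d i) \<noteq> {})) \<and>
     (\<forall>i \<in> {1..last_index d}. rel_at d i = [DiaR] \<or> set (rel_at d i) \<subseteq> {Dia}) \<and>
     (\<forall>i < last_index d.
        primitive_block (block_at d (i + 1)) \<and> rel_at d (i + 1) = [DiaR] \<longrightarrow>
        \<not> last (block_at d i) \<supseteq> hd (block_at d (i + 1))) \<and>
     (\<forall>i < last_index d.
        i > 0 \<and> primitive_block (block_at d i) \<and> rel_at d (i + 1) = [DiaR] \<longrightarrow>
        \<not> last (block_at d i) \<subseteq> hd (block_at d (i + 1)))"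

definition lone_conjunct :: "division \<Rightarrow> nat \<Rightarrow> bool" where
  "lone_conjunct d i \<longleftrightarrow> 0 < i \<and> i \<le> last_index d \<and>
     primitive_block (block_at d i) \<and> card (hd (block_at d i)) \<ge> 2"

(* A query may have several divisions, as a point without atoms between two relations from
   {<, \<le>} can count as an intermediate point or as a primitive block; at most one of them
   satisfies normal_form, which rules out the latter choice. *)
definition safe :: "query \<Rightarrow> bool" where
  "safe q \<longleftrightarrow> (\<exists>q' \<in> Qp {Next, Dia, DiaR}. equivalent q q' \<and>
     (\<exists>d. is_division_of d q' \<and> normal_form d \<and> (\<forall>i. \<not> lone_conjunct d i)))"

end

theory Submission
  imports Defs
begin

text \<open>
  A path query is a chain of points joined by steps "one later" or "at least g later" (g = 0 is \<le>,
  and g strict diamonds merge into one step); a match of the query is a map from points to times.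
  In the canonical data of a normal form, the blocks lie far apart. Condition (n3) prevents the
  points from being matched before their own place, and (n4) from being matched behind it, so
  that the normal form has only one match there, and it has none after any of the following
  changes: deleting an atom, pulling a block apart at one of its points, or shortening a gap.
  Conversely, a normal form that agrees with the given one on the canonical data and on all these
  changes is matched in the canonical data with exactly one point over every point, hence equals
  the given one. The exception is a lone conjunct \<rho>, over which a chain
  \<sigma> \<le> \<sigma>' \<le> \<dots> of proper subsets may lie. Such a chain can be detected by a word of proper
  subsets of \<rho> if its length is bounded, and it cannot occur if all steps are strict. Without a
  bound it cannot be excluded, because on data shorter than the chain two neighbours meet.
\<close>

section \<open>Chains and their normal form\<close>

text \<open>The examples have to be built from Q alone, although the competitor Q' may be
  arbitrarily long and have arbitrarily wide gaps. The distance b needs to exceed only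
  \<open>weight Q\<close>, because the data in which every gap of Q has its least width already
  confine Q': a match there ends before time b, so all blocks and gaps of Q' are shorter than b.
  Apart from the comparison of gaps, only one match h of Q' is ever studied, a match in the
  canonical data. Where Q has no match in changed data, h cannot be carried over to them, and what
  obstructs the transfer is a successor step or a missing atom at a known place. This determines how
  many points lie over each point of Q. Over an inner point with empty label there might be none,
  over a point with atoms there might be several, joined by \<le>. The outcome is equality of the
  two chains rather than equivalence, so normal forms are unique. All four statements use the same
  examples; they differ only in the reason why a primitive block after the start has a single point
  over it.\<close>

type_synonym chain = "(nat option \<times> atom set) list"

fun step :: "nat option \<Rightarrow> nat \<Rightarrow> nat \<Rightarrow> bool" where
  "step None x y \<longleftrightarrow> y = Suc x"
| "step (Some g) x y \<longleftrightarrow> x + g \<le> y"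

fun chain_sat :: "data \<Rightarrow> nat \<Rightarrow> chain \<Rightarrow> bool" where
  "chain_sat D x [] \<longleftrightarrow> True"
| "chain_sat D x ((s, \<sigma>) # ps) \<longleftrightarrow> (\<exists>y. step s x y \<and> \<sigma> \<subseteq> D y \<and> chain_sat D y ps)"

text \<open>The recursive \<open>chain_sat\<close> suits rewriting inside a chain, a map of the
  points suits arguments about distances. The step stored at the head is ignored, since the head
  lies at time 0.\<close>

definition hom :: "data \<Rightarrow> chain \<Rightarrow> (nat \<Rightarrow> nat) \<Rightarrow> bool" where
  "hom D Q h \<longleftrightarrow> h 0 = 0 \<and> (\<forall>i<length Q. snd (Q ! i) \<subseteq> D (h i)) \<and>
     (\<forall>i. Suc i < length Q \<longrightarrow> step (fst (Q ! Suc i)) (h i) (h (Suc i)))"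

definition csat :: "data \<Rightarrow> chain \<Rightarrow> bool" where
  "csat D Q \<longleftrightarrow> (\<exists>h. hom D Q h)"

lemma chain_sat_iff:
  "chain_sat D x ps \<longleftrightarrow> (\<exists>h. h 0 = x \<and>
     (\<forall>i<length ps. snd (ps ! i) \<subseteq> D (h (Suc i)) \<and> step (fst (ps ! i)) (h i) (h (Suc i))))"
proof (induction ps arbitrary: x)
  case Nil
  show ?case by (auto intro: exI[of _ "\<lambda>_. x"])
next
  case (Cons p ps)
  obtain s \<sigma> where p: "p = (s, \<sigma>)" by force
  show ?case
  proof
    assume "chain_sat D x (p # ps)"
    then obtain y h where y: "step s x y" "\<sigma> \<subseteq> D y" and h: "h 0 = y"
      "\<forall>i<length ps. snd (ps ! i) \<subseteq> D (h (Suc i)) \<and> step (fst (ps ! i)) (h i) (h (Suc i))"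
      unfolding p by (auto simp: Cons.IH)
    define h' where "h' = case_nat x h"
    have "snd ((p # ps) ! i) \<subseteq> D (h' (Suc i)) \<and> step (fst ((p # ps) ! i)) (h' i) (h' (Suc i))"
      if "i < length (p # ps)" for i
      using that y h by (cases i) (auto simp: h'_def p)
    then show "\<exists>h. h 0 = x \<and> (\<forall>i<length (p # ps). snd ((p # ps) ! i) \<subseteq> D (h (Suc i)) \<and>
        step (fst ((p # ps) ! i)) (h i) (h (Suc i)))"
      by (intro exI[of _ h']) (auto simp: h'_def)
  next
    assume "\<exists>h. h 0 = x \<and> (\<forall>i<length (p # ps). snd ((p # ps) ! i) \<subseteq> D (h (Suc i)) \<and>
        step (fst ((p # ps) ! i)) (h i) (h (Suc i)))"
    then obtain h where h: "h 0 = x" "\<And>i. i < length (p # ps) \<Longrightarrow>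
        snd ((p # ps) ! i) \<subseteq> D (h (Suc i)) \<and> step (fst ((p # ps) ! i)) (h i) (h (Suc i))"
      by auto
    have "chain_sat D (h 1) ps"
      unfolding Cons.IH using h(2)[of "Suc i" for i]
      by (intro exI[of _ "\<lambda>i. h (Suc i)"]) auto
    then show "chain_sat D x (p # ps)"
      using h(1) h(2)[of 0] by (auto simp: p)
  qed
qed

lemma csat_Cons: "csat D ((s, \<rho>) # ps) \<longleftrightarrow> \<rho> \<subseteq> D 0 \<and> chain_sat D 0 ps"
proof -
  have "hom D ((s, \<rho>) # ps) h \<longleftrightarrow> h 0 = 0 \<and> \<rho> \<subseteq> D (h 0) \<and>
     (\<forall>i<length ps. snd (ps ! i) \<subseteq> D (h (Suc i)) \<and> step (fst (ps ! i)) (h i) (h (Suc i)))" for h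
    unfolding hom_def by (auto simp: All_less_Suc2)
  then show ?thesis unfolding csat_def chain_sat_iff by metis
qed

lemma chain_sat_shift: "chain_sat (\<lambda>x. D (x - 1)) (Suc x) ps \<longleftrightarrow> chain_sat D x ps"
proof (induction ps arbitrary: x)
  case (Cons p ps)
  obtain s \<sigma> where p: "p = (s, \<sigma>)" by force
  have "chain_sat (\<lambda>x. D (x - 1)) (Suc x) (p # ps) \<longleftrightarrow>
      (\<exists>y. step s (Suc x) (Suc y) \<and> \<sigma> \<subseteq> D y \<and> chain_sat (\<lambda>x. D (x - 1)) (Suc y) ps)"
  proof -
    have "y = Suc (y - 1)" if "step s (Suc x) y" for y using that by (cases s) auto
    then show ?thesis unfolding p by (simp, metis diff_Suc_1)
  qed
  also have "\<dots> \<longleftrightarrow> chain_sat D x (p # ps)"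
    unfolding Cons.IH p by (cases s) auto
  finally show ?case .
qed simp

text \<open>Reading the head as a successor step from a position before the start lets the
  first point take part in rewriting like every other point.\<close>

lemma csat_shift: "csat D ((None, \<rho>) # ps) \<longleftrightarrow> chain_sat (\<lambda>x. D (x - 1)) 0 ((None, \<rho>) # ps)"
  using chain_sat_shift[of D 0 ps] by (simp add: csat_Cons)

definition chain_equiv :: "chain \<Rightarrow> chain \<Rightarrow> bool" where
  "chain_equiv P Q \<longleftrightarrow> (\<forall>D x. chain_sat D x P = chain_sat D x Q)"

lemma chain_sat_append_cong:
  "(\<And>x. chain_sat D x A = chain_sat D x B) \<Longrightarrow> chain_sat D x (xs @ A) = chain_sat D x (xs @ B)"
  by (induction xs arbitrary: x) auto

lemma chain_equiv_append: "chain_equiv A B \<Longrightarrow> chain_equiv (xs @ A) (xs @ B)"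
  unfolding chain_equiv_def using chain_sat_append_cong by blast

text \<open>The head step carries no meaning; fixing it to \<open>None\<close> gives each chain one
  representation, so that chains can be proved equal, and matches \<open>csat_shift\<close>.\<close>

definition well_formed :: "chain \<Rightarrow> bool" where
  "well_formed Q \<longleftrightarrow> Q \<noteq> [] \<and> fst (Q ! 0) = None \<and> (\<forall>(s, \<sigma>) \<in> set Q. finite \<sigma>)"

lemma chain_equiv_csat:
  assumes "chain_equiv P Q" "well_formed P" "well_formed Q"
  shows "csat D P = csat D Q"
proof -
  obtain \<rho> ps where "P = (None, \<rho>) # ps"
    using assms(2) by (cases P) (auto simp: well_formed_def)
  moreover obtain \<rho>' ps' where "Q = (None, \<rho>') # ps'"
    using assms(3) by (cases Q) (auto simp: well_formed_def)
  ultimately show ?thesis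
    using assms(1) unfolding chain_equiv_def by (simp only: csat_shift)
qed

definition block_begin :: "chain \<Rightarrow> nat \<Rightarrow> bool" where
  "block_begin Q i \<longleftrightarrow> i = 0 \<or> fst (Q ! i) \<noteq> None"

definition block_end :: "chain \<Rightarrow> nat \<Rightarrow> bool" where
  "block_end Q i \<longleftrightarrow> Suc i = length Q \<or> fst (Q ! Suc i) \<noteq> None"

text \<open>The conditions (n1), (n3), (n4); merging consecutive diamonds into one gap leaves
  nothing to say for (n2).\<close>

definition nf :: "chain \<Rightarrow> bool" where
  "nf Q \<longleftrightarrow> well_formed Q \<and>
     (\<forall>i<length Q. 0 < i \<longrightarrow> block_begin Q i \<or> block_end Q i \<longrightarrow> snd (Q ! i) \<noteq> {}) \<and>
     (\<forall>i. Suc i < length Q \<longrightarrow> fst (Q ! Suc i) = Some 0 \<longrightarrow>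
        (block_end Q (Suc i) \<longrightarrow> \<not> snd (Q ! Suc i) \<subseteq> snd (Q ! i)) \<and>
        (0 < i \<and> block_begin Q i \<longrightarrow> \<not> snd (Q ! i) \<subseteq> snd (Q ! Suc i)))"

definition lone :: "chain \<Rightarrow> nat \<Rightarrow> bool" where
  "lone Q i \<longleftrightarrow> 0 < i \<and> i < length Q \<and> block_begin Q i \<and> block_end Q i \<and> card (snd (Q ! i)) \<ge> 2"

definition positive_gaps :: "chain \<Rightarrow> bool" where
  "positive_gaps Q \<longleftrightarrow> Some 0 \<notin> fst ` set Q"

section \<open>Rewriting to normal form\<close>

definition weight :: "chain \<Rightarrow> nat" where
  "weight Q = (\<Sum>(s, \<sigma>)\<leftarrow>Q. 1 + (case s of None \<Rightarrow> 0 | Some g \<Rightarrow> g) + card \<sigma>)"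

text \<open>The last two clauses are carried along for later: \<open>weight\<close> ties the
  examples to the query size, and positive gaps are what remains of the strict diamonds. Termination
  comes from the length.\<close>

definition reduces :: "chain \<Rightarrow> chain \<Rightarrow> bool" where
  "reduces Q Q' \<longleftrightarrow> well_formed Q' \<and> chain_equiv Q Q' \<and> weight Q' \<le> weight Q \<and>
     (positive_gaps Q \<longrightarrow> positive_gaps Q')"

lemma reduces_context:
  assumes "well_formed (xs @ A)" "xs \<noteq> [] \<or> fst (hd A) = fst (hd B) \<and> B \<noteq> []"
    "chain_equiv A B" "weight B \<le> weight A" "\<forall>(s, \<sigma>) \<in> set B. finite \<sigma>"
    "positive_gaps A \<Longrightarrow> positive_gaps B"
  shows "reduces (xs @ A) (xs @ B)"
proof -
  have "A \<noteq> [] \<or> xs \<noteq> []" using assms(1) by (auto simp: well_formed_def)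
  then have "well_formed (xs @ B)"
    using assms(1,2,5) by (cases xs; cases A; cases B) (auto simp: well_formed_def)
  then show ?thesis using assms
    by (auto simp: reduces_def chain_equiv_append weight_def positive_gaps_def)
qed

lemma equiv_drop_last: "chain_equiv [(s, {})] []"
  by (cases s) (auto simp: chain_equiv_def)

lemma equiv_merge_gap_suc: "chain_equiv ((Some g, {}) # (None, \<sigma>) # ys) ((Some (Suc g), \<sigma>) # ys)"
  unfolding chain_equiv_def
  by (auto, metis add_Suc_right not_less_eq_eq Suc_le_D Suc_le_mono)

lemma equiv_merge_gap_gap:
  "chain_equiv ((Some g, {}) # (Some g', \<sigma>) # ys) ((Some (g + g'), \<sigma>) # ys)"
proof -
  have "(\<exists>y. x + g \<le> y \<and> (\<exists>z. y + g' \<le> z \<and> P z)) \<longleftrightarrow> (\<exists>z. x + (g + g') \<le> z \<and> P z)"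
    for x and P :: "nat \<Rightarrow> bool"
    by (metis (no_types, opaque_lifting) add.assoc add_le_mono1 dual_order.trans order_refl)
  then show ?thesis unfolding chain_equiv_def by simp
qed

lemma equiv_merge_suc_gap: "chain_equiv ((None, {}) # (Some g, \<sigma>) # ys) ((Some (Suc g), \<sigma>) # ys)"
  by (auto simp: chain_equiv_def)

lemma equiv_absorb_right_last:
  "\<sigma> \<subseteq> \<tau> \<Longrightarrow> chain_equiv [(s, \<tau>), (Some 0, \<sigma>)] [(s, \<tau>)]"
  by (auto simp: chain_equiv_def)

text \<open>The point labelled \<sigma> can be moved back onto its predecessor, because the gap that
  follows is only easier to satisfy from an earlier time. A following successor step would be
  violated, which explains \<open>block_end\<close> in (n3).\<close>

lemma equiv_absorb_right:
  assumes "\<sigma> \<subseteq> \<tau>"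
  shows "chain_equiv ((s, \<tau>) # (Some 0, \<sigma>) # (Some g, \<upsilon>) # ys) ((s, \<tau>) # (Some g, \<upsilon>) # ys)"
  unfolding chain_equiv_def
proof (intro allI iffI)
  fix D x
  assume "chain_sat D x ((s, \<tau>) # (Some 0, \<sigma>) # (Some g, \<upsilon>) # ys)"
  then show "chain_sat D x ((s, \<tau>) # (Some g, \<upsilon>) # ys)"
    by simp (meson add_le_mono1 le_trans)
next
  fix D x
  assume "chain_sat D x ((s, \<tau>) # (Some g, \<upsilon>) # ys)"
  then show "chain_sat D x ((s, \<tau>) # (Some 0, \<sigma>) # (Some g, \<upsilon>) # ys)"
    using assms by simp (meson order_refl subset_trans)
qed

text \<open>The earlier point can be delayed until it meets the later one, because it is entered by
  a gap. The head of a chain cannot be delayed, which explains 0 < i in (n4).\<close>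

lemma equiv_absorb_left:
  assumes "\<tau> \<subseteq> \<sigma>"
  shows "chain_equiv ((Some g, \<tau>) # (Some 0, \<sigma>) # ys) ((Some g, \<sigma>) # ys)"
  unfolding chain_equiv_def
proof (intro allI iffI)
  fix D x
  assume "chain_sat D x ((Some g, \<tau>) # (Some 0, \<sigma>) # ys)"
  then show "chain_sat D x ((Some g, \<sigma>) # ys)"
    by simp (meson le_trans)
next
  fix D x
  assume "chain_sat D x ((Some g, \<sigma>) # ys)"
  then show "chain_sat D x ((Some g, \<tau>) # (Some 0, \<sigma>) # ys)"
    using assms by simp (meson order_refl subset_trans)
qed

lemma reduce_not_nf:
  assumes wf: "well_formed Q" and "\<not> nf Q"
  obtains Q' where "reduces Q Q'" "length Q' < length Q"
proof -
  note result = that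
  have fin: "\<And>i. i < length Q \<Longrightarrow> finite (snd (Q ! i))"
    using wf by (force simp: well_formed_def dest: nth_mem)
  have split1: "Q = take i Q @ Q ! i # drop (Suc i) Q" if "i < length Q" for i
    using that by (rule id_take_nth_drop)
  have split2: "Q = take i Q @ Q ! i # Q ! Suc i # drop (Suc (Suc i)) Q" if "Suc i < length Q" for i
    using that by (metis Cons_nth_drop_Suc Suc_lessD append_take_drop_id)
  have fin_drop: "\<forall>(s, \<sigma>) \<in> set (drop i Q). finite \<sigma>" for i
    using wf by (auto simp: well_formed_def dest: in_set_dropD)
  have step: ?thesis
    if "Q = xs @ A" "xs \<noteq> [] \<or> fst (hd A) = fst (hd B) \<and> B \<noteq> []"
      "chain_equiv A B" "weight B \<le> weight A" "\<forall>(s, \<sigma>) \<in> set B. finite \<sigma>"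
      "positive_gaps A \<Longrightarrow> positive_gaps B" "length B < length A" for xs A B
    using reduces_context[of xs A B] wf that by (intro result[of "xs @ B"]) auto
  consider (n1) i where "i < length Q" "0 < i" "block_begin Q i \<or> block_end Q i" "snd (Q ! i) = {}"
    | (n3) i where "Suc i < length Q" "fst (Q ! Suc i) = Some 0" "block_end Q (Suc i)"
        "snd (Q ! Suc i) \<subseteq> snd (Q ! i)"
    | (n4) i where "Suc i < length Q" "fst (Q ! Suc i) = Some 0" "0 < i" "block_begin Q i"
        "snd (Q ! i) \<subseteq> snd (Q ! Suc i)"
    using assms unfolding nf_def by blast
  then show ?thesis
  proof cases
    case n1
    have ne: "take i Q \<noteq> []" using n1 by auto
    obtain s where Qi: "Q ! i = (s, {})" using n1 by (metis prod.collapse)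
    show ?thesis
    proof (cases "Suc i = length Q")
      case True
      show ?thesis
        by (rule step[of "take i Q" "[(s, {})]" "[]"])
          (use True n1 split1[of i] Qi ne in \<open>auto simp: equiv_drop_last weight_def positive_gaps_def\<close>)
    next
      case False
      then have lt: "Suc i < length Q" using n1 by auto
      obtain t \<sigma> where Qs: "Q ! Suc i = (t, \<sigma>)" by force
      have fs: "finite \<sigma>" using fin[OF lt] Qs by simp
      let ?ys = "drop (Suc (Suc i)) Q"
      note sp = split2[OF lt, unfolded Qs]
      \<comment> \<open>Two successor steps would make i neither the begin nor the end of a block,
        so this combination is absent.\<close>
      consider (a) g where "fst (Q ! i) = Some g" "t = None"
        | (b) g g' where "fst (Q ! i) = Some g" "t = Some g'"
        | (c) g' where "fst (Q ! i) = None" "t = Some g'"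
        using n1 lt Qs unfolding block_begin_def block_end_def
        by (cases "fst (Q ! i)"; cases t) auto
      then show ?thesis
      proof cases
        case a
        show ?thesis
          by (rule step[of "take i Q" "(Some g, {}) # (None, \<sigma>) # ?ys" "(Some (Suc g), \<sigma>) # ?ys"])
            (use a sp Qi ne fs fin_drop equiv_merge_gap_suc in \<open>auto simp: weight_def positive_gaps_def\<close>)
      next
        case b
        show ?thesis
          by (rule step[of "take i Q" "(Some g, {}) # (Some g', \<sigma>) # ?ys" "(Some (g + g'), \<sigma>) # ?ys"])
            (use b sp Qi ne fs fin_drop equiv_merge_gap_gap in \<open>auto simp: weight_def positive_gaps_def\<close>)
      next
        case c
        show ?thesis
          by (rule step[of "take i Q" "(None, {}) # (Some g', \<sigma>) # ?ys" "(Some (Suc g'), \<sigma>) # ?ys"])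
            (use c sp Qi ne fs fin_drop equiv_merge_suc_gap in \<open>auto simp: weight_def positive_gaps_def\<close>)
      qed
    qed
  next
    case n3
    obtain s \<tau> where Qi: "Q ! i = (s, \<tau>)" by force
    obtain \<sigma> where Qs: "Q ! Suc i = (Some 0, \<sigma>)" using n3 by (metis prod.collapse)
    note sp = split2[OF n3(1), unfolded Qs Qi]
    have ft: "finite \<tau>" using fin[of i] n3 Qi by simp
    have sub: "\<sigma> \<subseteq> \<tau>" using n3 Qi Qs by simp
    show ?thesis
    proof (cases "Suc (Suc i) = length Q")
      case True
      show ?thesis
        by (rule step[of "take i Q" "[(s, \<tau>), (Some 0, \<sigma>)]" "[(s, \<tau>)]"])
          (use True sp ft equiv_absorb_right_last[OF sub] in \<open>auto simp: weight_def positive_gaps_def\<close>)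
    next
      case False
      then have lt: "Suc (Suc i) < length Q" using n3 by auto
      obtain g \<upsilon> where Qss: "Q ! Suc (Suc i) = (Some g, \<upsilon>)"
        using n3(3) False unfolding block_end_def by (cases "Q ! Suc (Suc i)") auto
      let ?ys = "drop (Suc (Suc (Suc i))) Q"
      have fu: "finite \<upsilon>" using fin[OF lt] Qss by simp
      have sp': "Q = take i Q @ (s, \<tau>) # (Some 0, \<sigma>) # (Some g, \<upsilon>) # ?ys"
        using sp Cons_nth_drop_Suc[OF lt] Qss by simp
      show ?thesis
        by (rule step[of "take i Q" "(s, \<tau>) # (Some 0, \<sigma>) # (Some g, \<upsilon>) # ?ys"
                "(s, \<tau>) # (Some g, \<upsilon>) # ?ys"])
          (use sp' ft fu fin_drop equiv_absorb_right[OF sub] in \<open>auto simp: weight_def positive_gaps_def\<close>)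
    qed
  next
    case n4
    obtain g \<tau> where Qi: "Q ! i = (Some g, \<tau>)"
      using n4 unfolding block_begin_def by (cases "Q ! i") auto
    obtain \<sigma> where Qs: "Q ! Suc i = (Some 0, \<sigma>)" using n4 by (metis prod.collapse)
    note sp = split2[OF n4(1), unfolded Qs Qi]
    have fs: "finite \<sigma>" using fin[OF n4(1)] Qs by simp
    have sub: "\<tau> \<subseteq> \<sigma>" using n4 Qi Qs by simp
    let ?ys = "drop (Suc (Suc i)) Q"
    show ?thesis
      by (rule step[of "take i Q" "(Some g, \<tau>) # (Some 0, \<sigma>) # ?ys" "(Some g, \<sigma>) # ?ys"])
        (use sp fs fin_drop equiv_absorb_left[OF sub] n4 in \<open>auto simp: weight_def positive_gaps_def\<close>)
  qed
qed

lemma nf_exists: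
  assumes "well_formed Q"
  obtains Q' where "nf Q'" "reduces Q Q'"
proof -
  have "\<exists>Q'. nf Q' \<and> reduces Q Q'"
    using assms
  proof (induction "length Q" arbitrary: Q rule: less_induct)
    case less
    show ?case
    proof (cases "nf Q")
      case True
      then show ?thesis using less.prems by (auto simp: reduces_def chain_equiv_def)
    next
      case False
      obtain P where P: "reduces Q P" "length P < length Q"
        using reduce_not_nf[OF less.prems False] .
      then have "well_formed P" by (simp add: reduces_def)
      then obtain Q' where "nf Q'" "reduces P Q'" using less.hyps P by blast
      then show ?thesis using P by (auto simp: reduces_def chain_equiv_def intro!: exI[of _ Q'])
    qed
  qed
  then show ?thesis using that by blast
qed

section \<open>Canonical data\<close>

lemma hom_mono:
  assumes "hom D Q h" "i \<le> j" "j < length Q"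
  shows "h i \<le> h j"
  using assms(2,3)
proof (induction rule: dec_induct)
  case (step k)
  then have "step (fst (Q ! Suc k)) (h k) (h (Suc k))"
    using assms(1) by (simp add: hom_def)
  then have "h k \<le> h (Suc k)" by (cases "fst (Q ! Suc k)") auto
  then show ?case using step by simp
qed simp

lemma hom_suc: "hom D Q h \<Longrightarrow> Suc i < length Q \<Longrightarrow> fst (Q ! Suc i) = None \<Longrightarrow> h (Suc i) = Suc (h i)"
  by (auto simp: hom_def)

lemma hom_gap:
  "hom D Q h \<Longrightarrow> Suc i < length Q \<Longrightarrow> fst (Q ! Suc i) = Some g \<Longrightarrow> h i + g \<le> h (Suc i)"
  unfolding hom_def by (metis step.simps(2))

lemma hom_label: "hom D Q h \<Longrightarrow> i < length Q \<Longrightarrow> snd (Q ! i) \<subseteq> D (h i)"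
  by (auto simp: hom_def)

lemma hom_run:
  assumes "hom D Q h" "l \<le> r" "r < length Q" "\<And>j. l < j \<Longrightarrow> j \<le> r \<Longrightarrow> fst (Q ! j) = None"
  shows "h r = h l + (r - l)"
  using assms(2-4)
proof (induction rule: dec_induct)
  case (step k)
  then show ?case using hom_suc[OF assms(1), of k] by simp
qed simp

lemma block_end_ex:
  assumes "i < length Q"
  obtains r where "i \<le> r" "r < length Q" "block_end Q r"
    "\<And>j. i < j \<Longrightarrow> j \<le> r \<Longrightarrow> fst (Q ! j) = None"
proof -
  let ?P = "\<lambda>r. i \<le> r \<and> r < length Q \<and> block_end Q r"
  have "?P (length Q - 1)" using assms by (auto simp: block_end_def)
  then have P: "?P (LEAST r. ?P r)" by (rule LeastI)
  have "fst (Q ! j) = None" if "i < j" "j \<le> (LEAST r. ?P r)" for j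
  proof (rule ccontr)
    assume "fst (Q ! j) \<noteq> None"
    then have "?P (j - 1)" using that P by (auto simp: block_end_def)
    then have "(LEAST r. ?P r) \<le> j - 1" by (rule Least_le)
    then show False using that by simp
  qed
  then show ?thesis using P that by blast
qed

lemma block_begin_ex:
  obtains l where "l \<le> i" "block_begin Q l" "\<And>j. l < j \<Longrightarrow> j \<le> i \<Longrightarrow> fst (Q ! j) = None"
proof -
  let ?P = "\<lambda>l. l \<le> i \<and> block_begin Q l"
  have P0: "?P 0" by (simp add: block_begin_def)
  have b: "\<forall>y. ?P y \<longrightarrow> y \<le> i" by simp
  have P: "?P (GREATEST l. ?P l)" using GreatestI_nat[of ?P, OF P0] by blast
  have "fst (Q ! j) = None" if "(GREATEST l. ?P l) < j" "j \<le> i" for j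
  proof (rule ccontr)
    assume "fst (Q ! j) \<noteq> None"
    then have "?P j" using that by (auto simp: block_begin_def)
    then have "j \<le> (GREATEST l. ?P l)" using Greatest_le_nat[of ?P j i] by blast
    then show False using that by simp
  qed
  then show ?thesis using P that by blast
qed

lemma nf_nonempty:
  "nf Q \<Longrightarrow> i < length Q \<Longrightarrow> 0 < i \<Longrightarrow> block_begin Q i \<or> block_end Q i \<Longrightarrow> snd (Q ! i) \<noteq> {}"
  by (auto simp: nf_def)

lemma nf_not_subset_left:
  "nf Q \<Longrightarrow> Suc i < length Q \<Longrightarrow> fst (Q ! Suc i) = Some 0 \<Longrightarrow> block_end Q (Suc i) \<Longrightarrow>
   \<not> snd (Q ! Suc i) \<subseteq> snd (Q ! i)"
  by (auto simp: nf_def)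

lemma nf_not_subset_right:
  "nf Q \<Longrightarrow> Suc i < length Q \<Longrightarrow> fst (Q ! Suc i) = Some 0 \<Longrightarrow> 0 < i \<Longrightarrow> block_begin Q i \<Longrightarrow>
   \<not> snd (Q ! i) \<subseteq> snd (Q ! Suc i)"
  by (auto simp: nf_def)

lemma nf_length: "nf Q \<Longrightarrow> 0 < length Q"
  by (auto simp: nf_def well_formed_def)

lemma nf_finite: "nf Q \<Longrightarrow> i < length Q \<Longrightarrow> finite (snd (Q ! i))"
  by (auto simp: nf_def well_formed_def) (metis nth_mem prod.collapse case_prodD)

lemma nf_head: "nf Q \<Longrightarrow> fst (Q ! 0) = None"
  by (auto simp: nf_def well_formed_def)

text \<open>A distance of \<open>length Q\<close> cannot be bridged by a block of Q: a block with
  one point at an end of such a stretch has its remaining points strictly inside it. The widths of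
  the gaps in Q do not enter.\<close>

definition spaced :: "chain \<Rightarrow> (nat \<Rightarrow> nat) \<Rightarrow> nat \<Rightarrow> bool" where
  "spaced Q p i \<longleftrightarrow> (if fst (Q ! Suc i) = None then p (Suc i) = Suc (p i) else p i + length Q \<le> p (Suc i))"

lemma spaced_less:
  assumes "\<And>i. l \<le> i \<Longrightarrow> i < m \<Longrightarrow> spaced Q p i" "length Q > 0" "l \<le> i" "i < j" "j \<le> m"
  shows "p i < p j"
proof -
  have "Suc i \<le> j" using assms(4) by simp
  then show ?thesis using assms(5)
  proof (induction rule: dec_induct)
    case base
    then show ?case using assms(1)[of i] assms(2,3) by (auto simp: spaced_def simp del: length_greater_0_conv split: if_splits)
  next
    case (step k)
    then show ?case using assms(1)[of k] assms(2,3) by (auto simp: spaced_def simp del: length_greater_0_conv split: if_splits)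
  qed
qed

text \<open>By (n3), no block can be squeezed into the end of its predecessor, so on data that
  contain the points up to the m-th far apart, nothing can be matched ahead of its own place.\<close>

lemma hom_lower:
  assumes Q: "nf Q" and h: "hom D Q h" and m: "m < length Q"
    and p0: "p 0 = 0" and sp: "\<And>i. i < m \<Longrightarrow> spaced Q p i"
    and lab: "\<And>i. i < m \<Longrightarrow> D (p i) \<subseteq> snd (Q ! i)"
    and emp: "\<And>x. x < p m \<Longrightarrow> x \<notin> p ` {..<m} \<Longrightarrow> D x = {}"
  shows "i \<le> m \<Longrightarrow> p i \<le> h i"
proof (induction i)
  case 0
  then show ?case using p0 by simp
next
  case (Suc i)
  have n: "length Q > 0" using m by linarith
  have less: "p i' < p j" if "i' < j" "j \<le> m" for i' j
    using spaced_less[of 0 m Q p i' j] sp n that by simp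
  have Si: "Suc i < length Q" "i < m" using Suc m by auto
  have le: "p i \<le> h i" using Suc by simp
  have spi: "spaced Q p i" using sp Si by blast
  show ?case
  proof (cases "fst (Q ! Suc i)")
    case None
    then show ?thesis using spi hom_suc[OF h Si(1)] le by (simp add: spaced_def)
  next
    case (Some g)
    have gap: "p i + length Q \<le> p (Suc i)" using spi Some by (simp add: spaced_def)
    have hs: "h i + g \<le> h (Suc i)" using hom_gap[OF h Si(1) Some] .
    have pm: "p (Suc i) \<le> p m" using less[of "Suc i" m] Si by (cases "Suc i = m") auto
    have empty_between: "D x = {}" if "p i < x" "x < p (Suc i)" for x
    proof (rule emp)
      show "x < p m" using that pm by simp
      show "x \<notin> p ` {..<m}"
      proof
        assume "x \<in> p ` {..<m}"
        then obtain j where j: "j < m" "x = p j" by auto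
        then have "i < j" using that less[of j i] Si by (cases "j = i") (auto intro: ccontr)
        then have "p (Suc i) \<le> p j" using less[of "Suc i" j] j by (cases "Suc i = j") auto
        then show False using that j by simp
      qed
    qed
    show ?thesis
    proof (rule ccontr)
      assume "\<not> p (Suc i) \<le> h (Suc i)"
      then have lt: "h (Suc i) < p (Suc i)" by simp
      have "snd (Q ! Suc i) \<noteq> {}"
        using nf_nonempty[OF Q Si(1)] Some by (simp add: block_begin_def)
      then have "D (h (Suc i)) \<noteq> {}" using hom_label[OF h Si(1)] by auto
      then have eq: "h (Suc i) = p i"
        using empty_between[of "h (Suc i)"] lt hs le by force
      then have g: "g = 0" using hs le by simp
      have sub: "snd (Q ! Suc i) \<subseteq> snd (Q ! i)"
        using hom_label[OF h Si(1)] lab[OF Si(2)] eq by auto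
      \<comment> \<open>If the block entered at \<open>Suc i\<close> has further points, its end
        falls into the empty stretch after \<open>p i\<close>, although (n1) gives it atoms; if it
        has none, its label violates (n3).\<close>
      obtain r where r: "Suc i \<le> r" "r < length Q" "block_end Q r"
          "\<And>j. Suc i < j \<Longrightarrow> j \<le> r \<Longrightarrow> fst (Q ! j) = None"
        using block_end_ex[OF Si(1)] by blast
      have "r \<noteq> Suc i"
        using r nf_not_subset_left[OF Q Si(1)] Some g sub by auto
      then have "p i < h r" "h r < p (Suc i)"
        using hom_run[OF h r(1,2)] r gap eq by auto
      then have "D (h r) = {}" by (rule empty_between)
      moreover have "snd (Q ! r) \<noteq> {}" using nf_nonempty[OF Q r(2)] r by auto
      ultimately show False using hom_label[OF h r(2)] by auto
    qed
  qed
qed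

text \<open>The mirror image, by (n4).\<close>

lemma hom_upper:
  assumes Q: "nf Q" and h: "hom D Q h"
    and sp: "\<And>i. m \<le> i \<Longrightarrow> Suc i < length Q \<Longrightarrow> spaced Q p i"
    and lab: "\<And>i. m < i \<Longrightarrow> i < length Q \<Longrightarrow> D (p i) \<subseteq> snd (Q ! i)"
    and emp: "\<And>x. p m < x \<Longrightarrow> x \<notin> p ` {m<..<length Q} \<Longrightarrow> D x = {}"
    and i: "m \<le> i" "i < length Q"
  shows "h i \<le> p i"
proof -
  let ?n = "length Q"
  have n: "?n > 0" using i by linarith
  have less: "p i' < p j" if "m \<le> i'" "i' < j" "j < ?n" for i' j
    using spaced_less[of m "?n - 1" Q p i' j] sp n that by simp
  have "i \<le> ?n - 1" using i by simp
  then show ?thesis using i(1)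
  proof (induction rule: inc_induct)
    case base
    show ?case
    proof (cases "?n = 1")
      case True
      then show ?thesis using h by (simp add: hom_def)
    next
      case False
      then have l: "?n - 1 < ?n" "0 < ?n - 1" "block_end Q (?n - 1)" using n
        by (auto simp: block_end_def simp del: length_greater_0_conv)
      have "snd (Q ! (?n - 1)) \<noteq> {}" using nf_nonempty[OF Q l(1,2)] l(3) by simp
      then have "D (h (?n - 1)) \<noteq> {}" using hom_label[OF h l(1)] by auto
      then have "h (?n - 1) \<le> p m \<or> h (?n - 1) \<in> p ` {m<..<?n}" using emp[of "h (?n - 1)"] by force
      moreover have *: "p j \<le> p (?n - 1)" if "m \<le> j" "j < ?n" for j
      proof (cases "j = ?n - 1")
        case False
        then have "j < ?n - 1" using that by linarith
        then show ?thesis using less[of j "?n - 1"] that l by simp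
      qed simp
      ultimately show ?thesis using *[of m, OF order_refl le_less_trans[OF i]] by auto
    qed
  next
    case (step i)
    then have Si: "Suc i < ?n" "m \<le> i" by auto
    have le: "h (Suc i) \<le> p (Suc i)" using step by simp
    have spi: "spaced Q p i" using sp Si by blast
    show ?case
    proof (cases "fst (Q ! Suc i)")
      case None
      then show ?thesis using spi hom_suc[OF h Si(1)] le by (simp add: spaced_def)
    next
      case (Some g)
      have gap: "p i + ?n \<le> p (Suc i)" using spi Some by (simp add: spaced_def)
      have hs: "h i + g \<le> h (Suc i)" using hom_gap[OF h Si(1) Some] .
      have pm: "p m \<le> p i" using less[of m i] Si by (cases "i = m") auto
      have empty_between: "D x = {}" if "p i < x" "x < p (Suc i)" for x
      proof (rule emp)
        show "p m < x" using that pm by simp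
        show "x \<notin> p ` {m<..<?n}"
        proof
          assume "x \<in> p ` {m<..<?n}"
          then obtain j where j: "m < j" "j < ?n" "x = p j" by auto
          then have "i < j" using that less[of j i] Si by (cases "j = i") (auto intro: ccontr)
          then have "p (Suc i) \<le> p j" using less[of "Suc i" j] j Si by (cases "Suc i = j") auto
          then show False using that j by simp
        qed
      qed
      show ?thesis
      proof (rule ccontr)
        assume "\<not> h i \<le> p i"
        then have gt: "p i < h i" by simp
        have i0: "0 < i" using h gt by (auto simp: hom_def intro: ccontr)
        have "snd (Q ! i) \<noteq> {}"
          using nf_nonempty[OF Q, of i] Si i0 Some by (simp add: block_end_def)
        then have "D (h i) \<noteq> {}" using hom_label[OF h, of i] Si by auto
        then have eq: "h i = p (Suc i)"
          using empty_between[of "h i"] gt hs le by force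
        then have g: "g = 0" "h (Suc i) = h i" using hs le by auto
        have sub: "snd (Q ! i) \<subseteq> snd (Q ! Suc i)"
          using hom_label[OF h, of i] lab[of "Suc i"] Si eq by auto
        obtain l where l: "l \<le> i" "block_begin Q l" "\<And>j. l < j \<Longrightarrow> j \<le> i \<Longrightarrow> fst (Q ! j) = None"
          using block_begin_ex by blast
        have "l \<noteq> i"
          using l nf_not_subset_right[OF Q Si(1)] Some g sub i0 by auto
        then have *: "p i < h l" "h l < p (Suc i)"
          using hom_run[OF h l(1)] l Si gap eq by auto
        then have "D (h l) = {}" by (rule empty_between)
        \<comment> \<open>The head may be empty in a normal form, so (n1) yields atoms only for l >
          0; the head lies at time 0 and thus not beyond \<open>p i\<close>.\<close>
        moreover have "l \<noteq> 0" using * h by (cases "l = 0") (simp_all add: hom_def)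
        then have "snd (Q ! l) \<noteq> {}" using nf_nonempty[OF Q, of l] l Si by auto
        ultimately show False using hom_label[OF h, of l] l Si by auto
      qed
    qed
  qed
qed

section \<open>Data planted at prescribed positions\<close>

fun pos :: "(nat \<Rightarrow> nat) \<Rightarrow> chain \<Rightarrow> nat \<Rightarrow> nat" where
  "pos w Q 0 = 0"
| "pos w Q (Suc i) = pos w Q i + (if fst (Q ! Suc i) = None then 1 else w (Suc i))"

text \<open>A union, because points share a time when a gap is given width 0.\<close>

definition plant :: "chain \<Rightarrow> (nat \<Rightarrow> nat) \<Rightarrow> data" where
  "plant Q p x = (\<Union>i\<in>{i. i < length Q \<and> p i = x}. snd (Q ! i))"

abbreviation cpos :: "nat \<Rightarrow> chain \<Rightarrow> nat \<Rightarrow> nat" where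
  "cpos b \<equiv> pos (\<lambda>_. b)"

text \<open>Canonical data in which the word w of length k takes the place of point m.\<close>

definition insert_word :: "nat \<Rightarrow> chain \<Rightarrow> nat \<Rightarrow> nat \<Rightarrow> (nat \<Rightarrow> atom set) \<Rightarrow> data" where
  "insert_word b Q m k w x =
     (if x < cpos b Q m then plant Q (cpos b Q) x
      else if x < cpos b Q m + k then w (x - cpos b Q m)
      else plant Q (cpos b Q) (x + 1 - k))"

lemma cpos_less:
  assumes "b > 0" "i < j"
  shows "cpos b Q i < cpos b Q j"
proof -
  have "strict_mono (cpos b Q)" using assms by (simp add: strict_mono_Suc_iff)
  then show ?thesis using assms by (simp add: strict_mono_less)
qed

lemma cpos_less_iff: "b > 0 \<Longrightarrow> cpos b Q i < cpos b Q j \<longleftrightarrow> i < j"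
  by (metis cpos_less not_less_iff_gr_or_eq)

lemma cpos_inj: "b > 0 \<Longrightarrow> cpos b Q i = cpos b Q j \<longleftrightarrow> i = j"
  by (metis cpos_less less_irrefl nat_neq_iff)

lemma cpos_spaced: "length Q \<le> b \<Longrightarrow> spaced Q (cpos b Q) i"
  by (auto simp: spaced_def)

lemma plant_cpos: "b > 0 \<Longrightarrow> i < length Q \<Longrightarrow> plant Q (cpos b Q) (cpos b Q i) = snd (Q ! i)"
  by (auto simp: plant_def cpos_inj)

lemma plant_empty: "x \<notin> p ` {..<length Q} \<Longrightarrow> plant Q p x = {}"
  by (auto simp: plant_def)

lemma insert_word_before:
  "x < cpos b Q m \<Longrightarrow> insert_word b Q m k w x = plant Q (cpos b Q) x"
  by (simp add: insert_word_def)

lemma insert_word_in: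
  "t < k \<Longrightarrow> insert_word b Q m k w (cpos b Q m + t) = w t"
  by (simp add: insert_word_def)

lemma insert_word_after:
  "cpos b Q m < x \<Longrightarrow> k > 0 \<Longrightarrow> insert_word b Q m k w (x + k - 1) = plant Q (cpos b Q) x"
  by (auto simp: insert_word_def)

text \<open>Both estimates leave the data at their own point m arbitrary. The lower one is applied
  at the first letter of the word, the upper one at the last letter with all positions shifted by k
  - 1, so together they force point m into the word.\<close>

lemma insert_word_hom_bounds:
  assumes Q: "nf Q" and b: "length Q \<le> b" and m: "m < length Q" and k: "k > 0"
    and h: "hom (insert_word b Q m k w) Q h"
  shows "i \<le> m \<Longrightarrow> cpos b Q i \<le> h i"
    and "m \<le> i \<Longrightarrow> i < length Q \<Longrightarrow> h i \<le> cpos b Q i + k - 1"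
proof -
  have b0: "b > 0" using b nf_length[OF Q] by linarith
  let ?p = "cpos b Q" and ?D = "insert_word b Q m k w"
  show "?p i \<le> h i" if "i \<le> m"
  proof (rule hom_lower[OF Q h m _ cpos_spaced[OF b] _ _ that])
    show "?D (?p i) \<subseteq> snd (Q ! i)" if "i < m" for i
      using that m by (simp add: insert_word_before cpos_less[OF b0] plant_cpos[OF b0])
    show "?D x = {}" if "x < ?p m" "x \<notin> ?p ` {..<m}" for x
    proof -
      have "x \<notin> ?p ` {..<length Q}" using that cpos_less_iff[OF b0] by auto
      then show ?thesis using that by (simp add: insert_word_before plant_empty)
    qed
  qed simp
  let ?p' = "\<lambda>i. cpos b Q i + (k - 1)"
  have "h i \<le> ?p' i" if "m \<le> i" "i < length Q"
  proof (rule hom_upper[OF Q h _ _ _ that, where p = ?p'])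
    show "spaced Q ?p' i" for i
      using cpos_spaced[OF b, of i] by (auto simp: spaced_def)
    show "?D (?p' i) \<subseteq> snd (Q ! i)" if "m < i" "i < length Q" for i
      using that k insert_word_after[OF cpos_less[OF b0 that(1)] k] by (simp add: plant_cpos[OF b0])
    show "?D x = {}" if "?p' m < x" "x \<notin> ?p' ` {m<..<length Q}" for x
    proof -
      define y where "y = x - (k - 1)"
      have x: "x = y + k - 1" and y: "?p m < y" using that k by (auto simp: y_def)
      have "y \<notin> ?p ` {..<length Q}"
      proof
        assume "y \<in> ?p ` {..<length Q}"
        then obtain j where "j < length Q" "y = ?p j" by auto
        then show False using y that(2) x k cpos_less_iff[OF b0] by auto
      qed
      then show ?thesis using x insert_word_after[OF y k] by (simp add: plant_empty)
    qed
  qed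
  then show "m \<le> i \<Longrightarrow> i < length Q \<Longrightarrow> h i \<le> ?p i + k - 1" using k by simp
qed

text \<open>The main way to refute Q: replace point m by any word, however long, none of whose
  letters contains the label of m.\<close>

lemma insert_word_letter:
  assumes "nf Q" "length Q \<le> b" "m < length Q" "k > 0" "csat (insert_word b Q m k w) Q"
  obtains t where "t < k" "snd (Q ! m) \<subseteq> w t"
proof -
  obtain h where h: "hom (insert_word b Q m k w) Q h" using assms by (auto simp: csat_def)
  note bd = insert_word_hom_bounds[OF assms(1-4) h, of m]
  define t where "t = h m - cpos b Q m"
  have t: "t < k" "h m = cpos b Q m + t" using bd assms by (auto simp: t_def)
  then have "snd (Q ! m) \<subseteq> w t"
    using hom_label[OF h assms(3)] insert_word_in[OF t(1)] by metis
  then show ?thesis using t that by blast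
qed

text \<open>This pulls a block apart: everything before m keeps the copy \<sigma>, everything after
  m keeps the copy \<tau>, and the b - 1 empty times between the copies exceed what a block can
  span.\<close>

definition split_point :: "nat \<Rightarrow> chain \<Rightarrow> nat \<Rightarrow> atom set \<Rightarrow> atom set \<Rightarrow> data" where
  "split_point b Q m \<sigma> \<tau> =
     insert_word b Q m (Suc b) (\<lambda>t. if t = 0 then \<sigma> else if t = b then \<tau> else {})"

text \<open>Both ends of the block around m carry atoms or lie at time 0, so neither falls between
  the copies, and the block is too short to have one end on each side. If it lies on the left, it
  must end with m at \<sigma>; if on the right, it must begin with m at \<tau>, which the head
  cannot do.\<close>

lemma split_point_sat:
  assumes Q: "nf Q" and b: "length Q \<le> b" and m: "m < length Q"
    and sat: "csat (split_point b Q m \<sigma> \<tau>) Q"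
  shows "block_end Q m \<and> snd (Q ! m) \<subseteq> \<sigma> \<or> block_begin Q m \<and> m \<noteq> 0 \<and> snd (Q ! m) \<subseteq> \<tau>"
proof -
  let ?p = "cpos b Q" and ?D = "split_point b Q m \<sigma> \<tau>"
  have b0: "b > 0" using b m by simp
  obtain h where h: "hom ?D Q h" using sat by (auto simp: csat_def)
  note bd = insert_word_hom_bounds[OF Q b m _ h[unfolded split_point_def]]
  have gap: "?D x = {}" if "?p m < x" "x < ?p m + b" for x
    using that unfolding split_point_def insert_word_def by auto
  have at0: "?D (?p m) = \<sigma>" using b0 by (simp add: split_point_def insert_word_def)
  have at1: "?D (?p m + b) = \<tau>" using b0 by (simp add: split_point_def insert_word_def)
  obtain l where l: "l \<le> m" "block_begin Q l" "\<And>j. l < j \<Longrightarrow> j \<le> m \<Longrightarrow> fst (Q ! j) = None"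
    using block_begin_ex by blast
  obtain r where r: "m \<le> r" "r < length Q" "block_end Q r"
      "\<And>j. m < j \<Longrightarrow> j \<le> r \<Longrightarrow> fst (Q ! j) = None"
    using block_end_ex[OF m] by blast
  have run1: "h m = h l + (m - l)" by (rule hom_run[OF h l(1) m l(3)])
  have run2: "h r = h m + (r - m)" by (rule hom_run[OF h r(1,2,4)])
  have hm: "?p m \<le> h m" "h m \<le> ?p m + b" using bd(1)[of m] bd(2)[of m] m by auto
  have hl: "h l \<le> ?p m \<or> ?p m + b \<le> h l"
  proof (cases "l = 0")
    case True
    then show ?thesis using h by (simp add: hom_def)
  next
    case False
    then have "snd (Q ! l) \<noteq> {}" using nf_nonempty[OF Q, of l] l m by auto
    then have "?D (h l) \<noteq> {}" using hom_label[OF h, of l] l m by auto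
    then show ?thesis using gap[of "h l"] by linarith
  qed
  have hr: "h r \<le> ?p m \<or> ?p m + b \<le> h r"
  proof (cases "r = 0")
    case True
    then show ?thesis using h by (simp add: hom_def)
  next
    case False
    then have "snd (Q ! r) \<noteq> {}" using nf_nonempty[OF Q, of r] r by auto
    then have "?D (h r) \<noteq> {}" using hom_label[OF h, of r] r by auto
    then show ?thesis using gap[of "h r"] by linarith
  qed
  have "r - l < b" using r b by simp
  then consider "h r \<le> ?p m" | "?p m + b \<le> h l" using hl hr run1 run2 l r by linarith
  then show ?thesis
  proof cases
    case 1
    then have "h m = ?p m" "r = m" using run2 hm r by auto
    then show ?thesis using r hom_label[OF h m] at0 by auto
  next
    case 2
    then have "h m = ?p m + b" "l = m" using run1 hm l by auto
    moreover have "m \<noteq> 0"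
    proof
      assume "m = 0"
      then show False using calculation h b0 by (simp add: hom_def)
    qed
    ultimately show ?thesis using l hom_label[OF h m] at1 by auto
  qed
qed

text \<open>All gaps are wide except the one into \<open>Suc m\<close>. The lower estimate applies
  up to m and the upper one from \<open>Suc m\<close> on, so the two points are matched at most e
  apart. This includes e = 0, where both are planted at one time, since neither estimate restricts
  the data at its own point.\<close>

lemma tight_gap:
  assumes Q: "nf Q" and b: "length Q \<le> b" and m: "Suc m < length Q" and g: "fst (Q ! Suc m) = Some g"
    and sat: "csat (plant Q (pos ((\<lambda>_. b)(Suc m := e)) Q)) Q"
  shows "g \<le> e"
proof -
  let ?p = "pos ((\<lambda>_. b)(Suc m := e)) Q"
  let ?D = "plant Q ?p"
  obtain h where h: "hom ?D Q h" using sat by (auto simp: csat_def)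
  have n: "length Q > 0" using m by linarith
  have sp: "spaced Q ?p i" if "i \<noteq> m" for i using that b by (auto simp: spaced_def)
  have pSm: "?p (Suc m) = ?p m + e" using g by simp
  have less1: "?p i < ?p j" if "i < j" "j \<le> m" for i j
    using spaced_less[of 0 m Q ?p i j] sp n that by simp
  have less2: "?p i < ?p j" if "Suc m \<le> i" "i < j" for i j
    using spaced_less[of "Suc m" j Q ?p i j] sp n that by simp
  have le1: "?p i \<le> ?p m" if "i \<le> m" for i
    using less1[of i m] that by (cases "i = m") auto
  have le2: "?p (Suc m) \<le> ?p i" if "Suc m \<le> i" for i
    using less2[of "Suc m" i] that by (cases "i = Suc m") auto
  have "?p m \<le> h m"
  proof (rule hom_lower[OF Q h, of m ?p])
    show "?D (?p i) \<subseteq> snd (Q ! i)" if "i < m" for i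
    proof -
      have "j = i" if "?p j = ?p i" for j
      proof (rule ccontr)
        assume "j \<noteq> i"
        then have "j < i \<or> i < j" by auto
        then show False
          using that less1[of i j] less1[of j i] less1[of i m] le2[of j] pSm \<open>i < m\<close>
          by (cases "j \<le> m") (auto simp: not_le)
      qed
      then show ?thesis by (auto simp: plant_def)
    qed
    show "?D x = {}" if "x < ?p m" "x \<notin> ?p ` {..<m}" for x
    proof (rule plant_empty)
      show "x \<notin> ?p ` {..<length Q}"
      proof
        assume "x \<in> ?p ` {..<length Q}"
        then obtain j where "x = ?p j" by auto
        moreover have "j \<ge> m" using that(2) calculation by (auto simp: not_less intro: ccontr)
        ultimately show False using that(1) le2[of j] pSm by (cases "j = m") auto
      qed
    qed
  qed (use m sp in auto)
  moreover have "h (Suc m) \<le> ?p (Suc m)"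
  proof (rule hom_upper[OF Q h, where m = "Suc m" and p = ?p])
    show "?D (?p i) \<subseteq> snd (Q ! i)" if "Suc m < i" "i < length Q" for i
    proof -
      have "j = i" if "?p j = ?p i" for j
      proof (rule ccontr)
        assume "j \<noteq> i"
        then have "j < i \<or> i < j" by auto
        then show False
          using that less2[of i j] less2[of j i] less2[of "Suc m" i] le1[of j] pSm \<open>Suc m < i\<close>
          by (cases "j \<le> m") (auto simp: not_le)
      qed
      then show ?thesis by (auto simp: plant_def)
    qed
    show "?D x = {}" if "?p (Suc m) < x" "x \<notin> ?p ` {Suc m<..<length Q}" for x
    proof (rule plant_empty)
      show "x \<notin> ?p ` {..<length Q}"
      proof
        assume "x \<in> ?p ` {..<length Q}"
        then obtain j where "x = ?p j" "j < length Q" by auto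
        moreover have "j \<le> Suc m" using that(2) calculation by (auto simp: not_less intro: ccontr)
        ultimately show False using that(1) le1[of j] pSm by (cases "j = Suc m") auto
      qed
    qed
  qed (use m sp in auto)
  ultimately show ?thesis using hom_gap[OF h m g] pSm by simp
qed

lemma hom_pos:
  assumes "\<And>i g. Suc i < length Q \<Longrightarrow> fst (Q ! Suc i) = Some g \<Longrightarrow> g \<le> w (Suc i)"
  shows "hom (plant Q (pos w Q)) Q (pos w Q)"
proof -
  have "step (fst (Q ! Suc i)) (pos w Q i) (pos w Q (Suc i))" if "Suc i < length Q" for i
    using assms[of i] that by (cases "fst (Q ! Suc i)") auto
  then show ?thesis unfolding hom_def plant_def by auto
qed

section \<open>The candidate data\<close>

definition gap :: "nat option \<Rightarrow> nat" where
  "gap s = (case s of None \<Rightarrow> 0 | Some g \<Rightarrow> g)"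

abbreviation gaps :: "chain \<Rightarrow> nat \<Rightarrow> nat" where
  "gaps Q i \<equiv> gap (fst (Q ! i))"

definition weaken :: "atom set \<Rightarrow> atom set set" where
  "weaken \<rho> = insert \<rho> ((\<lambda>A. \<rho> - {A}) ` \<rho>)"

lemma weaken_self: "\<rho> \<in> weaken \<rho>"
  by (simp add: weaken_def)

lemma weaken_delete: "A \<in> \<rho> \<Longrightarrow> \<rho> - {A} \<in> weaken \<rho>"
  by (simp add: weaken_def)

text \<open>Its first N * card \<rho> letters run N times through all ways of deleting one atom from \<rho>.\<close>

definition deletion_word :: "atom set \<Rightarrow> nat \<Rightarrow> atom set" where
  "deletion_word \<rho> t = \<rho> - {sorted_list_of_set \<rho> ! (t mod card \<rho>)}"

text \<open>The second instance gives every gap its least width and serves to confine competitors.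
  Split points come with each copy either complete or lacking an atom, because which copy has to be
  damaged to refute Q depends on where m lies in its block. The widths g and g - 1 bound a gap from
  both sides. \<open>N\<close> bounds the length of the competitors, where such a bound is
  available.\<close>

definition candidates :: "nat \<Rightarrow> nat \<Rightarrow> chain \<Rightarrow> data set" where
  "candidates b N Q =
     {plant Q (cpos b Q), plant Q (pos (gaps Q) Q)} \<union>
     (\<Union>m<length Q. (\<lambda>A. insert_word b Q m 1 (\<lambda>_. snd (Q ! m) - {A})) ` snd (Q ! m)) \<union>
     (\<Union>m<length Q. (\<lambda>(\<sigma>, \<tau>). split_point b Q m \<sigma> \<tau>) ` (weaken (snd (Q ! m)) \<times> weaken (snd (Q ! m)))) \<union>
     (\<lambda>m. insert_word b Q m (N * card (snd (Q ! m))) (deletion_word (snd (Q ! m)))) ` {..<length Q} \<union>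
     (\<Union>m<length Q. (\<lambda>e. plant Q (pos ((\<lambda>_. b)(m := e)) Q)) ` {gaps Q m, gaps Q m - 1})"

text \<open>Delay all points from k on by b. The only step that notices is the one into k, and a gap
  tolerates the delay. The points over m are then distributed between the two copies.\<close>

lemma split_point_cut:
  assumes b: "b > 0" and h: "hom (plant Q (cpos b Q)) Q' h"
    and k: "0 < k" "k < length Q' \<Longrightarrow> fst (Q' ! k) \<noteq> None"
    and left: "\<And>i. i < length Q' \<Longrightarrow> i < k \<Longrightarrow> h i \<le> cpos b Q m"
    and right: "\<And>i. i < length Q' \<Longrightarrow> k \<le> i \<Longrightarrow> cpos b Q m \<le> h i"
    and \<sigma>: "\<And>i. i < length Q' \<Longrightarrow> i < k \<Longrightarrow> h i = cpos b Q m \<Longrightarrow> snd (Q' ! i) \<subseteq> \<sigma>"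
    and \<tau>: "\<And>i. i < length Q' \<Longrightarrow> k \<le> i \<Longrightarrow> h i = cpos b Q m \<Longrightarrow> snd (Q' ! i) \<subseteq> \<tau>"
  shows "csat (split_point b Q m \<sigma> \<tau>) Q'"
proof -
  let ?D = "split_point b Q m \<sigma> \<tau>" and ?p = "cpos b Q"
  define h' where "h' i = (if i < k then h i else h i + b)" for i
  have "snd (Q' ! i) \<subseteq> ?D (h' i)" if i: "i < length Q'" for i
  proof (cases "i < k")
    case True
    consider "h i < ?p m" | "h i = ?p m" using left[OF i True] by linarith
    then show ?thesis
    proof cases
      case 1
      then show ?thesis using hom_label[OF h i] True
        by (simp add: h'_def split_point_def insert_word_before)
    next
      case 2
      then show ?thesis using \<sigma>[OF i True] True
        by (simp add: h'_def split_point_def insert_word_def)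
    qed
  next
    case False
    consider "?p m < h i" | "h i = ?p m" using right[OF i] False by linarith
    then show ?thesis
    proof cases
      case 1
      then show ?thesis using hom_label[OF h i] False insert_word_after[OF 1, of "Suc b"]
        by (simp add: h'_def split_point_def)
    next
      case 2
      then show ?thesis using \<tau>[OF i] False b
        by (simp add: h'_def split_point_def insert_word_def)
    qed
  qed
  moreover have "step (fst (Q' ! Suc i)) (h' i) (h' (Suc i))" if i: "Suc i < length Q'" for i
  proof (cases "Suc i = k")
    case True
    then obtain g where "fst (Q' ! Suc i) = Some g" using k i by auto
    then show ?thesis using True hom_gap[OF h i] by (simp add: h'_def)
  next
    case False
    have "step (fst (Q' ! Suc i)) (h i) (h (Suc i))" using h i by (simp add: hom_def)
    then show ?thesis using False by (cases "fst (Q' ! Suc i)") (auto simp: h'_def)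
  qed
  moreover have "h' 0 = 0" using h k by (simp add: h'_def hom_def)
  ultimately show ?thesis unfolding csat_def hom_def by blast
qed

section \<open>Estimates by the weight\<close>

lemma weight_Cons: "weight ((s, \<sigma>) # ps) = 1 + gap s + card \<sigma> + weight ps"
  by (simp add: weight_def gap_def)

lemma weight_append: "weight (xs @ ys) = weight xs + weight ys"
  by (simp add: weight_def)

lemma length_le_weight: "length Q \<le> weight Q"
  by (induction Q) (auto simp: weight_Cons)

lemma weight_take: "weight (take i Q) \<le> weight Q"
  by (metis append_take_drop_id le_add1 weight_append)

lemma gap_card_le_weight: "i < length Q \<Longrightarrow> gaps Q i + card (snd (Q ! i)) \<le> weight Q"
proof (induction Q arbitrary: i)
  case (Cons q Q)
  obtain s \<sigma> where "q = (s, \<sigma>)" by force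
  then show ?case using Cons.prems Cons.IH[of "i - 1"] by (cases i) (auto simp: weight_Cons)
qed simp

lemma tight_pos_less: "i < length Q \<Longrightarrow> pos (gaps Q) Q i < weight Q"
proof -
  have "pos (gaps Q) Q i < weight (take (Suc i) Q)" if "i < length Q" for i
    using that
  proof (induction i)
    case 0
    then show ?case by (cases Q) (auto simp: weight_Cons)
  next
    case (Suc i)
    obtain s \<sigma> where s: "Q ! Suc i = (s, \<sigma>)" by force
    have "weight (take (Suc (Suc i)) Q) = weight (take (Suc i) Q) + (1 + gap s + card \<sigma>)"
      using Suc.prems s by (simp add: take_Suc_conv_app_nth[of "Suc i"] weight_append weight_Cons weight_def[of "[]"])
    then show ?case using Suc s by (cases s) (auto simp: gap_def)
  qed
  then show "i < length Q \<Longrightarrow> ?thesis" using weight_take less_le_trans by blast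
qed

lemma cut_exists:
  fixes h :: "nat \<Rightarrow> nat"
  assumes "\<And>i j. i \<le> j \<Longrightarrow> j < n \<Longrightarrow> h i \<le> h j"
  obtains a where "a \<le> n" "\<And>i. i < n \<Longrightarrow> h i < x \<longleftrightarrow> i < a"
proof -
  define a where "a = (LEAST i. i = n \<or> x \<le> h i)"
  have 1: "a = n \<or> x \<le> h a" unfolding a_def by (rule LeastI[of _ n]) simp
  have 2: "a \<le> n" unfolding a_def by (rule Least_le) simp
  have 3: "\<not> x \<le> h i" if "i < a" for i using not_less_Least[of i] that unfolding a_def by blast
  have "h i < x \<longleftrightarrow> i < a" if "i < n" for i
    using 1 2 3[of i] assms[of a i] that by (cases "i < a") auto
  then show ?thesis using 2 that by blast
qed

section \<open>A competitor that agrees on all candidates\<close>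

locale agreeing =
  fixes Q Q' :: chain and b N :: nat
  assumes Q: "nf Q" and Q': "nf Q'" and b: "weight Q < b"
    and agree: "\<And>D. D \<in> candidates b N Q \<Longrightarrow> csat D Q \<longleftrightarrow> csat D Q'"
begin

lemma b_length: "length Q < b"
  using b length_le_weight[of Q] by simp

lemma b_pos: "b > 0" "b \<ge> 2"
  using b_length nf_length[OF Q] by linarith+

lemma tight_hom: obtains t where "hom (plant Q (pos (gaps Q) Q)) Q' t"
proof -
  have "csat (plant Q (pos (gaps Q) Q)) Q"
    unfolding csat_def by (rule exI, rule hom_pos) (simp add: gap_def)
  then have "csat (plant Q (pos (gaps Q) Q)) Q'" by (subst agree[symmetric]) (auto simp: candidates_def)
  then show ?thesis using that by (auto simp: csat_def)
qed

text \<open>By (n1) the last point carries atoms, unless it is the head, so it lies on a planted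
  point; in the tight data these all precede \<open>weight Q\<close>. This is where Q', about which
  nothing was known, gets blocks and gaps shorter than b.\<close>

lemma tight_hom_less:
  assumes t: "hom (plant Q (pos (gaps Q) Q)) Q' t" and i: "i < length Q'"
  shows "t i < b"
proof (cases "length Q' = 1")
  case True
  then show ?thesis using t i b_pos by (simp add: hom_def)
next
  case False
  let ?r = "length Q' - 1"
  have r: "?r < length Q'" "0 < ?r" "block_end Q' ?r" using i False by (auto simp: block_end_def)
  then have "snd (Q' ! ?r) \<noteq> {}" using nf_nonempty[OF Q'] by blast
  then have "plant Q (pos (gaps Q) Q) (t ?r) \<noteq> {}" using hom_label[OF t r(1)] by auto
  then obtain j where "j < length Q" "t ?r = pos (gaps Q) Q j" using plant_empty by blast
  then have "t ?r < b" using tight_pos_less[of j Q] b by simp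
  moreover have "t i \<le> t ?r" using hom_mono[OF t _ r(1)] i by simp
  ultimately show ?thesis by simp
qed

lemma run_short:
  assumes "l \<le> r" "r < length Q'" "\<And>j. l < j \<Longrightarrow> j \<le> r \<Longrightarrow> fst (Q' ! j) = None"
  shows "r - l < b"
proof -
  obtain t where t: "hom (plant Q (pos (gaps Q) Q)) Q' t" by (rule tight_hom)
  show ?thesis using hom_run[OF t assms] tight_hom_less[OF t assms(2)] by simp
qed

lemma gap_short:
  assumes "Suc i < length Q'" "fst (Q' ! Suc i) = Some g"
  shows "g < b"
proof -
  obtain t where t: "hom (plant Q (pos (gaps Q) Q)) Q' t" by (rule tight_hom)
  show ?thesis using hom_gap[OF t assms] tight_hom_less[OF t assms(1)] by simp
qed

abbreviation "p \<equiv> cpos b Q"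

lemma p_less: "p i < p j \<longleftrightarrow> i < j" using cpos_less_iff[OF b_pos(1)] .
lemma p_le: "p i \<le> p j \<longleftrightarrow> i \<le> j" using p_less by (metis not_less)

text \<open>Every gap of Q contributes the full distance b, so points less than b apart belong to
  the same block.\<close>

lemma p_close:
  assumes "i \<le> j" "p j < p i + b"
  shows "p j = p i + (j - i)"
  using assms
proof (induction rule: dec_induct)
  case (step k)
  then have "p k < p i + b" using p_less[of k "Suc k"] by simp
  moreover have "fst (Q ! Suc k) = None"
    using step.prems step.hyps p_le[of i k] by (auto split: if_splits)
  ultimately show ?case using step by simp
qed simp

lemma canon_hom: obtains h where "hom (plant Q p) Q' h"
proof -
  have "csat (plant Q p) Q"
    unfolding csat_def
  proof (rule exI, rule hom_pos)
    fix i g assume "Suc i < length Q" "fst (Q ! Suc i) = Some g"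
    then show "g \<le> b" using gap_card_le_weight[of "Suc i" Q] b by (simp add: gap_def)
  qed
  then have "csat (plant Q p) Q'" by (subst agree[symmetric]) (auto simp: candidates_def)
  then show ?thesis using that by (auto simp: csat_def)
qed

end

locale agreeing_hom = agreeing +
  fixes h assumes h: "hom (plant Q p) Q' h"
begin

lemma nonempty_pos: "i < length Q' \<Longrightarrow> snd (Q' ! i) \<noteq> {} \<Longrightarrow> \<exists>j<length Q. h i = p j"
  using hom_label[OF h, of i] plant_empty[of "h i" p Q] by auto

text \<open>This is clear only for points with atoms and for the head. An inner point lies between
  the two ends of its block, which are on planted points; as the block is shorter than b, these
  belong to one block of Q, which occupies every time in between.\<close>

lemma hom_range:
  assumes i: "i < length Q'"
  obtains j where "j < length Q" "h i = p j"
proof -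
  obtain l where l: "l \<le> i" "block_begin Q' l" "\<And>j. l < j \<Longrightarrow> j \<le> i \<Longrightarrow> fst (Q' ! j) = None"
    using block_begin_ex by blast
  obtain r where r: "i \<le> r" "r < length Q'" "block_end Q' r"
      "\<And>j. i < j \<Longrightarrow> j \<le> r \<Longrightarrow> fst (Q' ! j) = None"
    using block_end_ex[OF i] by blast
  have at0: "h 0 = p 0" "0 < length Q" using h nf_length[OF Q] by (simp_all add: hom_def)
  have "\<exists>j<length Q. h l = p j"
    using at0 nonempty_pos[of l] nf_nonempty[OF Q', of l] l i by (cases "l = 0") auto
  then obtain jl where jl: "jl < length Q" "h l = p jl" by blast
  have "\<exists>j<length Q. h r = p j"
    using at0 nonempty_pos[of r] nf_nonempty[OF Q', of r] r by (cases "r = 0") auto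
  then obtain jr where jr: "jr < length Q" "h r = p jr" by blast
  have run: "fst (Q' ! j) = None" if "l < j" "j \<le> r" for j using l(3) r(4) that by (cases "j \<le> i") auto
  have hi: "h i = h l + (i - l)" using hom_run[OF h l(1) i] l(3) by blast
  have hr: "h r = h l + (r - l)" by (rule hom_run[OF h _ r(2) run]) (use l r in simp)
  have "r - l < b" using run_short[OF _ r(2) run] l r by simp
  then have le: "jl \<le> jr" "p jr < p jl + b" using hr jl jr p_le[of jl jr] by auto
  then have pr: "p jr = p jl + (jr - jl)" by (rule p_close)
  have ij: "i - l \<le> jr - jl" using pr hr jl jr r l by linarith
  have "p (jl + (i - l)) = p jl + (i - l)"
  proof -
    have "p (jl + (i - l)) \<le> p jr" using ij le by (simp add: p_le)
    then show ?thesis using p_close[of jl "jl + (i - l)"] le by simp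
  qed
  then show ?thesis using that[of "jl + (i - l)"] hi jl jr ij le by auto
qed

text \<open>As b is at least 2, the time just before the begin of a later block is not planted,
  whereas every point of Q' lies on a planted time.\<close>

lemma suc_into_begin:
  assumes m: "0 < m" "m < length Q" "block_begin Q m"
    and i: "Suc i < length Q'" "h (Suc i) = p m"
  shows "fst (Q' ! Suc i) \<noteq> None"
proof
  assume "fst (Q' ! Suc i) = None"
  then have *: "p m = Suc (h i)" using hom_suc[OF h i(1)] i by simp
  obtain j where j: "h i = p j" using hom_range[of i] i by auto
  obtain m' where m': "m = Suc m'" using m by (cases m) auto
  have "j \<le> m'" using * j p_less[of j m] m' by simp
  then have "p j \<le> p m'" by (simp add: p_le)
  moreover have "p m = p m' + b" using m m' by (auto simp: block_begin_def)
  ultimately show False using * j b_pos by simp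
qed

lemma suc_from_end:
  assumes m: "m < length Q" "block_end Q m"
    and i: "Suc i < length Q'" "h i = p m"
  shows "fst (Q' ! Suc i) \<noteq> None"
proof
  assume "fst (Q' ! Suc i) = None"
  then have *: "h (Suc i) = Suc (p m)" using hom_suc[OF h i(1)] i by simp
  obtain j where j: "h (Suc i) = p j" "j < length Q" using hom_range[of "Suc i"] i by auto
  have "Suc m \<le> j" using * j p_less[of m j] by simp
  then have "p (Suc m) \<le> p j" "Suc m < length Q" using j by (simp_all only: p_le)
  moreover have "p (Suc m) = p m + b" using m calculation by (auto simp: block_end_def)
  ultimately show False using * j b_pos by simp
qed

text \<open>Deleting A at m refutes Q and hence Q'. So h must break there, and the only thing it can
  lose is A at a point over m.\<close>

lemma atom_covered:
  assumes m: "m < length Q" and A: "A \<in> snd (Q ! m)"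
  obtains i where "i < length Q'" "h i = p m" "A \<in> snd (Q' ! i)"
proof -
  let ?D = "insert_word b Q m 1 (\<lambda>_. snd (Q ! m) - {A})"
  have "?D \<in> candidates b N Q" using m A unfolding candidates_def by blast
  moreover have "\<not> csat ?D Q"
  proof
    assume "csat ?D Q"
    then obtain t :: nat where "snd (Q ! m) \<subseteq> snd (Q ! m) - {A}"
      using insert_word_letter[OF Q less_imp_le[OF b_length] m zero_less_one] by metis
    then show False using A by blast
  qed
  ultimately have "\<not> csat ?D Q'" using agree by blast
  then have "\<not> hom ?D Q' h" by (auto simp: csat_def)
  then obtain i where i: "i < length Q'" "\<not> snd (Q' ! i) \<subseteq> ?D (h i)" using h by (auto simp: hom_def)
  have D: "?D x = (if x = p m then snd (Q ! m) - {A} else plant Q p x)" for x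
    by (auto simp: insert_word_def)
  have "snd (Q' ! i) \<subseteq> plant Q p (h i)" using hom_label[OF h i(1)] .
  then have "h i = p m" "A \<in> snd (Q' ! i)"
    using i(2)[unfolded D] plant_cpos[OF b_pos(1) m] by (auto split: if_splits)
  then show ?thesis using i that by blast
qed

text \<open>By monotonicity the points over m form an interval from a to c, with c excluded. It may
  still be empty, as the label of m may be.\<close>

lemma fibre:
  assumes m: "m < length Q"
  obtains a c where "a \<le> c" "0 < c" "c \<le> length Q'" "a = 0 \<longleftrightarrow> m = 0"
    "\<And>i. i < length Q' \<Longrightarrow> h i < p m \<longleftrightarrow> i < a"
    "\<And>i. i < length Q' \<Longrightarrow> h i \<le> p m \<longleftrightarrow> i < c"
proof -
  note mono = hom_mono[OF h]
  have n: "0 < length Q'" using nf_length[OF Q'] .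
  have h0: "h 0 = 0" using h by (simp add: hom_def)
  obtain a where a: "a \<le> length Q'" "\<And>i. i < length Q' \<Longrightarrow> h i < p m \<longleftrightarrow> i < a"
    using cut_exists[of "length Q'" h "p m", OF mono] by blast
  obtain c where c: "c \<le> length Q'" "\<And>i. i < length Q' \<Longrightarrow> h i < Suc (p m) \<longleftrightarrow> i < c"
    using cut_exists[of "length Q'" h "Suc (p m)", OF mono] by blast
  have "a \<le> c"
  proof (rule ccontr)
    assume "\<not> a \<le> c"
    then show False using a(2)[of c] c(2)[of c] a(1) by simp
  qed
  moreover have "0 < c" using c(2)[OF n] h0 by simp
  moreover have "a = 0 \<longleftrightarrow> m = 0" using a(2)[OF n] h0 p_less[of 0 m] by auto
  ultimately show ?thesis using a c that by (simp add: less_Suc_eq_le)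
qed

section \<open>The points over one point of Q\<close>

context
  fixes m a c :: nat
  assumes m: "m < length Q" and ac: "a \<le> c" "0 < c" "c \<le> length Q'" "a = 0 \<longleftrightarrow> m = 0"
    and a: "\<And>i. i < length Q' \<Longrightarrow> h i < p m \<longleftrightarrow> i < a"
    and c: "\<And>i. i < length Q' \<Longrightarrow> h i \<le> p m \<longleftrightarrow> i < c"
begin

lemma fibre_iff: "i < length Q' \<Longrightarrow> h i = p m \<longleftrightarrow> a \<le> i \<and> i < c"
  using a[of i] c[of i] by linarith

lemma fibre_label: "a \<le> i \<Longrightarrow> i < c \<Longrightarrow> snd (Q' ! i) \<subseteq> snd (Q ! m)"
  using hom_label[OF h, of i] ac fibre_iff[of i] plant_cpos[OF b_pos(1) m] by simp

lemma fibre_gap: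
  assumes "a < i" "i < c"
  shows "fst (Q' ! i) = Some 0"
proof -
  obtain j where j: "i = Suc j" using assms by (cases i) auto
  have lt: "Suc j < length Q'" using assms ac j by simp
  have eq: "h j = p m" "h (Suc j) = p m" using fibre_iff[of j] fibre_iff[of i] lt assms j by auto
  show ?thesis
    using hom_suc[OF h lt] hom_gap[OF h lt] eq j by (cases "fst (Q' ! i)") auto
qed

lemma fibre_begin: "block_begin Q m \<Longrightarrow> m \<noteq> 0 \<Longrightarrow> a < c \<Longrightarrow> fst (Q' ! a) \<noteq> None"
  using suc_into_begin[OF _ m, of "a - 1"] ac fibre_iff[of a] by simp

lemma fibre_end: "block_end Q m \<Longrightarrow> a < c \<Longrightarrow> c < length Q' \<Longrightarrow> fst (Q' ! c) \<noteq> None"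
  using suc_from_end[OF m, of "c - 1"] ac fibre_iff[of "c - 1"] by simp

lemma fibre_covers:
  assumes "A \<in> snd (Q ! m)"
  obtains i where "a \<le> i" "i < c" "A \<in> snd (Q' ! i)"
  using atom_covered[OF m assms] fibre_iff that by metis

text \<open>If Q has no match in the split data, then h must not be transferable by cutting before
  k. Since the labels on both sides fit the copies, the only possible obstacle is a successor step
  into k. Cutting behind the last point is always possible, hence k <
  \<open>length Q'\<close>.\<close>

lemma cut_fails:
  assumes k: "0 < k" "a \<le> k" "k \<le> c" and \<sigma>: "\<sigma> \<in> weaken (snd (Q ! m))" and \<tau>: "\<tau> \<in> weaken (snd (Q ! m))"
    and left: "\<And>i. a \<le> i \<Longrightarrow> i < k \<Longrightarrow> snd (Q' ! i) \<subseteq> \<sigma>"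
    and right: "\<And>i. k \<le> i \<Longrightarrow> i < c \<Longrightarrow> snd (Q' ! i) \<subseteq> \<tau>"
    and no: "\<not> (block_end Q m \<and> snd (Q ! m) \<subseteq> \<sigma>)"
      "\<not> (block_begin Q m \<and> m \<noteq> 0 \<and> snd (Q ! m) \<subseteq> \<tau>)"
  shows "k < length Q' \<and> fst (Q' ! k) = None"
proof (rule ccontr)
  assume *: "\<not> ?thesis"
  have "csat (split_point b Q m \<sigma> \<tau>) Q'"
  proof (rule split_point_cut[OF b_pos(1) h k(1)])
    show "h i \<le> p m" if "i < length Q'" "i < k" for i using that c k by simp
    show "p m \<le> h i" if "i < length Q'" "k \<le> i" for i using that a[of i] k by simp
    show "snd (Q' ! i) \<subseteq> \<sigma>" if "i < length Q'" "i < k" "h i = p m" for i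
      using that fibre_iff[of i] left by simp
    show "snd (Q' ! i) \<subseteq> \<tau>" if "i < length Q'" "k \<le> i" "h i = p m" for i
      using that fibre_iff[of i] right by simp
  qed (use * in auto)
  moreover have "split_point b Q m \<sigma> \<tau> \<in> candidates b N Q"
    using m \<sigma> \<tau> unfolding candidates_def by fast
  ultimately have "csat (split_point b Q m \<sigma> \<tau>) Q" using agree by blast
  then show False using split_point_sat[OF Q less_imp_le[OF b_length] m] no by blast
qed

lemma fibre_nonempty: "snd (Q ! m) \<noteq> {} \<Longrightarrow> a < c"
  using fibre_covers by (metis all_not_in_conv le_less_trans)

lemma fibre_single_label:
  assumes "c = Suc a" shows "snd (Q' ! a) = snd (Q ! m)"
proof
  show "snd (Q' ! a) \<subseteq> snd (Q ! m)" using fibre_label assms by simp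
  show "snd (Q ! m) \<subseteq> snd (Q' ! a)"
  proof
    fix A assume "A \<in> snd (Q ! m)"
    then obtain i where "a \<le> i" "i < c" "A \<in> snd (Q' ! i)" by (rule fibre_covers)
    then show "A \<in> snd (Q' ! a)" using assms by (simp add: le_less_Suc_eq)
  qed
qed

text \<open>An inner point of a block admits no split at all, so every cut from a to c must hit a
  successor step. Steps between points at the same time are no successor steps, which leaves at most
  one point; with none, the successor step into a would jump over \<open>p m\<close>.\<close>

lemma fibre_inner:
  assumes "\<not> block_begin Q m" "\<not> block_end Q m"
  shows "c = Suc a" "c < length Q' \<and> fst (Q' ! c) = None"
proof -
  have m0: "m \<noteq> 0" using assms by (auto simp: block_begin_def)
  have cut: "k < length Q' \<and> fst (Q' ! k) = None" if "a \<le> k" "k \<le> c" for k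
  proof (rule cut_fails[of k "snd (Q ! m)" "snd (Q ! m)"])
    show "0 < k" using that ac m0 by linarith
  qed (use that ac assms fibre_label weaken_self in auto)
  show "c < length Q' \<and> fst (Q' ! c) = None" using cut ac by simp
  have "a < c"
  proof (rule ccontr)
    assume "\<not> a < c"
    then have "c = a" using ac by simp
    then have a1: "a < length Q'" "fst (Q' ! a) = None" "0 < a" using cut[of a] ac by auto
    then have "h a = Suc (h (a - 1))" using hom_suc[OF h, of "a - 1"] by simp
    moreover have "h (a - 1) < p m" "\<not> h a \<le> p m" using a1 a[of "a - 1"] c[of a] \<open>c = a\<close> by auto
    ultimately show False by simp
  qed
  moreover have "\<not> Suc a < c" using cut[of "Suc a"] fibre_gap[of "Suc a"] by auto
  ultimately show "c = Suc a" by simp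
qed

text \<open>Only splits whose right copy is damaged refute Q. They force the last point over m to
  have the full label, for if it lacked A, the cut just before it would be possible with A removed
  on the right. A point before it would have a smaller label and violate (n4) in Q'.\<close>

lemma fibre_begin_only:
  assumes "block_begin Q m" "\<not> block_end Q m" "m \<noteq> 0"
  shows "c = Suc a" "c < length Q' \<and> fst (Q' ! c) = None"
proof -
  let ?\<rho> = "snd (Q ! m)"
  have ne: "?\<rho> \<noteq> {}" using nf_nonempty[OF Q m] assms by simp
  then have "a < c" by (rule fibre_nonempty)
  have a0: "0 < a" using ac assms by simp
  obtain A0 where A0: "A0 \<in> ?\<rho>" using ne by blast
  \<comment> \<open>For the cut at c no point over m remains on the right, so the damaged copy
    imposes nothing and A0 is arbitrary.\<close>
  show "c < length Q' \<and> fst (Q' ! c) = None"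
    by (rule cut_fails[of c ?\<rho> "?\<rho> - {A0}"])
      (use ac A0 assms fibre_label weaken_self weaken_delete in auto)
  have into: "fst (Q' ! i) \<noteq> None" if "a \<le> i" "i < c" for i
    using that fibre_gap[of i] fibre_begin assms by (cases "i = a") auto
  have "?\<rho> \<subseteq> snd (Q' ! (c - 1))"
  proof
    fix A assume A: "A \<in> ?\<rho>"
    show "A \<in> snd (Q' ! (c - 1))"
    proof (rule ccontr)
      assume nA: "A \<notin> snd (Q' ! (c - 1))"
      have "fst (Q' ! (c - 1)) = None"
      proof (rule cut_fails[of "c - 1" ?\<rho> "?\<rho> - {A}", THEN conjunct2])
        show "snd (Q' ! i) \<subseteq> ?\<rho> - {A}" if "c - 1 \<le> i" "i < c" for i
        proof -
          have "i = c - 1" "a \<le> i" using that \<open>a < c\<close> by linarith+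
          then show ?thesis using nA fibre_label[of i] that by auto
        qed
      qed (use A a0 \<open>a < c\<close> assms fibre_label weaken_self weaken_delete in auto)
      moreover have "a \<le> c - 1" "c - 1 < c" using \<open>a < c\<close> by linarith+
      ultimately show False using into by blast
    qed
  qed
  moreover have "\<not> Suc a < c"
  proof
    assume that: "Suc a < c"
    define d where "d = c - 2"
    then have d: "c = Suc (Suc d)" "a \<le> d" using that by auto
    have "\<not> snd (Q' ! d) \<subseteq> snd (Q' ! Suc d)"
      using nf_not_subset_right[OF Q', of d] d ac a0 fibre_gap[of "Suc d"] into[of d]
      by (auto simp: block_begin_def)
    then show False using calculation fibre_label[of d] d by auto
  qed
  ultimately show "c = Suc a" using \<open>a < c\<close> by linarith
qed

text \<open>The head is pinned to the left copy and its block cannot reach across the void, so even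
  undamaged copies refute Q.\<close>

lemma fibre_start_only:
  assumes "m = 0" "\<not> block_end Q m"
  shows "c = Suc a" "c < length Q' \<and> fst (Q' ! c) = None"
proof -
  have cut: "k < length Q' \<and> fst (Q' ! k) = None" if "0 < k" "k \<le> c" for k
    by (rule cut_fails[of k "snd (Q ! m)" "snd (Q ! m)"])
      (use that ac assms fibre_label weaken_self in auto)
  show "c < length Q' \<and> fst (Q' ! c) = None" using cut ac by simp
  have "\<not> 1 < c" using cut[of 1] fibre_gap[of 1] ac assms by auto
  then show "c = Suc a" using ac assms by simp
qed

text \<open>The mirror image of \<open>fibre_begin_only\<close>, with the left copy damaged and with
  (n3): now the first point over m has the full label. A primitive block at the start belongs here,
  because the head cannot use the right copy.\<close>

lemma fibre_end_only:
  assumes "m = 0 \<or> \<not> block_begin Q m" "block_end Q m"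
  shows "c = Suc a"
proof -
  let ?\<rho> = "snd (Q ! m)"
  have "a < c" using fibre_nonempty nf_nonempty[OF Q m] assms ac by (cases "m = 0") auto
  have out: "fst (Q' ! i) \<noteq> None" if "a < i" "i \<le> c" "i < length Q'" for i
    using that fibre_gap[of i] fibre_end assms by (cases "i = c") auto
  have "?\<rho> \<subseteq> snd (Q' ! a)"
  proof
    fix A assume A: "A \<in> ?\<rho>"
    show "A \<in> snd (Q' ! a)"
    proof (rule ccontr)
      assume nA: "A \<notin> snd (Q' ! a)"
      have "Suc a < length Q' \<and> fst (Q' ! Suc a) = None"
      proof (rule cut_fails[of "Suc a" "?\<rho> - {A}" ?\<rho>])
        show "snd (Q' ! i) \<subseteq> ?\<rho> - {A}" if "a \<le> i" "i < Suc a" for i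
        proof -
          have "i = a" using that by simp
          then show ?thesis using nA fibre_label[of i] \<open>a < c\<close> by auto
        qed
      qed (use A \<open>a < c\<close> assms fibre_label weaken_self weaken_delete in auto)
      then show False using out[of "Suc a"] \<open>a < c\<close> by simp
    qed
  qed
  moreover have "\<not> Suc a < c"
  proof
    assume that: "Suc a < c"
    have "Suc (Suc a) = length Q' \<or> Suc (Suc a) < length Q'" using that ac by linarith
    then have "\<not> snd (Q' ! Suc a) \<subseteq> snd (Q' ! a)"
      using nf_not_subset_left[OF Q', of a] that ac fibre_gap[of "Suc a"] out[of "Suc (Suc a)"]
      by (auto simp: block_end_def)
    then show False using calculation fibre_label[of "Suc a"] that by auto
  qed
  ultimately show ?thesis using \<open>a < c\<close> by linarith
qed

text \<open>All labels over m are subsets of the label of m. A point directly before the full one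
  would thus violate (n4), and a point directly after it (n3).\<close>

lemma fibre_primitive_full:
  assumes "block_begin Q m" "block_end Q m" "m \<noteq> 0"
    and i: "a \<le> i" "i < c" "snd (Q' ! i) = snd (Q ! m)"
  shows "c = Suc a"
proof -
  have "a < c" using i by simp
  have a0: "0 < a" using ac assms by simp
  have out: "fst (Q' ! j) \<noteq> None" if "a < j" "j \<le> c" "j < length Q'" for j
    using that fibre_gap[of j] fibre_end assms \<open>a < c\<close> by (cases "j = c") auto
  have into: "fst (Q' ! j) \<noteq> None" if "a \<le> j" "j < c" for j
    using that fibre_gap[of j] fibre_begin assms by (cases "j = a") auto
  have "\<not> a < i"
  proof
    assume "a < i"
    then obtain j where j: "i = Suc j" "a \<le> j" by (cases i) auto
    then have "\<not> snd (Q' ! j) \<subseteq> snd (Q' ! i)"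
      using nf_not_subset_right[OF Q', of j] i ac a0 fibre_gap[of i] into[of j]
      by (auto simp: block_begin_def)
    then show False using i j fibre_label[of j] by auto
  qed
  moreover have "\<not> Suc i < c"
  proof
    assume "Suc i < c"
    moreover from this have "Suc (Suc i) = length Q' \<or> Suc (Suc i) < length Q'" using ac by linarith
    ultimately have "\<not> snd (Q' ! Suc i) \<subseteq> snd (Q' ! i)"
      using nf_not_subset_left[OF Q', of i] i ac fibre_gap[of "Suc i"] out[of "Suc (Suc i)"]
      by (auto simp: block_end_def)
    then show False using i \<open>Suc i < c\<close> fibre_label[of "Suc i"] by auto
  qed
  ultimately show ?thesis using i by linarith
qed

text \<open>If every point over m lacks some atom, the points can be spread over the rounds of the
  deletion word: point i goes to round i - a and there to the letter that omits its missing atom.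
  \<open>N\<close> rounds suffice, and Q' is matched although no letter admits the label of
  m.\<close>

lemma fibre_deletion_word:
  assumes mb: "block_begin Q m" "block_end Q m" "m \<noteq> 0" and N: "length Q' \<le> N"
    and miss: "\<And>i. a \<le> i \<Longrightarrow> i < c \<Longrightarrow> snd (Q' ! i) \<noteq> snd (Q ! m)"
  shows False
proof -
  let ?\<rho> = "snd (Q ! m)" let ?q = "card ?\<rho>" let ?w = "deletion_word ?\<rho>"
  let ?D = "insert_word b Q m (N * ?q) ?w"
  have fin: "finite ?\<rho>" using nf_finite[OF Q m] .
  have ne: "?\<rho> \<noteq> {}" using nf_nonempty[OF Q m] mb by simp
  have "a < c" using fibre_nonempty[OF ne] .
  have q: "0 < ?q" using fin ne by (simp add: card_gt_0_iff)
  have Nq: "0 < N * ?q" using q N ac by simp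
  have "\<exists>t<?q. snd (Q' ! i) \<subseteq> ?\<rho> - {sorted_list_of_set ?\<rho> ! t}" if i: "a \<le> i" "i < c" for i
  proof -
    obtain A where A: "A \<in> ?\<rho>" "A \<notin> snd (Q' ! i)" using miss[OF i] fibre_label[OF i] by blast
    then obtain t where "t < ?q" "sorted_list_of_set ?\<rho> ! t = A"
      using fin by (metis in_set_conv_nth length_sorted_list_of_set set_sorted_list_of_set)
    then show ?thesis using A fibre_label[OF i] by blast
  qed
  then obtain t where t: "\<And>i. a \<le> i \<Longrightarrow> i < c \<Longrightarrow> t i < ?q"
    "\<And>i. a \<le> i \<Longrightarrow> i < c \<Longrightarrow> snd (Q' ! i) \<subseteq> ?\<rho> - {sorted_list_of_set ?\<rho> ! t i}" by metis
  define s where "s i = (i - a) * ?q + t i" for i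
  have s_less: "s i < N * ?q" if "a \<le> i" "i < c" for i
  proof -
    have "Suc (i - a) * ?q \<le> N * ?q" using that N ac by (intro mult_le_mono1) simp
    then show ?thesis using t(1)[OF that] by (simp add: s_def)
  qed
  have s_mono: "s i \<le> s (Suc i)" if "a \<le> i" "Suc i < c" for i
    using t(1)[of i] that by (simp add: s_def Suc_diff_le)
  \<comment> \<open>The word takes the place of a single time, so everything behind it moves by its
    length minus one.\<close>
  define h' where "h' i = (if i < a then h i else if i < c then p m + s i else h i + N * ?q - 1)" for i
  have "snd (Q' ! i) \<subseteq> ?D (h' i)" if i: "i < length Q'" for i
  proof -
    consider "i < a" | "a \<le> i" "i < c" | "c \<le> i" by linarith
    then show ?thesis
    proof cases
      case 1
      then show ?thesis using hom_label[OF h i] a[OF i] by (simp add: h'_def insert_word_before)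
    next
      case 2
      have "?w (s i) = ?\<rho> - {sorted_list_of_set ?\<rho> ! t i}"
        using t(1)[OF 2] by (simp add: deletion_word_def s_def)
      then show ?thesis using 2 t(2)[OF 2] insert_word_in[OF s_less[OF 2]] by (simp add: h'_def)
    next
      case 3
      then have "p m < h i" using c[OF i] by simp
      then show ?thesis using 3 ac hom_label[OF h i] insert_word_after[OF _ Nq] by (simp add: h'_def)
    qed
  qed
  moreover have "step (fst (Q' ! Suc i)) (h' i) (h' (Suc i))" if i: "Suc i < length Q'" for i
  proof -
    have st: "step (fst (Q' ! Suc i)) (h i) (h (Suc i))" using h i by (simp add: hom_def)
    consider "Suc i < a" | "Suc i = a" | "a \<le> i" "Suc i < c" | "Suc i = c" "a \<le> i" | "c \<le> i" by linarith
    then show ?thesis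
    proof cases
      case 1
      then show ?thesis using st by (simp add: h'_def)
    next
      case 2
      then obtain g where g: "fst (Q' ! Suc i) = Some g" using fibre_begin[OF mb(1,3) \<open>a < c\<close>] by auto
      have "h (Suc i) = p m" using fibre_iff[OF i] 2 \<open>a < c\<close> by simp
      then show ?thesis using st g 2 \<open>a < c\<close> by (auto simp: h'_def)
    next
      case 3
      then show ?thesis using s_mono[OF 3] fibre_gap[of "Suc i"] by (simp add: h'_def)
    next
      case 4
      then obtain g where g: "fst (Q' ! Suc i) = Some g" using fibre_end[OF mb(2) \<open>a < c\<close>] i by auto
      have "h i = p m" using fibre_iff[of i] 4 i by simp
      then show ?thesis using st g 4 s_less[of i] ac by (simp add: h'_def)
    next
      case 5
      have "N * ?q = Suc (N * ?q - 1)" using Nq by simp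
      then show ?thesis using 5 ac st by (cases "fst (Q' ! Suc i)") (auto simp: h'_def)
    qed
  qed
  moreover have "h' 0 = 0" using h ac mb by (simp add: h'_def hom_def)
  ultimately have "csat ?D Q'" unfolding csat_def hom_def by blast
  moreover have "?D \<in> candidates b N Q" using m unfolding candidates_def by blast
  ultimately have "csat ?D Q" using agree by blast
  then obtain t where "?\<rho> \<subseteq> ?w t"
    using insert_word_letter[OF Q less_imp_le[OF b_length] m Nq] by blast
  moreover have "sorted_list_of_set ?\<rho> ! (t mod ?q) \<in> ?\<rho>"
    using fin q by (metis length_sorted_list_of_set mod_less_divisor nth_mem set_sorted_list_of_set)
  ultimately show False by (auto simp: deletion_word_def)
qed

text \<open>Only primitive blocks after the start need \<open>side\<close>. Without lone conjuncts
  the label is a singleton, so the nonempty label of the point a is already full; a bound on the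
  length gives access to the deletion word; and with positive gaps two points never share a
  time.\<close>

lemma fibre_singleton:
  assumes side: "(\<forall>i. \<not> lone Q i) \<or> length Q' \<le> N \<or> positive_gaps Q'"
  shows "c = Suc a \<and> (\<not> block_end Q m \<longrightarrow> c < length Q' \<and> fst (Q' ! c) = None)"
proof -
  consider "\<not> block_end Q m" | "block_end Q m" "m = 0 \<or> \<not> block_begin Q m"
    | "block_end Q m" "m \<noteq> 0" "block_begin Q m" by blast
  then show ?thesis
  proof cases
    case 1
    then show ?thesis
      using fibre_inner fibre_begin_only fibre_start_only by (cases "block_begin Q m"; cases "m = 0") auto
  next
    case 2
    then show ?thesis using fibre_end_only by blast
  next
    case 3
    let ?\<rho> = "snd (Q ! m)"
    have ne: "?\<rho> \<noteq> {}" and "a < c" using nf_nonempty[OF Q m] 3 fibre_nonempty by auto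
    have a0: "0 < a" using ac 3 by simp
    have "c = Suc a"
    proof (rule ccontr)
      assume *: "c \<noteq> Suc a"
      then have miss: "snd (Q' ! i) \<noteq> ?\<rho>" if "a \<le> i" "i < c" for i
        using fibre_primitive_full 3 that by blast
      from side show False
      proof (elim disjE)
        assume "length Q' \<le> N"
        then show False using fibre_deletion_word 3 miss by blast
      next
        assume "positive_gaps Q'"
        moreover have "Suc a < c" using * \<open>a < c\<close> by simp
        then have "Some 0 = fst (Q' ! Suc a)" "Q' ! Suc a \<in> set Q'" using fibre_gap[of "Suc a"] ac by auto
        ultimately show False unfolding positive_gaps_def by blast
      next
        assume "\<forall>i. \<not> lone Q i"
        then have "\<not> lone Q m" by blast
        moreover have "card ?\<rho> \<noteq> 0" using ne nf_finite[OF Q m] by simp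
        ultimately have "card ?\<rho> = 1" using 3 m by (simp add: lone_def)
        then obtain x where "?\<rho> = {x}" by (rule card_1_singletonE)
        moreover have "snd (Q' ! a) \<noteq> {}"
          using nf_nonempty[OF Q', of a] a0 \<open>a < c\<close> ac fibre_begin 3 by (auto simp: block_begin_def)
        ultimately have "snd (Q' ! a) = ?\<rho>"
          using fibre_label[of a] \<open>a < c\<close> by auto
        then show False using miss[of a] \<open>a < c\<close> by simp
      qed
    qed
    then show ?thesis using 3 by simp
  qed
qed

end

section \<open>From one-point fibres to equal chains\<close>

context
  assumes side: "(\<forall>i. \<not> lone Q i) \<or> length Q' \<le> N \<or> positive_gaps Q'"
begin

lemma fibre_unique:
  assumes m: "m < length Q"
  obtains i where "i < length Q'" "\<And>j. j < length Q' \<Longrightarrow> h j = p m \<longleftrightarrow> j = i" "snd (Q' ! i) = snd (Q ! m)"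
    "\<not> block_end Q m \<Longrightarrow> Suc i < length Q' \<and> fst (Q' ! Suc i) = None"
proof -
  obtain a c where ac: "a \<le> c" "0 < c" "c \<le> length Q'" "a = 0 \<longleftrightarrow> m = 0"
    "\<And>i. i < length Q' \<Longrightarrow> h i < p m \<longleftrightarrow> i < a"
    "\<And>i. i < length Q' \<Longrightarrow> h i \<le> p m \<longleftrightarrow> i < c"
    using fibre[OF m] by metis
  note facts = m ac
  have c: "c = Suc a" "\<not> block_end Q m \<longrightarrow> c < length Q' \<and> fst (Q' ! c) = None"
    using fibre_singleton[OF facts side] by auto
  show ?thesis
  proof (rule that[of a])
    show "h j = p m \<longleftrightarrow> j = a" if "j < length Q'" for j
      using fibre_iff[OF facts that] c by auto
    show "snd (Q' ! a) = snd (Q ! m)" using fibre_single_label[OF facts c(1)] .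
  qed (use c ac in auto)
qed

text \<open>Every point of Q' lies on a planted time, and by induction the times before
  \<open>p m\<close> are taken by the points below m. By monotonicity the one point over m can only
  be m itself.\<close>

lemma hom_canonical:
  assumes "m < length Q"
  shows "m < length Q' \<and> (\<forall>j<length Q'. h j = p m \<longleftrightarrow> j = m)"
  using assms
proof (induction m rule: less_induct)
  case (less m)
  obtain i where i: "i < length Q'" "\<And>j. j < length Q' \<Longrightarrow> h j = p m \<longleftrightarrow> j = i"
    using fibre_unique[OF less.prems] by metis
  have below: "h j < p m \<longleftrightarrow> j < m" if j: "j < length Q'" for j
  proof -
    obtain k where k: "k < length Q" "h j = p k" using hom_range[OF j] by blast
    have "h j = p j" if "j < m" using less.IH[OF that] that less.prems j by auto
    moreover have "k = j" if "k < m" using less.IH[OF that] k j by auto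
    ultimately show ?thesis using k p_less[of k m] p_less[of j m] by auto
  qed
  have "\<not> i < m" using below[OF i(1)] i(2)[OF i(1)] by simp
  moreover have "\<not> m < i"
  proof
    assume "m < i"
    then have "h m \<le> p m" using hom_mono[OF h, of m i] i(2)[OF i(1)] i(1) by simp
    then show False using below[of m] i(1) i(2)[of m] \<open>m < i\<close> by simp
  qed
  ultimately show ?case using i by (auto simp: nat_neq_iff)
qed

lemma hom_eq_canonical: "m < length Q \<Longrightarrow> h m = p m"
  using hom_canonical by blast

lemma length_eq: "length Q' = length Q"
proof -
  have "length Q \<le> length Q'" using hom_canonical[of "length Q - 1"] nf_length[OF Q] by linarith
  moreover have "\<not> length Q < length Q'"
  proof
    assume "length Q < length Q'"
    then obtain j where "j < length Q" "h (length Q) = p j" using hom_range by blast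
    then show False using hom_canonical[of j] \<open>length Q < length Q'\<close> by auto
  qed
  ultimately show ?thesis by simp
qed

lemma label_eq: "m < length Q \<Longrightarrow> snd (Q' ! m) = snd (Q ! m)"
  by (metis fibre_unique hom_canonical)

lemma suc_iff:
  assumes "Suc i < length Q"
  shows "fst (Q' ! Suc i) = None \<longleftrightarrow> fst (Q ! Suc i) = None"
proof
  assume "fst (Q' ! Suc i) = None"
  then have "p (Suc i) = Suc (p i)"
    using hom_suc[OF h, of i] hom_eq_canonical[of i] hom_eq_canonical[OF assms] assms length_eq by simp
  then show "fst (Q ! Suc i) = None" using b_pos by (auto split: if_splits)
next
  assume "fst (Q ! Suc i) = None"
  then have "\<not> block_end Q i" using assms by (simp add: block_end_def)
  moreover have i: "i < length Q" using assms by simp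
  ultimately show "fst (Q' ! Suc i) = None"
    by (metis fibre_unique[OF i] hom_canonical[OF i])
qed

lemma pos_eq: "i < length Q \<Longrightarrow> pos w Q' i = pos w Q i"
  by (induction i) (auto simp: suc_iff)

text \<open>Positions depend on which steps are successor steps but not on the widths of the gaps.
  So data planted from Q are also planted from Q', before the gaps have been compared.\<close>

lemma plant_eq: "plant Q' (pos w Q') = plant Q (pos w Q)"
  by (rule ext) (auto simp: plant_def length_eq label_eq pos_eq)

text \<open>Width g admits Q and therefore Q', so \<open>tight_gap\<close> for Q' gives g' \<le> g.
  If g' were smaller, width g - 1 would admit Q' and therefore Q, against \<open>tight_gap\<close>
  for Q.\<close>

lemma gap_eq:
  assumes i: "Suc i < length Q" and g: "fst (Q ! Suc i) = Some g" and g': "fst (Q' ! Suc i) = Some g'"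
  shows "g' = g"
proof -
  let ?w = "\<lambda>e. (\<lambda>_. b)(Suc i := e)"
  let ?D = "\<lambda>e. plant Q (pos (?w e) Q)"
  have cand: "?D e \<in> candidates b N Q" if "e \<in> {g, g - 1}" for e
    unfolding candidates_def by (intro UnI2 UN_I[of "Suc i"] imageI) (use that i g in \<open>auto simp: gap_def\<close>)
  have wit: "csat (?D e) Q" if "g \<le> e" for e
    unfolding csat_def
  proof (rule exI, rule hom_pos)
    fix j k assume "Suc j < length Q" "fst (Q ! Suc j) = Some k"
    then show "k \<le> ?w e (Suc j)"
      using gap_card_le_weight[of "Suc j" Q] b that g by (auto simp: gap_def)
  qed
  have wit': "csat (?D e) Q'" if "g' \<le> e" for e
    unfolding csat_def plant_eq[symmetric]
  proof (rule exI, rule hom_pos)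
    fix j k assume "Suc j < length Q'" "fst (Q' ! Suc j) = Some k"
    then show "k \<le> ?w e (Suc j)"
      using gap_short[of j k] that g' by auto
  qed
  have "csat (?D g) Q'" using wit[of g] agree[OF cand[of g]] by simp
  then have le: "g' \<le> g"
    using tight_gap[OF Q', of b i g' g] b_length length_eq i g' by (simp add: plant_eq)
  moreover have "\<not> g' < g"
  proof
    assume "g' < g"
    then have "csat (?D (g - 1)) Q" using wit'[of "g - 1"] agree[OF cand[of "g - 1"]] by simp
    then show False
      using tight_gap[OF Q _ i g, of b "g - 1"] b_length \<open>g' < g\<close> by simp
  qed
  ultimately show ?thesis by simp
qed

lemma chain_eq: "Q' = Q"
proof (rule nth_equalityI)
  show "length Q' = length Q" by (rule length_eq)
  fix i assume "i < length Q'"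
  then have i: "i < length Q" by (simp add: length_eq)
  have "fst (Q' ! i) = fst (Q ! i)"
  proof (cases i)
    case 0
    then show ?thesis using nf_head[OF Q] nf_head[OF Q'] by simp
  next
    case (Suc j)
    then show ?thesis using gap_eq[of j] suc_iff[of j] i
      by (cases "fst (Q ! i)"; cases "fst (Q' ! i)") auto
  qed
  then show "Q' ! i = Q ! i" using label_eq[OF i] by (simp add: prod_eq_iff)
qed

end

end

theorem candidates_characterise:
  assumes "nf Q" "nf Q'" "weight Q < b"
    and "\<And>D. D \<in> candidates b N Q \<Longrightarrow> csat D Q \<longleftrightarrow> csat D Q'"
    and "(\<forall>i. \<not> lone Q i) \<or> length Q' \<le> N \<or> positive_gaps Q'"
  shows "Q' = Q"
proof -
  interpret agreeing Q Q' b N using assms by unfold_locales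
  obtain h where "hom (plant Q p) Q' h" by (rule canon_hom)
  then interpret agreeing_hom Q Q' b N h by unfold_locales
  show ?thesis using chain_eq assms(5) by blast
qed

section \<open>Queries as chains, and lone conjuncts\<close>

fun step_of :: "tempop \<Rightarrow> nat option" where
  "step_of Next = None"
| "step_of Dia = Some 1"
| "step_of DiaR = Some 0"

definition steps_of :: "(tempop \<times> atom set) list \<Rightarrow> chain" where
  "steps_of ps = map (\<lambda>(t, \<sigma>). (step_of t, \<sigma>)) ps"

lemma steps_of_simps [simp]:
  "steps_of [] = []" "steps_of ((t, \<sigma>) # ps) = (step_of t, \<sigma>) # steps_of ps"
  "steps_of (ps @ qs) = steps_of ps @ steps_of qs"
  by (simp_all add: steps_of_def)

lemma sat_conj_list: "sat D l (conj_list xs) \<longleftrightarrow> set xs \<subseteq> D l"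
  by (induction xs rule: conj_list.induct) auto

lemma sat_conj_set: "finite \<rho> \<Longrightarrow> sat D l (conj_set \<rho>) \<longleftrightarrow> \<rho> \<subseteq> D l"
  by (simp add: conj_set_def sat_conj_list)

lemma sat_path_query:
  assumes "finite \<rho>" "\<forall>(t, \<sigma>) \<in> set ps. finite \<sigma>"
  shows "sat D l (path_query \<rho> ps) \<longleftrightarrow> \<rho> \<subseteq> D l \<and> chain_sat D l (steps_of ps)"
  using assms
proof (induction \<rho> ps arbitrary: l rule: path_query.induct)
  case (1 \<rho>)
  then show ?case by (simp add: sat_conj_set)
next
  case (2 \<rho> t \<rho>' ps)
  then show ?case by (cases t) (auto simp: sat_conj_set Suc_le_eq)
qed

lemma query_size_conj_list: "length xs \<le> query_size (conj_list xs) \<and> 1 \<le> query_size (conj_list xs)"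
  by (induction xs rule: conj_list.induct) auto

lemma query_size_conj_set: "card \<rho> \<le> query_size (conj_set \<rho>)" "1 \<le> query_size (conj_set \<rho>)"
  using query_size_conj_list[of "sorted_list_of_set \<rho>"] by (simp_all add: conj_set_def)

lemma weight_path_query: "weight ((None, \<rho>) # steps_of ps) \<le> query_size (path_query \<rho> ps) + 1"
proof (induction \<rho> ps rule: path_query.induct)
  case (1 \<rho>)
  then show ?case using query_size_conj_set[of \<rho>] by (simp add: weight_def)
next
  case (2 \<rho> t \<rho>' ps)
  \<comment> \<open>The conjunction and the temporal operator are two symbols, which pay for the new
    point and for its gap.\<close>
  have "gap (step_of t) \<le> 1" by (cases t) (auto simp: gap_def)
  then show ?case using 2 query_size_conj_set[of \<rho>] by (simp add: weight_Cons gap_def)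
qed

lemma sat_shift: "sat (\<lambda>x. D (x + k)) l q \<longleftrightarrow> sat D (l + k) q"
proof (induction q arbitrary: l)
  case (Temp t q)
  have shift: "(\<exists>m. R m \<and> sat D (m + k) q) \<longleftrightarrow> (\<exists>m\<ge>k. R (m - k) \<and> sat D m q)" for R
    by (metis add_diff_cancel_right' le_add2 le_add_diff_inverse2)
  show ?case
  proof (cases t)
    case Next
    then show ?thesis using Temp by simp
  next
    case Dia
    have "(\<exists>m>l. sat D (m + k) q) \<longleftrightarrow> (\<exists>m>l + k. sat D m q)"
      unfolding shift by (metis less_diff_conv add_leD2 less_imp_le_nat)
    then show ?thesis using Dia Temp by simp
  next
    case DiaR
    have "(\<exists>m\<ge>l. sat D (m + k) q) \<longleftrightarrow> (\<exists>m\<ge>l + k. sat D m q)"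
      unfolding shift by (metis le_diff_conv2 add_leD2)
    then show ?thesis using DiaR Temp by simp
  qed
qed auto

lemma data_instance_shift:
  assumes "data_instance D" shows "data_instance (\<lambda>x. D (x + k))"
proof -
  have "finite ((\<lambda>x. x + k) -` {l. D l \<noteq> {}})"
    using assms by (intro finite_vimageI) (auto simp: data_instance_def inj_on_def)
  then show ?thesis using assms by (simp add: data_instance_def vimage_def)
qed

text \<open>Queries look only forward, so truth at l is truth at 0 after dropping the first l times,
  which yields a data instance again.\<close>

lemma equivalent_iff:
  "equivalent q q' \<longleftrightarrow> (\<forall>D. data_instance D \<longrightarrow> sat D 0 q = sat D 0 q')"
proof
  show "equivalent q q' \<Longrightarrow> \<forall>D. data_instance D \<longrightarrow> sat D 0 q = sat D 0 q'"
    by (auto simp: equivalent_def entails_def)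
next
  assume *: "\<forall>D. data_instance D \<longrightarrow> sat D 0 q = sat D 0 q'"
  have "sat D l q = sat D l q'" if "data_instance D" for D l
    using *[rule_format, OF data_instance_shift[OF that, of l]] by (simp add: sat_shift)
  then show "equivalent q q'" by (simp add: equivalent_def entails_def)
qed

definition represents :: "chain \<Rightarrow> query \<Rightarrow> bool" where
  "represents Q q \<longleftrightarrow> (\<forall>D. sat D 0 q \<longleftrightarrow> csat D Q)"

lemma represents_equivalent: "represents Q q \<Longrightarrow> represents Q q' \<Longrightarrow> equivalent q q'"
  by (simp add: represents_def equivalent_iff)

lemma represents_path_query:
  "finite \<rho> \<Longrightarrow> \<forall>(t, \<sigma>) \<in> set ps. finite \<sigma> \<Longrightarrow> represents ((s, \<rho>) # steps_of ps) (path_query \<rho> ps)"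
  by (simp add: represents_def sat_path_query csat_Cons)

lemma nf_of_query:
  assumes "q \<in> Qp \<Phi>"
  obtains Q where "nf Q" "represents Q q" "weight Q \<le> query_size q + 1" "DiaR \<notin> \<Phi> \<Longrightarrow> positive_gaps Q"
proof -
  obtain \<rho> ps where q: "q = path_query \<rho> ps" "finite \<rho>" "\<forall>(t, \<sigma>) \<in> set ps. t \<in> \<Phi> \<and> finite \<sigma>"
    using assms unfolding Qp_def by blast
  let ?P = "(None, \<rho>) # steps_of ps"
  have wf: "well_formed ?P" using q by (auto simp: well_formed_def steps_of_def)
  have rep: "represents ?P q" unfolding q(1) using q by (intro represents_path_query) auto
  have pg: "positive_gaps ?P" if "DiaR \<notin> \<Phi>"
  proof -
    have "step_of t \<noteq> Some 0" if "(t, \<sigma>) \<in> set ps" for t \<sigma>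
      using q(3) that \<open>DiaR \<notin> \<Phi>\<close> by (cases t) auto
    then show ?thesis by (force simp: positive_gaps_def steps_of_def)
  qed
  obtain Q where Q: "nf Q" "reduces ?P Q" using nf_exists[OF wf] .
  show ?thesis
  proof (rule that[OF Q(1)])
    show "represents Q q"
      using rep Q chain_equiv_csat[OF _ wf] by (simp add: represents_def reduces_def)
    show "weight Q \<le> query_size q + 1"
      using Q weight_path_query[of \<rho> ps] q(1) by (simp add: reduces_def)
  qed (use Q pg in \<open>simp add: reduces_def\<close>)
qed

text \<open>A gap of width g is written as g next operators and one reflexive diamond, which keeps
  every chain within the class without strict diamonds.\<close>

fun step_ops :: "nat option \<Rightarrow> atom set \<Rightarrow> (tempop \<times> atom set) list" where
  "step_ops None \<sigma> = [(Next, \<sigma>)]"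
| "step_ops (Some g) \<sigma> = replicate g (Next, {}) @ [(DiaR, \<sigma>)]"

lemma chain_sat_replicate: "chain_sat D x (steps_of (replicate g (Next, {})) @ A) = chain_sat D (x + g) A"
  by (induction g arbitrary: x) auto

lemma query_of_chain:
  assumes "well_formed Q"
  obtains q where "q \<in> Qp {Next, DiaR}" "represents Q q"
proof -
  obtain \<rho> ps where Q: "Q = (None, \<rho>) # ps" using assms by (cases Q) (auto simp: well_formed_def)
  let ?ops = "\<lambda>ps. concat (map (\<lambda>(s, \<sigma>). step_ops s \<sigma>) ps)"
  have fin: "finite \<rho>" "\<forall>(s, \<sigma>) \<in> set ps. finite \<sigma>" using assms Q by (auto simp: well_formed_def)
  have ops: "t \<in> {Next, DiaR} \<and> finite \<tau>" if "(t, \<tau>) \<in> set (step_ops s \<sigma>)" "finite \<sigma>" for t \<tau> s \<sigma>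
    using that by (cases s) (auto split: if_splits)
  have fin': "\<forall>(t, \<tau>) \<in> set (?ops ps). t \<in> {Next, DiaR} \<and> finite \<tau>" using fin(2) ops by fastforce
  have "chain_sat D x (steps_of (?ops ps)) = chain_sat D x ps" for D x
  proof (induction ps arbitrary: x)
    case (Cons p ps)
    obtain s \<sigma> where p: "p = (s, \<sigma>)" by force
    show ?case unfolding p using Cons by (cases s) (simp_all add: chain_sat_replicate)
  qed simp
  then have "represents Q (path_query \<rho> (?ops ps))"
    using represents_path_query[of \<rho> "?ops ps" None] fin fin' unfolding Q
    by (fastforce simp: represents_def csat_Cons)
  moreover have "path_query \<rho> (?ops ps) \<in> Qp {Next, DiaR}"
    unfolding Qp_def using fin fin' by blast
  ultimately show ?thesis using that by blast
qed

section \<open>Extent of the planted data\<close>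

definition atoms :: "chain \<Rightarrow> atom set" where
  "atoms Q = (\<Union>i<length Q. snd (Q ! i))"

lemma finite_atoms: "nf Q \<Longrightarrow> finite (atoms Q)"
  by (auto simp: atoms_def nf_finite)

lemma card_atoms: "card (atoms Q) \<le> weight Q"
proof (induction Q)
  case (Cons q Q)
  obtain s \<sigma> where q: "q = (s, \<sigma>)" by force
  have "atoms (q # Q) = \<sigma> \<union> atoms Q"
    unfolding atoms_def q by (auto simp: lessThan_Suc_eq_insert_0)
  then have "card (atoms (q # Q)) \<le> card \<sigma> + card (atoms Q)" by (simp add: card_Un_le)
  then show ?case using Cons q by (simp add: weight_Cons)
qed (simp add: atoms_def)

lemma bounded_data:
  assumes "finite At" "\<And>x. D x \<subseteq> At" "\<And>x. L \<le> x \<Longrightarrow> D x = {}"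
  shows "data_instance D" "data_size D \<le> L * card At"
proof -
  have sub: "{l. D l \<noteq> {}} \<subseteq> {..<L}" using assms(3) by (auto simp: not_le[symmetric])
  then show "data_instance D"
    using assms(1,2) unfolding data_instance_def by (meson finite_lessThan finite_subset)
  have "data_size D \<le> (\<Sum>l | D l \<noteq> {}. card At)"
    unfolding data_size_def by (intro sum_mono card_mono assms)
  also have "\<dots> \<le> L * card At"
    using card_mono[OF finite_lessThan sub] by simp
  finally show "data_size D \<le> L * card At" .
qed

lemma pos_le: "(\<And>i. 0 < i \<Longrightarrow> i \<le> j \<Longrightarrow> w i \<le> b) \<Longrightarrow> 1 \<le> b \<Longrightarrow> pos w Q j \<le> j * b"
proof (induction j)
  case (Suc j)
  then have "pos w Q j \<le> j * b" "w (Suc j) \<le> b" by auto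
  then show ?case using Suc.prems(2) by auto
qed simp

lemma plant_bounds:
  assumes "\<And>i. i < length Q \<Longrightarrow> w i \<le> b" "1 \<le> b"
  shows "plant Q (pos w Q) x \<subseteq> atoms Q" "length Q * b \<le> x \<Longrightarrow> plant Q (pos w Q) x = {}"
proof -
  show "plant Q (pos w Q) x \<subseteq> atoms Q" by (auto simp: plant_def atoms_def)
  assume x: "length Q * b \<le> x"
  have "pos w Q i < x" if "i < length Q" for i
  proof -
    have "pos w Q i \<le> i * b" using assms that by (intro pos_le) auto
    also have "\<dots> < length Q * b" using assms(2) that by simp
    finally show ?thesis using x by simp
  qed
  then show "plant Q (pos w Q) x = {}" by (intro plant_empty) fastforce
qed

lemma insert_word_bounds:
  assumes "m < length Q" "1 \<le> b" "\<And>t. t < k \<Longrightarrow> w t \<subseteq> snd (Q ! m)"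
  shows "insert_word b Q m k w x \<subseteq> atoms Q"
    "length Q * b + k \<le> x \<Longrightarrow> insert_word b Q m k w x = {}"
proof -
  note pb = plant_bounds[of Q "\<lambda>_. b" b, OF order_refl assms(2)]
  have "snd (Q ! m) \<subseteq> atoms Q" using assms(1) by (auto simp: atoms_def)
  then have "w (x - cpos b Q m) \<subseteq> atoms Q" if "x - cpos b Q m < k" using assms(3)[OF that] by blast
  then show "insert_word b Q m k w x \<subseteq> atoms Q"
    using pb(1) by (auto simp: insert_word_def)
  assume x: "length Q * b + k \<le> x"
  have "cpos b Q m \<le> m * b" using assms(2) by (intro pos_le) auto
  also have "\<dots> < length Q * b" using assms by simp
  finally have "cpos b Q m + k \<le> x" using x by simp
  moreover have "length Q * b \<le> x + 1 - k" using x by simp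
  ultimately show "insert_word b Q m k w x = {}" using pb(2) by (simp add: insert_word_def)
qed

section \<open>Replacing a point by a chain of smaller points\<close>

definition stretch :: "chain \<Rightarrow> nat \<Rightarrow> nat \<Rightarrow> (nat \<Rightarrow> atom set) \<Rightarrow> chain" where
  "stretch Q m K w = take m Q @ map (\<lambda>t. (if t = 0 then fst (Q ! m) else Some 0, w t)) [0..<K] @ drop (Suc m) Q"

context
  fixes Q :: chain and m K :: nat and w :: "nat \<Rightarrow> atom set"
  assumes m: "m < length Q" and K: "0 < K"
begin

lemma stretch_length: "length (stretch Q m K w) = length Q + K - 1"
  using m K by (simp add: stretch_def)

lemma stretch_before: "i < m \<Longrightarrow> stretch Q m K w ! i = Q ! i"
  using m by (simp add: stretch_def nth_append)

lemma stretch_in: "t < K \<Longrightarrow> stretch Q m K w ! (m + t) = (if t = 0 then fst (Q ! m) else Some 0, w t)"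
  using m by (simp add: stretch_def nth_append)

lemma stretch_after: "m < i \<Longrightarrow> i < length Q \<Longrightarrow> stretch Q m K w ! (i + K - 1) = Q ! i"
  using m K by (auto simp: stretch_def nth_append)

lemma stretch_cases:
  assumes "i < length (stretch Q m K w)"
  obtains (before) "i < m" | (inside) t where "t < K" "i = m + t"
    | (after) j where "m < j" "j < length Q" "i = j + K - 1"
proof -
  consider "i < m" | "m \<le> i" "i < m + K" | "m + K \<le> i" by linarith
  then show ?thesis
  proof cases
    case 2
    then show ?thesis using inside[of "i - m"] by auto
  next
    case 3
    then show ?thesis using after[of "i + 1 - K"] assms K by (auto simp: stretch_length)
  qed (rule before)
qed

lemma stretch_hom:
  assumes m0: "0 < m" and h0: "h 0 = 0"
    and before: "\<And>i. i < m \<Longrightarrow> snd (Q ! i) \<subseteq> D (h i)"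
    and inside: "\<And>t. t < K \<Longrightarrow> w t \<subseteq> D (u t)"
    and after: "\<And>i. m < i \<Longrightarrow> i < length Q \<Longrightarrow> snd (Q ! i) \<subseteq> D (h i)"
    and steps: "\<And>i. Suc i < length Q \<Longrightarrow> Suc i \<noteq> m \<Longrightarrow> i \<noteq> m \<Longrightarrow> step (fst (Q ! Suc i)) (h i) (h (Suc i))"
    and in_step: "step (fst (Q ! m)) (h (m - 1)) (u 0)"
    and mono: "\<And>t. Suc t < K \<Longrightarrow> u t \<le> u (Suc t)"
    and out_step: "Suc m < length Q \<Longrightarrow> step (fst (Q ! Suc m)) (u (K - 1)) (h (Suc m))"
  shows "csat D (stretch Q m K w)"
proof -
  let ?S = "stretch Q m K w"
  define h' where "h' i = (if i < m then h i else if i < m + K then u (i - m) else h (i + 1 - K))" for i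
  have "snd (?S ! i) \<subseteq> D (h' i)" if "i < length ?S" for i
    using that
  proof (cases rule: stretch_cases)
    case before
    then show ?thesis using assms(3) by (simp add: stretch_before h'_def)
  next
    case (inside t)
    then show ?thesis using assms(4)[of t] by (simp add: stretch_in h'_def)
  next
    case (after j)
    have "i + 1 - K = j" "\<not> i < m + K" using after K by auto
    then show ?thesis using assms(5)[OF after(1,2)] stretch_after[OF after(1,2)] after by (simp add: h'_def)
  qed
  moreover have "step (fst (?S ! Suc i)) (h' i) (h' (Suc i))" if "Suc i < length ?S" for i
    using that
  proof (cases rule: stretch_cases)
    case before
    then show ?thesis using steps[of i] m by (simp add: stretch_before h'_def)
  next
    case (inside t)
    show ?thesis
    proof (cases t)
      case 0
      then have "i = m - 1" "Suc i = m" using inside m0 by auto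
      then show ?thesis using in_step stretch_in[OF inside(1)] 0 inside K m0 by (auto simp: h'_def)
    next
      case (Suc t')
      then show ?thesis using mono[of t'] stretch_in[OF inside(1)] inside by (simp add: h'_def)
    qed
  next
    case (after j)
    have eq: "fst (?S ! Suc i) = fst (Q ! j)" using stretch_after[OF after(1,2)] after by simp
    have hS: "h' (Suc i) = h j" using after K by (auto simp: h'_def)
    show ?thesis
    proof (cases "j = Suc m")
      case True
      then have "i = m + K - 1" using after K by simp
      then have "h' i = u (K - 1)" using K by (auto simp: h'_def)
      then show ?thesis using out_step True after eq hS by simp
    next
      case False
      then obtain j' where j': "j = Suc j'" "m < j'" using after by (cases j) auto
      then have "h' i = h j'" using after K by (simp add: h'_def)
      then show ?thesis using steps[of j'] j' after eq hS by simp
    qed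
  qed
  moreover have "h' 0 = 0" using h0 m0 by (simp add: h'_def)
  ultimately show ?thesis unfolding csat_def hom_def by blast
qed

end

text \<open>All new points can be placed at the time of the old one. So stretching with subsets of
  the label only weakens a query, and positive examples stay positive.\<close>

lemma csat_stretch:
  assumes m: "m < length Q" "0 < m" and K: "0 < K" and w: "\<And>t. t < K \<Longrightarrow> w t \<subseteq> snd (Q ! m)"
    and sat: "csat D Q"
  shows "csat D (stretch Q m K w)"
proof -
  obtain h where h: "hom D Q h" using sat by (auto simp: csat_def)
  have steps: "step (fst (Q ! Suc i)) (h i) (h (Suc i))" if "Suc i < length Q" for i
    using h that by (simp add: hom_def)
  show ?thesis
  proof (rule stretch_hom[OF m(1) K m(2), where h = h and u = "\<lambda>_. h m"])
    show "step (fst (Q ! m)) (h (m - 1)) (h m)" using steps[of "m - 1"] m by simp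
    show "w t \<subseteq> D (h m)" if "t < K" for t using w[OF that] hom_label[OF h m(1)] by blast
  qed (use h steps m in \<open>auto simp: hom_def\<close>)
qed

text \<open>On data shorter than the chain, two neighbouring points of the chain meet.\<close>

lemma csat_stretch_short:
  assumes lone: "lone Q m" and A: "A \<in> snd (Q ! m)" and D: "\<And>x. B \<le> x \<Longrightarrow> D x = {}"
    and sat: "csat D (stretch Q m (Suc B) (\<lambda>t. if even t then {A} else snd (Q ! m) - {A}))"
  shows "csat D Q"
proof -
  let ?\<rho> = "snd (Q ! m)" and ?w = "\<lambda>t. if even t then {A} else snd (Q ! m) - {A}"
  let ?S = "stretch Q m (Suc B) ?w"
  have m: "m < length Q" "0 < m" using lone by (auto simp: lone_def)
  note len = stretch_length[OF m(1), of "Suc B" ?w, simplified]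
  note inside = stretch_in[OF m(1), of "Suc B" _ ?w, simplified]
  note after = stretch_after[OF m(1), of "Suc B" _ ?w, simplified]
  obtain h where h: "hom D ?S h" using sat by (auto simp: csat_def)
  \<comment> \<open>This is where a lone conjunct needs two atoms: with only one, every other label
    would be empty and could be placed beyond the data.\<close>
  have "?\<rho> - {A} \<noteq> {}"
  proof
    assume "?\<rho> - {A} = {}"
    then have "?\<rho> = {A}" using A by blast
    then show False using lone by (simp add: lone_def)
  qed
  then have w_ne: "?w t \<noteq> {}" for t by simp
  have in_len: "m + t < length ?S" if "t \<le> B" for t using that m len by simp
  have lab: "?w t \<subseteq> D (h (m + t))" if "t \<le> B" for t
    using hom_label[OF h in_len[OF that]] inside[of t] that by simp
  have below: "h (m + t) < B" if "t \<le> B" for t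
  proof (rule ccontr)
    assume "\<not> ?thesis"
    then have "D (h (m + t)) = {}" using D by simp
    then show False using lab[OF that] w_ne[of t] by blast
  qed
  \<comment> \<open>The B + 1 new points all lie at times below B; without a coincidence of
    neighbours their times would increase strictly and reach B.\<close>
  have "\<exists>t. Suc t \<le> B \<and> h (m + Suc t) = h (m + t)"
  proof (rule ccontr)
    assume *: "\<not> ?thesis"
    have "t \<le> h (m + t)" if "t \<le> B" for t
      using that
    proof (induction t)
      case (Suc t)
      have "h (m + t) \<le> h (m + Suc t)" by (rule hom_mono[OF h _ in_len]) (use Suc in auto)
      moreover have "h (m + Suc t) \<noteq> h (m + t)" using * Suc.prems by blast
      ultimately show ?case using Suc by simp
    qed simp
    then show False using below[of B] by (simp add: not_less[symmetric])
  qed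
  then obtain t where t: "Suc t \<le> B" "h (m + Suc t) = h (m + t)" by blast
  have full: "?\<rho> \<subseteq> D (h (m + t))"
    using lab[of t] lab[of "Suc t"] t by (cases "even t") auto
  \<comment> \<open>Neighbouring labels together make up \<rho>, so the meeting point can host the
    original point m. Since m is entered and left by gaps, it may take any time used by the new
    points.\<close>
  define h' where "h' i = (if i < m then h i else if i = m then h (m + t) else h (i + B))" for i
  have hstep: "step (fst (?S ! Suc i)) (h i) (h (Suc i))" if "Suc i < length ?S" for i
    using h that by (simp add: hom_def)
  have before: "?S ! i = Q ! i" if "i < m" for i using stretch_before[OF m(1) _ that] by simp
  have "snd (Q ! i) \<subseteq> D (h' i)" if "i < length Q" for i
  proof -
    consider "i < m" | "i = m" | "m < i" by linarith
    then show ?thesis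
    proof cases
      case 1
      then show ?thesis using hom_label[OF h, of i] before[of i] that len by (simp add: h'_def)
    next
      case 3
      then show ?thesis using hom_label[OF h, of "i + B"] after[of i] that len by (simp add: h'_def)
    qed (use full in \<open>simp add: h'_def\<close>)
  qed
  moreover have "step (fst (Q ! Suc i)) (h' i) (h' (Suc i))" if i: "Suc i < length Q" for i
  proof -
    consider "Suc i < m" | "Suc i = m" | "i = m" | "m < i" by linarith
    then show ?thesis
    proof cases
      case 1
      then show ?thesis using hstep[of i] before[of "Suc i"] i len by (simp add: h'_def)
    next
      case 2
      then obtain g where g: "fst (Q ! Suc i) = Some g"
        using lone by (auto simp: lone_def block_begin_def)
      have "h (Suc i) \<le> h (m + t)" by (rule hom_mono[OF h _ in_len]) (use 2 t in auto)
      moreover have "h i + g \<le> h (Suc i)"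
        using hom_gap[OF h, of i g] inside[of 0] 2 g i len by auto
      ultimately show ?thesis using 2 g by (simp add: h'_def)
    next
      case 3
      then obtain g where g: "fst (Q ! Suc i) = Some g"
        using lone i by (auto simp: lone_def block_end_def)
      have "h (m + t) \<le> h (m + B)" by (rule hom_mono[OF h _ in_len]) (use t in auto)
      moreover have "h (m + B) + g \<le> h (Suc (m + B))"
        using hom_gap[OF h, of "m + B" g] after[of "Suc m"] 3 g i len by simp
      ultimately show ?thesis using 3 g by (simp add: h'_def)
    next
      case 4
      then show ?thesis using hstep[of "i + B"] after[of "Suc i"] i len by (simp add: h'_def)
    qed
  qed
  moreover have "h' 0 = 0" using h m by (simp add: h'_def hom_def)
  ultimately show ?thesis unfolding csat_def hom_def by blast
qed

lemma csat_stretch_insert_word: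
  assumes Q: "nf Q" and m: "m < length Q" "0 < m" "block_end Q m" and K: "0 < K" and b: "weight Q < b"
  shows "csat (insert_word b Q m K w) (stretch Q m K w)"
proof -
  let ?p = "cpos b Q" and ?D = "insert_word b Q m K w"
  let ?h = "\<lambda>i. if i \<le> m then ?p i else ?p i + K - 1"
  have b0: "0 < b" using b by simp
  have steps: "step (fst (Q ! Suc i)) (?p i) (?p (Suc i))" if "Suc i < length Q" for i
    using gap_card_le_weight[OF that] b by (cases "fst (Q ! Suc i)") (auto simp: gap_def)
  show ?thesis
  proof (rule stretch_hom[OF m(1) K m(2), where h = ?h and u = "\<lambda>t. ?p m + t"])
    show "snd (Q ! i) \<subseteq> ?D (?h i)" if "i < m" for i
      using that m insert_word_before[OF cpos_less[OF b0 that]] by (simp add: plant_cpos[OF b0])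
    show "snd (Q ! i) \<subseteq> ?D (?h i)" if "m < i" "i < length Q" for i
      using that insert_word_after[OF cpos_less[OF b0 that(1)] K] by (simp add: plant_cpos[OF b0])
    show "w t \<subseteq> ?D (?p m + t)" if "t < K" for t
      using insert_word_in[OF that] by simp
    show "step (fst (Q ! m)) (?h (m - 1)) (?p m + 0)"
      using steps[of "m - 1"] m by simp
    show "step (fst (Q ! Suc i)) (?h i) (?h (Suc i))" if "Suc i < length Q" "Suc i \<noteq> m" "i \<noteq> m" for i
    proof (cases "i < m")
      case True
      then show ?thesis using steps[OF that(1)] that by simp
    next
      case False
      then show ?thesis using steps[OF that(1)] that K by (cases "fst (Q ! Suc i)") auto
    qed
    show "step (fst (Q ! Suc m)) (?p m + (K - 1)) (?h (Suc m))" if Sm: "Suc m < length Q"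
    proof -
      obtain g where "fst (Q ! Suc m) = Some g" using m(3) Sm by (auto simp: block_end_def)
      then show ?thesis using steps[OF Sm] K by simp
    qed
  qed auto
qed

lemma well_formed_stretch:
  assumes "well_formed Q" "0 < m" "m < length Q" "\<And>t. finite (w t)"
  shows "well_formed (stretch Q m K w)"
proof -
  have "stretch Q m K w \<noteq> []" "stretch Q m K w ! 0 = Q ! 0"
    using assms(2,3) by (auto simp: stretch_def nth_append)
  moreover have "\<forall>(s, \<sigma>) \<in> set (stretch Q m K w). finite \<sigma>"
    using assms(1,4) by (auto simp: stretch_def well_formed_def dest: in_set_takeD in_set_dropD)
  ultimately show ?thesis using assms(1) by (simp add: well_formed_def)
qed

text \<open>Given E, let B bound the extent of its negative examples and stretch the lone conjunct
  to B + 1 points. Positive examples survive because the query gets weaker, negative ones because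
  they are too short to tell the difference. On the canonical data with the alternating word the two
  queries differ, as neither letter contains the whole label.\<close>

lemma lone_not_characterisable:
  assumes Q: "nf Q" and lone: "lone Q m" and rep: "represents Q q"
  shows "\<not> uniquely_characterisable q (Qp {Next, DiaR})"
proof
  assume "uniquely_characterisable q (Qp {Next, DiaR})"
  then obtain E where E: "example_set E" "fits q E"
      "\<And>q'. q' \<in> Qp {Next, DiaR} \<Longrightarrow> fits q' E \<Longrightarrow> equivalent q q'"
    unfolding uniquely_characterisable_def uniquely_characterises_def by blast
  have m: "m < length Q" "0 < m" "block_end Q m" using lone by (auto simp: lone_def)
  let ?\<rho> = "snd (Q ! m)"
  obtain A where A: "A \<in> ?\<rho>" using lone by (fastforce simp: lone_def)
  have "finite (\<Union>D\<in>snd E. {l. D l \<noteq> {}})"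
    using E(1) by (auto simp: example_set_def data_instance_def)
  then obtain B where "\<And>x. x \<in> (\<Union>D\<in>snd E. {l. D l \<noteq> {}}) \<Longrightarrow> x < B"
    unfolding finite_nat_set_iff_bounded by blast
  then have B: "D x = {}" if "D \<in> snd E" "B \<le> x" for D x using that by (meson UN_I leD mem_Collect_eq)
  let ?w = "\<lambda>t. if even t then {A} else ?\<rho> - {A}"
  let ?S = "stretch Q m (Suc B) ?w"
  have w: "?w t \<subseteq> ?\<rho>" for t :: nat using A by auto
  have "well_formed ?S"
    using well_formed_stretch[of Q m ?w "Suc B"] Q m w nf_finite[OF Q m(1)]
    by (meson finite_subset nf_def)
  then obtain q' where q': "q' \<in> Qp {Next, DiaR}" "represents ?S q'" by (rule query_of_chain)
  have "fits q' E"
    unfolding fits_def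
  proof (intro conjI ballI)
    fix D assume "D \<in> fst E"
    then have "csat D Q" using E(2) rep by (simp add: fits_def represents_def)
    then have "csat D ?S" by (intro csat_stretch[OF m(1,2) zero_less_Suc w])
    then show "sat D 0 q'" using q'(2) by (simp add: represents_def)
  next
    fix D assume D: "D \<in> snd E"
    then have "\<not> csat D Q" using E(2) rep by (simp add: fits_def represents_def)
    then have "\<not> csat D ?S" using csat_stretch_short[OF lone A, of B D] B[OF D] by blast
    then show "\<not> sat D 0 q'" using q'(2) by (simp add: represents_def)
  qed
  then have eq: "equivalent q q'" using E(3) q'(1) by blast
  let ?D = "insert_word (Suc (weight Q)) Q m (Suc B) ?w"
  note bd = insert_word_bounds[of m Q "Suc (weight Q)" "Suc B" ?w, OF m(1) _ w]
  have "data_instance ?D"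
    by (rule bounded_data(1)[of "atoms Q" ?D "length Q * Suc (weight Q) + Suc B", OF finite_atoms[OF Q] bd]) auto
  moreover have "csat ?D ?S" using csat_stretch_insert_word[OF Q m] by simp
  ultimately have sat: "csat ?D Q" using eq rep q'(2) by (simp add: equivalent_iff represents_def)
  have "length Q \<le> Suc (weight Q)" using length_le_weight[of Q] by simp
  from insert_word_letter[OF Q this m(1) zero_less_Suc sat]
  obtain t :: nat where t: "?\<rho> \<subseteq> ?w t" .
  have "?\<rho> \<subseteq> {A}"
  proof (cases "even t")
    case True
    then show ?thesis using t by simp
  next
    case False
    then have "?\<rho> \<subseteq> ?\<rho> - {A}" using t by simp
    then show ?thesis using A by blast
  qed
  then have "card ?\<rho> \<le> card {A}" by (rule card_mono[rotated]) simp
  moreover have "2 \<le> card ?\<rho>" using lone by (simp only: lone_def)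
  ultimately show False by simp
qed

section \<open>Sizes\<close>

lemma card_UN_bound:
  assumes "finite I" "\<And>i. i \<in> I \<Longrightarrow> card (f i) \<le> c"
  shows "card (\<Union>i\<in>I. f i) \<le> card I * c"
  using card_UN_le[OF assms(1), of f] sum_bounded_above[of I "\<lambda>i. card (f i)" c] assms(2) by force

lemma card_weaken: "finite \<rho> \<Longrightarrow> card (weaken \<rho>) \<le> Suc (card \<rho>)"
  unfolding weaken_def by (metis card_image_le card_insert_le_m1 diff_Suc_1 le_imp_less_Suc zero_less_Suc
      Suc_le_mono card_insert_if finite_imageI le_SucI)

lemma weaken_subset: "\<sigma> \<in> weaken \<rho> \<Longrightarrow> \<sigma> \<subseteq> \<rho>"
  by (auto simp: weaken_def)

context
  fixes Q :: chain and N X :: nat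
  assumes Q: "nf Q" and X: "X = weight Q + N + 1"
begin

lemma label_card: "m < length Q \<Longrightarrow> card (snd (Q ! m)) \<le> weight Q"
  using gap_card_le_weight[of m Q] by simp

text \<open>The factor 7 is 2 + 1 + 1 + 1 + 2, one summand for each family in
  \<open>candidates\<close>. The cube stems from the split points, which have a position and two
  weakened labels.\<close>

lemma candidates_finite_card:
  "finite (candidates b N Q) \<and> card (candidates b N Q) \<le> 7 * X ^ 3"
proof -
  let ?n = "length Q" and ?\<rho> = "\<lambda>m. snd (Q ! m)"
  have fin: "finite (?\<rho> m)" if "m < ?n" for m using nf_finite[OF Q that] .
  have n: "?n \<le> X" using length_le_weight[of Q] X by simp
  have r: "card (?\<rho> m) \<le> X" "Suc (card (?\<rho> m)) \<le> X" if "m < ?n" for m using label_card[OF that] X by auto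
  have fw: "finite (weaken (?\<rho> m))" if "m < ?n" for m using fin[OF that] by (simp add: weaken_def)
  have X1: "1 \<le> X" using X by simp
  have XX: "X \<le> X ^ 3" "X * X \<le> X ^ 3" using X1 by (simp_all add: power3_eq_cube)
  let ?A = "{plant Q (cpos b Q), plant Q (pos (gaps Q) Q)}"
  let ?B = "\<Union>m<?n. (\<lambda>A. insert_word b Q m 1 (\<lambda>_. ?\<rho> m - {A})) ` ?\<rho> m"
  let ?C = "\<Union>m<?n. (\<lambda>(\<sigma>, \<tau>). split_point b Q m \<sigma> \<tau>) ` (weaken (?\<rho> m) \<times> weaken (?\<rho> m))"
  let ?D = "(\<lambda>m. insert_word b Q m (N * card (?\<rho> m)) (deletion_word (?\<rho> m))) ` {..<?n}"
  let ?E = "\<Union>m<?n. (\<lambda>e. plant Q (pos ((\<lambda>_. b)(m := e)) Q)) ` {gaps Q m, gaps Q m - 1}"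
  have A: "card ?A \<le> 2 * X ^ 3"
    using card_insert_le_m1[of 2 "{plant Q (pos (gaps Q) Q)}" "plant Q (cpos b Q)"] X1
    by (auto intro: order_trans)
  have "card ?B \<le> card {..<?n} * X"
    by (rule card_UN_bound) (simp, rule order_trans[OF card_image_le[OF fin] r(1)], auto)
  also have "\<dots> \<le> X * X" using n by simp
  finally have B: "card ?B \<le> X ^ 3" using XX by simp
  have "card ?C \<le> card {..<?n} * (X * X)"
  proof (rule card_UN_bound)
    fix m assume m: "m \<in> {..<?n}"
    have "card ((\<lambda>(\<sigma>, \<tau>). split_point b Q m \<sigma> \<tau>) ` (weaken (?\<rho> m) \<times> weaken (?\<rho> m))) \<le> card (weaken (?\<rho> m) \<times> weaken (?\<rho> m))"
      using fw m by (intro card_image_le) auto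
    also have "\<dots> \<le> X * X"
      unfolding card_cartesian_product
      by (intro mult_le_mono) (use m r card_weaken[OF fin] in \<open>auto intro: order_trans\<close>)
    finally show "card ((\<lambda>(\<sigma>, \<tau>). split_point b Q m \<sigma> \<tau>) ` (weaken (?\<rho> m) \<times> weaken (?\<rho> m))) \<le> X * X" .
  qed simp
  also have "\<dots> \<le> X ^ 3" using n by (simp add: power3_eq_cube)
  finally have C: "card ?C \<le> X ^ 3" .
  have "card ?D \<le> ?n" using card_image_le[of "{..<?n}"] by simp
  then have D: "card ?D \<le> X ^ 3" using n XX by simp
  have "card ?E \<le> card {..<?n} * 2"
    by (rule card_UN_bound) (auto intro: order_trans[OF card_image_le] simp: card_insert_if)
  then have E: "card ?E \<le> 2 * X ^ 3" using n XX by simp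
  have "card (candidates b N Q) \<le> card ?A + card ?B + card ?C + card ?D + card ?E"
    unfolding candidates_def by (intro order_trans[OF card_Un_le] add_mono order_refl)
  moreover have "finite (candidates b N Q)"
    unfolding candidates_def using fin fw by auto
  ultimately show ?thesis using A B C D E by linarith
qed

text \<open>At most X atoms occur, at times below 4 * (X * X): one X * X covers the canonical data,
  three cover the longest inserted word.\<close>

lemma candidate_size:
  assumes D: "D \<in> candidates (Suc (weight Q)) N Q"
  shows "data_instance D \<and> data_size D \<le> 4 * X ^ 3"
proof -
  let ?b = "Suc (weight Q)"
  have n: "length Q \<le> X" using length_le_weight[of Q] X by simp
  have b: "?b \<le> X" using X by simp
  have XX: "1 \<le> X" "X \<le> X * X" using X by auto
  have gap: "gaps Q i \<le> ?b" if "i < length Q" for i using gap_card_le_weight[OF that] by simp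
  have nb: "length Q * ?b \<le> X * X" using n b by (rule mult_le_mono)
  have plant: "(\<forall>x. plant Q (pos w Q) x \<subseteq> atoms Q) \<and> (\<forall>x\<ge>4 * (X * X). plant Q (pos w Q) x = {})"
    if "\<And>i. i < length Q \<Longrightarrow> w i \<le> ?b" for w
    using plant_bounds[of Q w ?b, OF that] nb by auto
  have word: "(\<forall>x. insert_word ?b Q m k w x \<subseteq> atoms Q) \<and> (\<forall>x\<ge>4 * (X * X). insert_word ?b Q m k w x = {})"
    if "m < length Q" "k \<le> 3 * (X * X)" "\<And>t. t < k \<Longrightarrow> w t \<subseteq> snd (Q ! m)" for m k w
    using insert_word_bounds[of m Q ?b k w, OF that(1) _ that(3)] nb that(2) by auto
  have "(\<forall>x. D x \<subseteq> atoms Q) \<and> (\<forall>x\<ge>4 * (X * X). D x = {})"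
    using D unfolding candidates_def
  proof (elim UnE UN_E imageE)
    assume "D \<in> {plant Q (cpos ?b Q), plant Q (pos (gaps Q) Q)}"
    then show ?thesis using plant[of "\<lambda>_. ?b"] plant[of "gaps Q"] gap by auto
  next
    fix m A assume "m \<in> {..<length Q}" "D = insert_word ?b Q m 1 (\<lambda>_. snd (Q ! m) - {A})"
    then show ?thesis using word[of m 1 "\<lambda>_. snd (Q ! m) - {A}"] XX by auto
  next
    fix m st assume m: "m \<in> {..<length Q}" and st: "st \<in> weaken (snd (Q ! m)) \<times> weaken (snd (Q ! m))"
      and Dst: "D = (case st of (\<sigma>, \<tau>) \<Rightarrow> split_point ?b Q m \<sigma> \<tau>)"
    obtain \<sigma> \<tau> where s: "st = (\<sigma>, \<tau>)" by force
    have "Suc ?b \<le> 3 * (X * X)" using b XX by linarith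
    moreover have "(if t = 0 then \<sigma> else if t = ?b then \<tau> else {}) \<subseteq> snd (Q ! m)" for t :: nat
      using st s weaken_subset by auto
    ultimately show ?thesis
      unfolding Dst s prod.case split_point_def using m by (intro word) auto
  next
    fix m assume "m \<in> {..<length Q}"
      and Dm: "D = insert_word ?b Q m (N * card (snd (Q ! m))) (deletion_word (snd (Q ! m)))"
    then have m: "m < length Q" by simp
    have "N * card (snd (Q ! m)) \<le> X * X" using label_card[OF m] X by (intro mult_le_mono) auto
    then show ?thesis unfolding Dm using m by (intro word) (auto simp: deletion_word_def)
  next
    fix m e assume "m \<in> {..<length Q}" "e \<in> {gaps Q m, gaps Q m - 1}"
      "D = plant Q (pos ((\<lambda>_. ?b)(m := e)) Q)"
    moreover from this have "e \<le> ?b" using gap[of m] by auto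
    ultimately show ?thesis using plant[of "(\<lambda>_. ?b)(m := e)"] by simp
  qed
  then have bd: "data_instance D" "data_size D \<le> 4 * (X * X) * card (atoms Q)"
    using bounded_data[OF finite_atoms[OF Q], of D "4 * (X * X)"] by auto
  have "card (atoms Q) \<le> X" using card_atoms[of Q] X by simp
  then have "4 * (X * X) * card (atoms Q) \<le> 4 * (X * X) * X" by (rule mult_le_mono2)
  moreover have "4 * (X * X) * X = 4 * X ^ 3" by (simp add: power3_eq_cube)
  ultimately show ?thesis using bd by linarith
qed

text \<open>Whether a candidate is positive or negative is decided by evaluating q itself, so
  fitting the examples means exactly to agree with q on all candidates. The query need not belong to
  the class C, which is used for safe queries written with strict diamonds. The bound is the number
  7 * X^3 of candidates times their size 4 * X^3.\<close>

lemma small_characterisation: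
  assumes rep: "represents Q q"
    and cls: "\<And>q'. q' \<in> C \<Longrightarrow> \<exists>Q'. nf Q' \<and> represents Q' q' \<and>
      ((\<forall>i. \<not> lone Q i) \<or> length Q' \<le> N \<or> positive_gaps Q')"
  obtains E where "uniquely_characterises E q C" "examples_size E \<le> 28 * X ^ 6"
proof -
  let ?C = "candidates (Suc (weight Q)) N Q"
  let ?E = "({D \<in> ?C. sat D 0 q}, {D \<in> ?C. \<not> sat D 0 q})"
  have un: "fst ?E \<union> snd ?E = ?C" by auto
  have fin: "finite ?C" "card ?C \<le> 7 * X ^ 3" using candidates_finite_card by auto
  have "uniquely_characterises ?E q C"
    unfolding uniquely_characterises_def
  proof (intro conjI ballI impI)
    show "example_set ?E"
      unfolding example_set_def un using fin candidate_size by auto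
    show "fits q ?E" by (simp add: fits_def)
    fix q' assume q': "q' \<in> C" "fits q' ?E"
    obtain Q' where Q': "nf Q'" "represents Q' q'"
        "(\<forall>i. \<not> lone Q i) \<or> length Q' \<le> N \<or> positive_gaps Q'" using cls[OF q'(1)] by blast
    have "csat D Q \<longleftrightarrow> csat D Q'" if "D \<in> ?C" for D
      using q'(2) that rep Q'(2) by (auto simp: fits_def represents_def)
    then have "Q' = Q" using candidates_characterise[OF Q Q'(1) lessI _ Q'(3)] by blast
    then show "equivalent q q'" using represents_equivalent rep Q' by blast
  qed
  moreover have "examples_size ?E \<le> 28 * X ^ 6"
  proof -
    have "examples_size ?E \<le> (\<Sum>D\<in>?C. 4 * X ^ 3)"
      unfolding examples_size_def un by (intro sum_mono) (use candidate_size in auto)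
    also have "\<dots> = card ?C * (4 * X ^ 3)" by simp
    also have "\<dots> \<le> 7 * X ^ 3 * (4 * X ^ 3)" using fin(2) by (rule mult_le_mono1)
    also have "\<dots> = 28 * X ^ 6" by (simp flip: power_add)
    finally show ?thesis .
  qed
  ultimately show ?thesis using that by blast
qed

end

section \<open>The three polynomial bounds\<close>

lemma polynomial_bound:
  fixes X c d :: nat
  assumes "X \<le> c * n + d"
  shows "28 * X ^ 6 \<le> poly (smult 28 ([:d, c:] ^ 6)) n"
  using power_mono[OF assms, of 6] by (simp add: poly_power algebra_simps)

lemma poly_within_characterisable:
  "poly_characterisable_within
     {q \<in> Qp {Next, DiaR}. uniquely_characterisable q (Qp {Next, DiaR})} (Qp {Next, DiaR})"
  unfolding poly_characterisable_within_def
proof (rule conjI, blast, rule exI[of _ "smult 28 ([:2, 1:] ^ 6)"], rule ballI)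
  fix q assume q: "q \<in> {q \<in> Qp {Next, DiaR}. uniquely_characterisable q (Qp {Next, DiaR})}"
  then have "q \<in> Qp {Next, DiaR}" by simp
  then obtain Q where Q: "nf Q" "represents Q q" "weight Q \<le> query_size q + 1"
    by (rule nf_of_query)
  then have no: "\<forall>i. \<not> lone Q i" using lone_not_characterisable q by blast
  obtain E where "uniquely_characterises E q (Qp {Next, DiaR})" "examples_size E \<le> 28 * (weight Q + 0 + 1) ^ 6"
    by (rule small_characterisation[OF Q(1) refl Q(2), of "Qp {Next, DiaR}" 0]) (use no nf_of_query in metis)
  \<comment> \<open>The weight is at most the size plus 1, which gives the linear polynomial n + 2.
    No length bound is needed without lone conjuncts, hence \<open>N\<close> = 0.\<close>
  moreover have "28 * (weight Q + 0 + 1) ^ 6 \<le> poly (smult 28 ([:2, 1:] ^ 6)) (query_size q)"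
    by (rule polynomial_bound) (use Q in simp)
  ultimately show "\<exists>E. uniquely_characterises E q (Qp {Next, DiaR}) \<and>
      examples_size E \<le> poly (smult 28 ([:2, 1:] ^ 6)) (query_size q)" by (meson order_trans)
qed

lemma poly_bounded_reflexive: "poly_characterisable_bounded (Qp {Next, DiaR})"
  unfolding poly_characterisable_bounded_def
proof (rule exI[of _ "smult 28 ([:3, 2:] ^ 6)"], intro allI ballI)
  fix n q assume q: "q \<in> size_bounded (Qp {Next, DiaR}) n"
  then have "q \<in> Qp {Next, DiaR}" by (simp add: size_bounded_def)
  then obtain Q where Q: "nf Q" "represents Q q" "weight Q \<le> query_size q + 1" by (rule nf_of_query)
  have "\<exists>Q'. nf Q' \<and> represents Q' q' \<and> length Q' \<le> n + 1" if q': "q' \<in> size_bounded (Qp {Next, DiaR}) n" for q'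
  proof -
    have "q' \<in> Qp {Next, DiaR}" using q' by (simp add: size_bounded_def)
    then obtain Q' where "nf Q'" "represents Q' q'" "weight Q' \<le> query_size q' + 1" by (rule nf_of_query)
    moreover from this have "length Q' \<le> n + 1"
      using length_le_weight[of Q'] q' by (simp add: size_bounded_def)
    ultimately show ?thesis by blast
  qed
  then obtain E where "uniquely_characterises E q (size_bounded (Qp {Next, DiaR}) n)"
      "examples_size E \<le> 28 * (weight Q + (n + 1) + 1) ^ 6"
    using small_characterisation[OF Q(1) refl Q(2), of "size_bounded (Qp {Next, DiaR}) n" "n + 1"] by metis
  \<comment> \<open>Here \<open>N\<close> = n + 1 bounds the normal forms of all queries of size at
    most n, and the weight is at most n + 1 as well; the sum is 2n + 3.\<close>
  moreover have "28 * (weight Q + (n + 1) + 1) ^ 6 \<le> poly (smult 28 ([:3, 2:] ^ 6)) n"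
    by (rule polynomial_bound) (use Q q in \<open>simp add: size_bounded_def\<close>)
  ultimately show "\<exists>E. uniquely_characterises E q (size_bounded (Qp {Next, DiaR}) n) \<and>
      examples_size E \<le> poly (smult 28 ([:3, 2:] ^ 6)) n" by (meson order_trans)
qed

lemma poly_strict: "poly_characterisable (Qp {Next, Dia})"
  unfolding poly_characterisable_within_def
proof (rule conjI, blast, rule exI[of _ "smult 28 ([:2, 1:] ^ 6)"], rule ballI)
  fix q assume "q \<in> Qp {Next, Dia}"
  then obtain Q where Q: "nf Q" "represents Q q" "weight Q \<le> query_size q + 1" by (rule nf_of_query)
  \<comment> \<open>Rewriting preserves positive gaps, so strict competitors cannot form the chains
    that imitate a lone conjunct.\<close>
  have "\<exists>Q'. nf Q' \<and> represents Q' q' \<and> positive_gaps Q'" if "q' \<in> Qp {Next, Dia}" for q'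
    by (rule nf_of_query[OF that]) auto
  then obtain E where "uniquely_characterises E q (Qp {Next, Dia})" "examples_size E \<le> 28 * (weight Q + 0 + 1) ^ 6"
    using small_characterisation[OF Q(1) refl Q(2), of "Qp {Next, Dia}" 0] by metis
  moreover have "28 * (weight Q + 0 + 1) ^ 6 \<le> poly (smult 28 ([:2, 1:] ^ 6)) (query_size q)"
    by (rule polynomial_bound) (use Q in simp)
  ultimately show "\<exists>E. uniquely_characterises E q (Qp {Next, Dia}) \<and>
      examples_size E \<le> poly (smult 28 ([:2, 1:] ^ 6)) (query_size q)" by (meson order_trans)
qed

section \<open>Divisions\<close>

definition offset :: "'a list list \<Rightarrow> nat \<Rightarrow> nat" where
  "offset cs i = length (concat (take i cs))"

lemma offset_0 [simp]: "offset cs 0 = 0"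
  by (simp add: offset_def)

lemma offset_Suc: "i < length cs \<Longrightarrow> offset cs (Suc i) = offset cs i + length (cs ! i)"
  by (simp add: offset_def take_Suc_conv_app_nth)

lemma offset_length: "offset cs (length cs) = length (concat cs)"
  by (simp add: offset_def)

lemma nth_concat:
  assumes "i < length cs" "j < length (cs ! i)"
  shows "concat cs ! (offset cs i + j) = cs ! i ! j" "offset cs i + j < length (concat cs)"
proof -
  have "concat cs = concat (take i cs) @ cs ! i @ concat (drop (Suc i) cs)"
    by (metis assms(1) concat.simps(2) concat_append id_take_nth_drop)
  then show "concat cs ! (offset cs i + j) = cs ! i ! j" "offset cs i + j < length (concat cs)"
    using assms(2) by (simp_all add: offset_def nth_append)
qed

lemma concat_index:
  assumes "k < length (concat cs)"
  obtains i j where "i < length cs" "j < length (cs ! i)" "k = offset cs i + j"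
proof -
  have "\<exists>i<length cs. \<exists>j<length (cs ! i). k = offset cs i + j"
    using assms
  proof (induction cs arbitrary: k)
    case (Cons c cs)
    show ?case
    proof (cases "k < length c")
      case True
      then show ?thesis by (intro exI[of _ 0]) auto
    next
      case False
      then have "k - length c < length (concat cs)" using Cons.prems by auto
      then obtain i j where "i < length cs" "j < length (cs ! i)" "k - length c = offset cs i + j"
        using Cons.IH by blast
      then show ?thesis using False by (intro exI[of _ "Suc i"]) (auto simp: offset_def intro!: exI[of _ j])
    qed
  qed simp
  then show ?thesis using that by blast
qed

section \<open>The chain of a division\<close>

definition gap_of :: "tempop list \<Rightarrow> nat" where
  "gap_of R = (if R = [DiaR] then 0 else length R)"

definition block_chain :: "tempop list \<times> block \<Rightarrow> chain" where
  "block_chain = (\<lambda>(R, b). (Some (gap_of R), hd b) # map (Pair None) (tl b))"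

definition chunks :: "division \<Rightarrow> chain list" where
  "chunks d = map (Pair None) (fst d) # map block_chain (snd d)"

abbreviation chain_of :: "division \<Rightarrow> chain" where
  "chain_of d \<equiv> concat (chunks d)"

text \<open>This is (n2). It makes \<open>gap_of\<close>, which counts relations, the true width of
  the merged gap; in a mixed sequence only the strict relations should count.\<close>

definition proper_rels :: "division \<Rightarrow> bool" where
  "proper_rels d \<longleftrightarrow> (\<forall>R \<in> fst ` set (snd d). R = [DiaR] \<or> set R \<subseteq> {Dia})"

context
  fixes d :: division
  assumes wf: "wf_division d" and proper: "proper_rels d"
begin

lemma length_chunks: "length (chunks d) = Suc (last_index d)"
  by (simp add: chunks_def last_index_def)

lemma block_at_in: "i \<le> last_index d \<Longrightarrow> block_at d i \<in> insert (fst d) (snd ` set (snd d))"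
  by (cases i) (auto simp: block_at_def last_index_def)

lemma block_ne: "i \<le> last_index d \<Longrightarrow> block_at d i \<noteq> []"
  using wf block_at_in[of i] unfolding wf_division_def by blast

lemma block_finite: "i \<le> last_index d \<Longrightarrow> \<rho> \<in> set (block_at d i) \<Longrightarrow> finite \<rho>"
  using wf block_at_in[of i] unfolding wf_division_def by blast

lemma rel_at_in: "0 < i \<Longrightarrow> i \<le> last_index d \<Longrightarrow> rel_at d i \<in> fst ` set (snd d)"
  by (cases i) (auto simp: rel_at_def last_index_def)

lemma rel_at_proper: "0 < i \<Longrightarrow> i \<le> last_index d \<Longrightarrow> rel_at d i = [DiaR] \<or> set (rel_at d i) \<subseteq> {Dia}"
  using rel_at_in[of i] proper unfolding proper_rels_def by blast

lemma gap_of_rel_at: "0 < i \<Longrightarrow> i \<le> last_index d \<Longrightarrow> gap_of (rel_at d i) = 0 \<longleftrightarrow> rel_at d i = [DiaR]"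
  using rel_at_in[of i] wf unfolding gap_of_def wf_division_def by (metis length_0_conv)

lemma chunk_nth:
  assumes "i \<le> last_index d"
  shows "length (chunks d ! i) = length (block_at d i)"
    "j < length (block_at d i) \<Longrightarrow> chunks d ! i ! j =
       (if j = 0 \<and> 0 < i then Some (gap_of (rel_at d i)) else None, block_at d i ! j)"
proof -
  have "chunks d ! i = (if i = 0 then map (Pair None) (block_at d i)
      else block_chain (rel_at d i, block_at d i))"
    using assms by (cases i) (auto simp: chunks_def block_at_def rel_at_def last_index_def)
  moreover obtain \<rho> b where "block_at d i = \<rho> # b" using block_ne[OF assms] by (cases "block_at d i") auto
  ultimately show "length (chunks d ! i) = length (block_at d i)"
    "j < length (block_at d i) \<Longrightarrow> chunks d ! i ! j =
       (if j = 0 \<and> 0 < i then Some (gap_of (rel_at d i)) else None, block_at d i ! j)"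
    by (cases "i = 0"; auto simp: block_chain_def nth_Cons split: nat.split)+
qed

abbreviation off :: "nat \<Rightarrow> nat" where
  "off \<equiv> offset (chunks d)"

lemma flat_nth:
  assumes "i \<le> last_index d" "j < length (block_at d i)"
  shows "off i + j < length (chain_of d)"
    "chain_of d ! (off i + j) =
       (if j = 0 \<and> 0 < i then Some (gap_of (rel_at d i)) else None, block_at d i ! j)"
  using nth_concat[of i "chunks d" j] chunk_nth[OF assms(1)] assms length_chunks by auto

lemma flat_index:
  assumes "k < length (chain_of d)"
  obtains i j where "i \<le> last_index d" "j < length (block_at d i)" "k = off i + j"
  using concat_index[OF assms] length_chunks chunk_nth(1) by (metis less_Suc_eq_le)

lemma off_Suc: "i \<le> last_index d \<Longrightarrow> off (Suc i) = off i + length (block_at d i)"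
  using offset_Suc[of i "chunks d"] chunk_nth(1) length_chunks by simp

lemma off_end: "off (Suc (last_index d)) = length (chain_of d)"
  using offset_length[of "chunks d"] length_chunks by simp

lemma off_pos: "0 < i \<Longrightarrow> i \<le> last_index d \<Longrightarrow> 0 < off i"
  using off_Suc[of "i - 1"] block_ne[of "i - 1"] by (cases i) auto

lemma off_zero: "i \<le> last_index d \<Longrightarrow> off i + j = 0 \<longleftrightarrow> i = 0 \<and> j = 0"
  using off_pos[of i] by (cases i) auto

lemma flat_begin:
  assumes "i \<le> last_index d" "j < length (block_at d i)"
  shows "block_begin (chain_of d) (off i + j) \<longleftrightarrow> j = 0"
  using flat_nth(2)[OF assms] off_zero[OF assms(1), of j] by (auto simp: block_begin_def)

lemma flat_end:
  assumes i: "i \<le> last_index d" and j: "j < length (block_at d i)"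
  shows "block_end (chain_of d) (off i + j) \<longleftrightarrow> Suc j = length (block_at d i)"
proof (cases "Suc j = length (block_at d i)")
  case True
  then have next_off: "Suc (off i + j) = off (Suc i)" using off_Suc[OF i] by simp
  show ?thesis
  proof (cases "i = last_index d")
    case True
    then show ?thesis using next_off off_end \<open>Suc j = _\<close> by (simp add: block_end_def)
  next
    case False
    then have Si: "Suc i \<le> last_index d" using i by simp
    then have "fst (chain_of d ! off (Suc i)) \<noteq> None"
      using flat_nth(2)[OF Si, of 0] block_ne[OF Si] by simp
    then show ?thesis using next_off \<open>Suc j = _\<close> by (simp add: block_end_def)
  qed
next
  case False
  then have "Suc j < length (block_at d i)" using j by simp
  from flat_nth[OF i this] show ?thesis using False by (auto simp: block_end_def)
qed

lemma well_formed_flat: "well_formed (chain_of d)"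
proof -
  have z: "(0::nat) \<le> last_index d" "0 < length (block_at d 0)" using block_ne[of 0] by auto
  have "finite (snd (chain_of d ! k))" if k: "k < length (chain_of d)" for k
  proof -
    obtain i j where "i \<le> last_index d" "j < length (block_at d i)" "k = off i + j"
      using flat_index[OF k] .
    then show ?thesis using flat_nth(2)[of i j] block_finite by simp
  qed
  then have "\<forall>(s, \<sigma>) \<in> set (chain_of d). finite \<sigma>"
    by (simp only: all_set_conv_all_nth case_prod_beta) blast
  moreover have "0 < length (chain_of d)" "fst (chain_of d ! 0) = None" using flat_nth[OF z] by auto
  ultimately show ?thesis unfolding well_formed_def by blast
qed

text \<open>The exceptions in (n1) for the initial block all express that the very first point may
  be empty, and \<open>off_zero\<close> identifies it as position 0 of the chain.\<close>

lemma nf_points_iff: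
  "(\<forall>k<length (chain_of d). 0 < k \<longrightarrow> block_begin (chain_of d) k \<or> block_end (chain_of d) k \<longrightarrow>
      snd (chain_of d ! k) \<noteq> {}) \<longleftrightarrow>
   (\<forall>i \<le> last_index d. (i > 0 \<longrightarrow> hd (block_at d i) \<noteq> {}) \<and>
        (i > 0 \<or> \<not> primitive_block (block_at d i) \<longrightarrow> last (block_at d i) \<noteq> {}))"
  (is "?L \<longleftrightarrow> ?R")
proof
  assume L: ?L
  show ?R
  proof (intro allI impI conjI)
    fix i assume i: "i \<le> last_index d"
    let ?b = "block_at d i" let ?j = "length ?b - 1"
    have ne: "?b \<noteq> []" using block_ne[OF i] .
    show "hd ?b \<noteq> {}" if "i > 0"
      using L[rule_format, of "off i + 0"] flat_nth[OF i, of 0] flat_begin[OF i, of 0] ne that off_pos[OF _ i]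
      by (simp add: hd_conv_nth)
    show "last ?b \<noteq> {}" if "i > 0 \<or> \<not> primitive_block ?b"
    proof -
      have j: "?j < length ?b" using ne by simp
      have "\<not> (i = 0 \<and> ?j = 0)" using that ne by (auto simp: primitive_block_def le_Suc_eq)
      then have "0 < off i + ?j" using off_zero[OF i, of ?j] by (metis gr0I)
      then show ?thesis
        using L[rule_format, of "off i + ?j"] flat_nth[OF i j] flat_end[OF i j] ne by (simp add: last_conv_nth)
    qed
  qed
next
  assume R: ?R
  show ?L
  proof (intro allI impI)
    fix k assume k: "k < length (chain_of d)" "0 < k"
      and be: "block_begin (chain_of d) k \<or> block_end (chain_of d) k"
    obtain i j where ij: "i \<le> last_index d" "j < length (block_at d i)" "k = off i + j"
      using flat_index[OF k(1)] .
    have ne: "block_at d i \<noteq> []" using ij by auto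
    have nz: "\<not> (i = 0 \<and> j = 0)" using k(2) ij(3) off_zero[OF ij(1), of j] by (metis less_irrefl)
    have "j = 0 \<or> Suc j = length (block_at d i)" using be flat_begin[OF ij(1,2)] flat_end[OF ij(1,2)] ij by simp
    then have "block_at d i ! j \<noteq> {}"
    proof
      assume "j = 0"
      then have "hd (block_at d i) \<noteq> {}" using R ij nz by blast
      then show ?thesis using ne \<open>j = 0\<close> by (simp add: hd_conv_nth)
    next
      assume j: "Suc j = length (block_at d i)"
      then have "i > 0 \<or> \<not> primitive_block (block_at d i)" using nz by (auto simp: primitive_block_def)
      then have "last (block_at d i) \<noteq> {}" using R ij by blast
      moreover have "last (block_at d i) = block_at d i ! j" using ne j by (simp add: last_conv_nth flip: j)
      ultimately show ?thesis by simp
    qed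
    then show "snd (chain_of d ! k) \<noteq> {}" using flat_nth(2)[OF ij(1,2)] ij by simp
  qed
qed

text \<open>Gaps occur in the chain only where two blocks join, so the points k in question are
  precisely the last points of the blocks before the final one.\<close>

lemma nf_gaps_iff:
  "(\<forall>k. Suc k < length (chain_of d) \<longrightarrow> fst (chain_of d ! Suc k) = Some 0 \<longrightarrow>
      (block_end (chain_of d) (Suc k) \<longrightarrow> \<not> snd (chain_of d ! Suc k) \<subseteq> snd (chain_of d ! k)) \<and>
      (0 < k \<and> block_begin (chain_of d) k \<longrightarrow> \<not> snd (chain_of d ! k) \<subseteq> snd (chain_of d ! Suc k))) \<longleftrightarrow>
   (\<forall>i < last_index d. rel_at d (i + 1) = [DiaR] \<longrightarrow>
      (primitive_block (block_at d (i + 1)) \<longrightarrow> \<not> last (block_at d i) \<supseteq> hd (block_at d (i + 1))) \<and>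
      (i > 0 \<and> primitive_block (block_at d i) \<longrightarrow> \<not> last (block_at d i) \<subseteq> hd (block_at d (i + 1))))"
  (is "(\<forall>k. ?A k \<longrightarrow> ?B k \<longrightarrow> ?C k) \<longleftrightarrow> (\<forall>i<_. ?B' i \<longrightarrow> ?C' i)")
proof -
  have at_join: "?A (off i + (length (block_at d i) - 1)) \<and>
      (?B (off i + (length (block_at d i) - 1)) \<longleftrightarrow> ?B' i) \<and>
      (?C (off i + (length (block_at d i) - 1)) \<longleftrightarrow> ?C' i)"
    if i: "i < last_index d" for i
  proof -
    let ?j = "length (block_at d i) - 1"
    have i': "i \<le> last_index d" "Suc i \<le> last_index d" using i by auto
    have ne: "block_at d i \<noteq> []" "block_at d (Suc i) \<noteq> []" using block_ne i' by auto
    have j: "?j < length (block_at d i)" "0 < length (block_at d (Suc i))" using ne by auto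
    have nx: "Suc (off i + ?j) = off (Suc i) + 0" using off_Suc[OF i'(1)] ne by (cases "block_at d i") auto
    note f1 = flat_nth[OF i'(1) j(1)] and f2 = flat_nth[OF i'(2) j(2)]
    have pb: "primitive_block b \<longleftrightarrow> length b - 1 = 0" if "b \<noteq> []" for b
      using that by (auto simp: primitive_block_def le_Suc_eq)
    have e: "block_end (chain_of d) (off (Suc i) + 0) \<longleftrightarrow> primitive_block (block_at d (Suc i))"
      using flat_end[OF i'(2) j(2)] by (auto simp: primitive_block_def)
    have b: "block_begin (chain_of d) (off i + ?j) \<longleftrightarrow> primitive_block (block_at d i)"
      using flat_begin[OF i'(1) j(1)] pb[OF ne(1)] by simp
    have z: "0 < off i + ?j \<longleftrightarrow> \<not> (i = 0 \<and> ?j = 0)" using off_zero[OF i'(1), of ?j] by auto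
    have s: "snd (chain_of d ! (off i + ?j)) = last (block_at d i)"
      "snd (chain_of d ! (off (Suc i) + 0)) = hd (block_at d (Suc i))"
      using f1 f2 ne by (simp_all add: last_conv_nth hd_conv_nth)
    have g: "fst (chain_of d ! (off (Suc i) + 0)) = Some 0 \<longleftrightarrow> rel_at d (Suc i) = [DiaR]"
      using f2(2) gap_of_rel_at[of "Suc i"] i'(2) by simp
    show ?thesis
      unfolding nx s e b z g using f2(1) pb[OF ne(1)] by (cases "i = 0") (auto simp only: Suc_eq_plus1 neq0_conv)
  qed
  show ?thesis
  proof
    assume "\<forall>k. ?A k \<longrightarrow> ?B k \<longrightarrow> ?C k"
    then show "\<forall>i<last_index d. ?B' i \<longrightarrow> ?C' i" using at_join by blast
  next
    assume R: "\<forall>i<last_index d. ?B' i \<longrightarrow> ?C' i"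
    show "\<forall>k. ?A k \<longrightarrow> ?B k \<longrightarrow> ?C k"
    proof (intro allI impI)
      fix k assume A: "?A k" and B: "?B k"
      then have "k < length (chain_of d)" by simp
      then obtain i j where ij: "i \<le> last_index d" "j < length (block_at d i)" "k = off i + j"
        by (rule flat_index)
      have "block_end (chain_of d) k" using A B by (simp add: block_end_def)
      then have j: "Suc j = length (block_at d i)" using flat_end[OF ij(1,2)] ij by simp
      have "i \<noteq> last_index d" using A ij j off_end off_Suc[OF ij(1)] by auto
      then have i: "i < last_index d" using ij by simp
      have k: "k = off i + (length (block_at d i) - 1)" using ij(3) j by simp
      have "?B' i" using B at_join[OF i] unfolding k by blast
      then have "?C' i" using R i by blast
      then show "?C k" using at_join[OF i] unfolding k by blast
    qed
  qed
qed

lemma nf_chain_of_iff: "nf (chain_of d) \<longleftrightarrow> normal_form d"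
proof -
  have "\<forall>i \<in> {1..last_index d}. rel_at d i = [DiaR] \<or> set (rel_at d i) \<subseteq> {Dia}"
    using rel_at_proper by simp
  then show ?thesis
    unfolding nf_def normal_form_def nf_points_iff nf_gaps_iff using well_formed_flat by blast
qed

lemma lone_chain_of_iff: "(\<exists>k. lone (chain_of d) k) \<longleftrightarrow> (\<exists>i. lone_conjunct d i)"
proof
  assume "\<exists>k. lone (chain_of d) k"
  then obtain k where k: "lone (chain_of d) k" ..
  then have "k < length (chain_of d)" by (simp add: lone_def)
  then obtain i j where ij: "i \<le> last_index d" "j < length (block_at d i)" "k = off i + j"
    by (rule flat_index)
  have "j = 0" "Suc j = length (block_at d i)"
    using k flat_begin[OF ij(1,2)] flat_end[OF ij(1,2)] ij by (auto simp: lone_def)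
  moreover have "0 < i" using k ij calculation off_zero[OF ij(1), of j] by (auto simp: lone_def)
  moreover have "hd (block_at d i) = snd (chain_of d ! k)"
    using flat_nth(2)[OF ij(1,2)] ij calculation by (simp add: hd_conv_nth block_ne)
  ultimately have "lone_conjunct d i"
    using k ij by (simp add: lone_conjunct_def primitive_block_def lone_def)
  then show "\<exists>i. lone_conjunct d i" ..
next
  assume "\<exists>i. lone_conjunct d i"
  then obtain i where i: "0 < i" "i \<le> last_index d" "length (block_at d i) = 1"
      "2 \<le> card (hd (block_at d i))"
    by (auto simp: lone_conjunct_def primitive_block_def)
  then have z: "0 < length (block_at d i)" by simp
  have "lone (chain_of d) (off i + 0)"
    unfolding lone_def
    using flat_nth[OF i(2) z] flat_begin[OF i(2) z] flat_end[OF i(2) z] off_pos[OF i(1,2)] i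
    by (simp add: hd_conv_nth block_ne)
  then show "\<exists>k. lone (chain_of d) k" ..
qed

end

text \<open>Strict diamonds through empty points merge into one gap whose width is their
  number.\<close>

lemma division_steps_chain_sat:
  assumes "R \<noteq> []" "R = [DiaR] \<or> set R \<subseteq> {Dia}"
  shows "chain_sat D x (steps_of (division_steps (R, b)) @ A) = chain_sat D x (block_chain (R, b) @ A)"
proof -
  let ?T = "map (Pair None) (tl b) @ A"
  have tl: "steps_of (map (Pair Next) (tl b)) = map (Pair None) (tl b)" by (simp add: steps_of_def)
  consider "R = [DiaR]" | "set R \<subseteq> {Dia}" using assms by blast
  then show ?thesis
  proof cases
    case 1
    then show ?thesis by (simp add: division_steps_def block_chain_def gap_of_def tl)
  next
    case 2
    obtain n where R: "R = replicate (Suc n) Dia"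
    proof
      show "R = replicate (Suc (length R - 1)) Dia"
        using assms(1) 2 by (intro replicate_eqI) auto
    qed
    have "chain_sat D x (steps_of (replicate n (Dia, {})) @ (Some 1, \<sigma>) # B) = chain_sat D x ((Some (Suc n), \<sigma>) # B)"
      for \<sigma> B
    proof (induction n arbitrary: x)
      case (Suc n)
      have "chain_sat D x (steps_of (replicate (Suc n) (Dia, {})) @ (Some 1, \<sigma>) # B) =
          chain_sat D x ((Some 1, {}) # (Some (Suc n), \<sigma>) # B)"
        by (simp add: Suc.IH[unfolded One_nat_def])
      also have "\<dots> = chain_sat D x ((Some (Suc (Suc n)), \<sigma>) # B)"
        using equiv_merge_gap_gap[of 1 "Suc n"] by (simp only: chain_equiv_def) simp
      finally show ?case .
    qed simp
    moreover have "R \<noteq> [DiaR]" by (simp add: R)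
    then have "gap_of R = Suc n" by (simp add: gap_of_def R)
    moreover have "butlast R = replicate n Dia" "last R = Dia"
      by (simp_all add: R butlast_conv_take last_replicate del: replicate_Suc)
    ultimately show ?thesis
      by (simp add: division_steps_def block_chain_def tl map_replicate)
  qed
qed

lemma represents_division_query:
  assumes wf: "wf_division d" and proper: "proper_rels d"
  shows "represents (chain_of d) (division_query d)" "division_query d \<in> Qp {Next, Dia, DiaR}"
proof -
  obtain b ds where d: "d = (b, ds)" by force
  have b: "b \<noteq> []" "\<forall>\<rho>\<in>set b. finite \<rho>" using wf by (auto simp: wf_division_def d)
  have ds: "R \<noteq> []" "c \<noteq> []" "\<forall>\<rho>\<in>set c. finite \<rho>" "R = [DiaR] \<or> set R \<subseteq> {Dia}" if "(R, c) \<in> set ds" for R c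
    using wf proper that by (force simp: wf_division_def proper_rels_def d)+
  let ?ps = "map (Pair Next) (tl b) @ concat (map division_steps ds)"
  have fin: "finite (hd b)" using b by simp
  have fin': "\<forall>(t, \<sigma>) \<in> set ?ps. t \<in> {Next, Dia, DiaR} \<and> finite \<sigma>"
  proof -
    have "finite \<sigma>" if "(t, \<sigma>) \<in> set (division_steps (R, c))" "(R, c) \<in> set ds" for t \<sigma> R c
      using that ds[OF that(2)] by (auto simp: division_steps_def dest: list.set_sel(2))
    then have "finite \<sigma>" if "(t, \<sigma>) \<in> set ?ps" for t \<sigma>
      using that b by (auto dest: list.set_sel(2))
    moreover have "t \<in> {Next, Dia, DiaR}" for t by (cases t) auto
    ultimately show ?thesis by blast
  qed
  have ds': "\<forall>(R, c)\<in>set ds. R \<noteq> [] \<and> (R = [DiaR] \<or> set R \<subseteq> {Dia})" using ds(1,4) by blast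
  have "chain_sat D x (steps_of (concat (map division_steps ds))) = chain_sat D x (concat (map block_chain ds))"
    for D x using ds'
  proof (induction ds arbitrary: x)
    case (Cons Rc ds)
    obtain R c where Rc: "Rc = (R, c)" by force
    have "chain_sat D x (steps_of (concat (map division_steps (Rc # ds)))) =
        chain_sat D x (block_chain (R, c) @ steps_of (concat (map division_steps ds)))"
      using division_steps_chain_sat[of R D x c] Cons.prems Rc by simp
    also have "\<dots> = chain_sat D x (block_chain (R, c) @ concat (map block_chain ds))"
      by (rule chain_sat_append_cong, rule Cons.IH) (use Cons.prems in simp)
    finally show ?case using Rc by simp
  qed simp
  then have eq: "chain_sat D x (map (Pair None) (tl b) @ steps_of (concat (map division_steps ds))) =
      chain_sat D x (map (Pair None) (tl b) @ concat (map block_chain ds))" for D x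
    by (rule chain_sat_append_cong)
  have tl: "steps_of (map (Pair Next) (tl b)) = map (Pair None) (tl b)" by (simp add: steps_of_def)
  have q: "division_query d = path_query (hd b) ?ps" by (simp add: division_query_def d)
  have "represents ((None, hd b) # steps_of ?ps) (division_query d)"
    unfolding q using fin fin' by (intro represents_path_query) auto
  moreover have "chain_of d = (None, hd b) # map (Pair None) (tl b) @ concat (map block_chain ds)"
    using b by (cases b) (auto simp: chunks_def d)
  ultimately show "represents (chain_of d) (division_query d)"
    by (simp add: represents_def csat_Cons tl eq)
  show "division_query d \<in> Qp {Next, Dia, DiaR}"
    unfolding Qp_def q using fin fin' by blast
qed

lemma division_of_chain:
  assumes "well_formed Q"
  obtains d where "wf_division d" "proper_rels d" "chain_of d = Q"
proof -
  define rel where "rel g = (if g = 0 then [DiaR] else replicate g Dia)" for g :: nat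
  have rel: "rel g \<noteq> []" "set (rel g) \<subseteq> {Dia, DiaR}" "rel g = [DiaR] \<or> set (rel g) \<subseteq> {Dia}"
    "gap_of (rel g) = g" for g
    by (cases g; auto simp: rel_def gap_of_def)+
  obtain \<rho> ps where Q: "Q = (None, \<rho>) # ps" using assms by (cases Q) (auto simp: well_formed_def)
  have fin: "finite \<rho>" "\<forall>(s, \<sigma>)\<in>set ps. finite \<sigma>" using assms Q by (auto simp: well_formed_def)
  \<comment> \<open>A tail of the chain may begin in the middle of a block. Its leading successor
    part b is therefore kept apart until the point that opens the block is reached.\<close>
  have "\<exists>b ds. (\<forall>\<sigma>\<in>set b. finite \<sigma>) \<and>
      (\<forall>(R, c)\<in>set ds. c \<noteq> [] \<and> (\<forall>\<sigma>\<in>set c. finite \<sigma>) \<and> R \<in> range rel) \<and>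
      ps = map (Pair None) b @ concat (map block_chain ds)"
    using fin(2)
  proof (induction ps)
    case Nil
    show ?case by (intro exI[of _ "[]"]) simp
  next
    case (Cons p ps)
    obtain b ds where IH: "\<forall>\<sigma>\<in>set b. finite \<sigma>"
        "\<forall>(R, c)\<in>set ds. c \<noteq> [] \<and> (\<forall>\<sigma>\<in>set c. finite \<sigma>) \<and> R \<in> range rel"
        "ps = map (Pair None) b @ concat (map block_chain ds)"
      using Cons by auto
    obtain s \<sigma> where p: "p = (s, \<sigma>)" by force
    have f: "finite \<sigma>" using Cons.prems p by simp
    show ?case
    proof (cases s)
      case None
      show ?thesis
        by (rule exI[of _ "\<sigma> # b"], rule exI[of _ ds]) (use IH f p None in auto)
    next
      case (Some g)
      show ?thesis
        by (rule exI[of _ "[]"], rule exI[of _ "(rel g, \<sigma> # b) # ds"])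
          (use IH f p Some rel(4) in \<open>auto simp: block_chain_def\<close>)
    qed
  qed
  then obtain b ds where ds: "\<forall>\<sigma>\<in>set b. finite \<sigma>"
      "\<forall>(R, c)\<in>set ds. c \<noteq> [] \<and> (\<forall>\<sigma>\<in>set c. finite \<sigma>) \<and> R \<in> range rel"
      "ps = map (Pair None) b @ concat (map block_chain ds)" by blast
  let ?d = "(\<rho> # b, ds)"
  have "wf_division ?d" using ds fin(1) rel(1,2) by (fastforce simp: wf_division_def)
  moreover have "proper_rels ?d" using ds(2) rel(3) by (fastforce simp: proper_rels_def)
  moreover have "chain_of ?d = Q" using ds(3) Q by (simp add: chunks_def)
  ultimately show ?thesis using that by blast
qed

text \<open>Chains in normal form and divisions in normal form correspond in both directions, with
  the lone conjuncts. The query q' remains because safety speaks of an equivalent query, possibly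
  with strict diamonds.\<close>

lemma safe_iff: "safe q \<longleftrightarrow> (\<exists>Q q'. nf Q \<and> represents Q q' \<and> equivalent q q' \<and> (\<forall>i. \<not> lone Q i))"
proof
  assume "safe q"
  then obtain q' d where d: "equivalent q q'" "is_division_of d q'" "normal_form d" "\<forall>i. \<not> lone_conjunct d i"
    unfolding safe_def by blast
  have wf: "wf_division d" "q' = division_query d" using d by (auto simp: is_division_of_def)
  have proper: "proper_rels d"
    unfolding proper_rels_def
  proof
    fix R assume "R \<in> fst ` set (snd d)"
    then obtain i where i: "i < last_index d" "R = rel_at d (Suc i)"
      by (auto simp: in_set_conv_nth rel_at_def last_index_def)
    then show "R = [DiaR] \<or> set R \<subseteq> {Dia}" using d(3) unfolding normal_form_def by auto
  qed
  show "\<exists>Q q'. nf Q \<and> represents Q q' \<and> equivalent q q' \<and> (\<forall>i. \<not> lone Q i)"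
    using nf_chain_of_iff[OF wf(1) proper] lone_chain_of_iff[OF wf(1) proper]
      represents_division_query(1)[OF wf(1) proper] wf(2) d by blast
next
  assume "\<exists>Q q'. nf Q \<and> represents Q q' \<and> equivalent q q' \<and> (\<forall>i. \<not> lone Q i)"
  then obtain Q q' where Q: "nf Q" "represents Q q'" "equivalent q q'" "\<forall>i. \<not> lone Q i" by blast
  then have "well_formed Q" by (simp add: nf_def)
  then obtain d where d: "wf_division d" "proper_rels d" "chain_of d = Q" by (rule division_of_chain)
  note rep = represents_division_query[OF d(1,2)]
  have "equivalent q (division_query d)"
    using Q rep(1) represents_equivalent[of Q q' "division_query d"] d(3)
    by (simp add: equivalent_iff)
  moreover have "normal_form d" "\<forall>i. \<not> lone_conjunct d i"
    using nf_chain_of_iff[OF d(1,2)] lone_chain_of_iff[OF d(1,2)] Q d(3) by auto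
  ultimately show "safe q"
    unfolding safe_def is_division_of_def using rep(2) d(1) by blast
qed

lemma characterisable_iff_safe:
  assumes q: "q \<in> Qp {Next, DiaR}"
  shows "uniquely_characterisable q (Qp {Next, DiaR}) \<longleftrightarrow> safe q"
proof
  assume uc: "uniquely_characterisable q (Qp {Next, DiaR})"
  obtain Q where Q: "nf Q" "represents Q q" using nf_of_query[OF q] .
  moreover have "\<forall>i. \<not> lone Q i" using lone_not_characterisable[OF Q(1) _ Q(2)] uc by blast
  moreover have "equivalent q q" by (simp add: equivalent_iff)
  ultimately show "safe q" unfolding safe_iff by blast
next
  assume "safe q"
  then obtain Q q' where Q: "nf Q" "represents Q q'" "equivalent q q'" "\<forall>i. \<not> lone Q i"
    unfolding safe_iff by blast
  have "\<exists>P. nf P \<and> represents P p" if "p \<in> Qp {Next, DiaR}" for p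
    by (rule nf_of_query[OF that]) blast
  then obtain E where "uniquely_characterises E q' (Qp {Next, DiaR})"
    using small_characterisation[OF Q(1) refl Q(2), of "Qp {Next, DiaR}" 0] Q(4) by metis
  then have E: "example_set E" "fits q' E" "\<And>p. p \<in> Qp {Next, DiaR} \<Longrightarrow> fits p E \<Longrightarrow> equivalent q' p"
    by (auto simp: uniquely_characterises_def)
  \<comment> \<open>Equivalent queries agree on data instances, and all examples are data instances,
    so the examples found for q' also serve q.\<close>
  have "fits q E"
    using E(1,2) Q(3) by (auto simp: fits_def example_set_def equivalent_iff)
  moreover have "equivalent q p" if "p \<in> Qp {Next, DiaR}" "fits p E" for p
    using E(3)[OF that] Q(3) by (simp add: equivalent_iff)
  ultimately show "uniquely_characterisable q (Qp {Next, DiaR})"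
    unfolding uniquely_characterisable_def uniquely_characterises_def using E(1) by blast
qed

theorem theorem8:
  "(\<forall>q \<in> Qp {Next, DiaR}. uniquely_characterisable q (Qp {Next, DiaR}) \<longleftrightarrow> safe q) \<and>
   poly_characterisable_within
     {q \<in> Qp {Next, DiaR}. uniquely_characterisable q (Qp {Next, DiaR})} (Qp {Next, DiaR}) \<and>
   poly_characterisable_bounded (Qp {Next, DiaR}) \<and>
   poly_characterisable (Qp {Next, Dia})"
  using characterisable_iff_safe poly_within_characterisable poly_bounded_reflexive poly_strict by blast

end
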